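(* Let $n\ge 1$ and let $V\in C^2(\mathbb{T}^n)$ satisfy $V\ge 0$ on $\mathbb{T}^n$, $\{V=0\}=\{x_1,\ldots,x_m\}$ (a finite nonempty set of distinct points), and $D^2V(x_i)$ positive definite for every $1\le i\le m$. For $\varepsilon>0$ let $v^\varepsilon$ be the solution of $$\varepsilon v^\varepsilon-\varepsilon\Delta v^\varepsilon+|Dv^\varepsilon|^2=V\qquad\text{in }\mathbb{T}^n,$$ and let $$v^*(x):=\min_{1\le i\le m}\{\kappa_i+d(x_i,x)\},\qquad x\in\mathbb{T}^n .$$ Then, uniformly for $x\in\mathbb{T}^n$, $$\lim_{\varepsilon\to 0}v^\varepsilon(x)=v^*(x).$$
   Context: $\mathbb{T}^n=\mathbb{R}^n/\mathbb{Z}^n$ is the flat torus. The equation has, for each $\varepsilon>0$, a unique viscosity solution, which is classical. For $1\le i\le m$ set $A_i:=\left(\tfrac12 D^2V(x_i)\right)^{1/2}$ (the positive definite symmetric square root) and $\kappa_i:=\operatorname{tr}A_i$. The critical Mañé potential is $$d(y,x):=\inf_{T>0}\ \inf_{\gamma}\int_0^T\left(\frac{|\dot\gamma(t)|^2}{4}+V(\gamma(t))\right)dt,$$ where the inner infimum is over absolutely continuous curves $\gamma:[0,T]\to\mathbb{T}^n$ with $\gamma(0)=y$, $\gamma(T)=x$. *)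

theory Defs
  imports "HOL-Analysis.Analysis"
begin

text \<open>Functions on the torus are represented by periodic functions on \<open>real ^ 'n\<close>, and points
  of the torus by representatives modulo \<open>int_lattice\<close>.\<close>

definition int_lattice :: "(real ^ 'n) set" where
  "int_lattice = {k. \<forall>i. k $ i \<in> \<int>}"

definition torus_fun :: "(real ^ 'n \<Rightarrow> real) \<Rightarrow> bool" where
  "torus_fun f \<longleftrightarrow> (\<forall>z. \<forall>k\<in>int_lattice. f (z + k) = f z)"

definition grad :: "(real ^ 'n \<Rightarrow> real) \<Rightarrow> real ^ 'n \<Rightarrow> real ^ 'n" where
  "grad f z = (THE D. GDERIV f z :> D)"

definition hess :: "(real ^ 'n \<Rightarrow> real) \<Rightarrow> real ^ 'n \<Rightarrow> real ^ 'n ^ 'n" where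
  "hess f z = jacobian (grad f) (at z)"

definition laplacian :: "(real ^ 'n \<Rightarrow> real) \<Rightarrow> real ^ 'n \<Rightarrow> real" where
  "laplacian f z = trace (hess f z)"

definition C2 :: "(real ^ 'n \<Rightarrow> real) \<Rightarrow> bool" where
  "C2 f \<longleftrightarrow> (\<forall>z. f differentiable at z) \<and> (\<forall>z. grad f differentiable at z)
     \<and> continuous_on UNIV (hess f)"

definition positive_definite :: "real ^ 'n ^ 'n \<Rightarrow> bool" where
  "positive_definite M \<longleftrightarrow> transpose M = M \<and> (\<forall>w. w \<noteq> 0 \<longrightarrow> 0 < w \<bullet> (M *v w))"

text \<open>Meaningful for positive definite \<open>M\<close> only: exactly then a unique such root exists.\<close>

definition pd_sqrt :: "real ^ 'n ^ 'n \<Rightarrow> real ^ 'n ^ 'n" where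
  "pd_sqrt M = (THE B. positive_definite B \<and> B ** B = M)"

definition kappa :: "(real ^ 'n \<Rightarrow> real) \<Rightarrow> real ^ 'n \<Rightarrow> real" where
  "kappa V p = trace (pd_sqrt ((1 / 2) *\<^sub>R hess V p))"

text \<open>Absolute continuity on \<open>{a..b}\<close>: finite families of non-overlapping closed subintervals are
  rendered as divisions of their union.\<close>

definition abs_continuous_curve :: "real \<Rightarrow> real \<Rightarrow> (real \<Rightarrow> real ^ 'n) \<Rightarrow> bool" where
  "abs_continuous_curve a b \<gamma> \<longleftrightarrow>
     (\<forall>e>0. \<exists>\<delta>>0. \<forall>D. D division_of \<Union>D \<and> \<Union>D \<subseteq> {a..b} \<and> (\<Sum>k\<in>D. Sup k - Inf k) < \<delta>
        \<longrightarrow> (\<Sum>k\<in>D. dist (\<gamma> (Inf k)) (\<gamma> (Sup k))) < e)"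

text \<open>Curves in the torus from \<open>y\<close> to \<open>x\<close>, given by their lifts to \<open>real ^ 'n\<close>; the endpoints are
  therefore prescribed only modulo the lattice.\<close>

definition torus_curves :: "real \<Rightarrow> real ^ 'n \<Rightarrow> real ^ 'n \<Rightarrow> (real \<Rightarrow> real ^ 'n) set" where
  "torus_curves T y x =
     {\<gamma>. abs_continuous_curve 0 T \<gamma> \<and> \<gamma> 0 - y \<in> int_lattice \<and> \<gamma> T - x \<in> int_lattice}"

text \<open>The action may be infinite, hence its values in \<open>ennreal\<close>; this presupposes \<open>V \<ge> 0\<close>. The
  derivative of an absolutely continuous curve exists almost everywhere, so that the arbitrary values
  of \<open>vector_derivative\<close> elsewhere do not contribute.\<close>

definition action :: "(real ^ 'n \<Rightarrow> real) \<Rightarrow> real \<Rightarrow> (real \<Rightarrow> real ^ 'n) \<Rightarrow> ennreal" where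
  "action V T \<gamma> =
     (\<integral>\<^sup>+t\<in>{0..T}. ennreal ((norm (vector_derivative \<gamma> (at t)))\<^sup>2 / 4 + V (\<gamma> t)) \<partial>lebesgue)"

text \<open>The infimum is finite for continuous \<open>V \<ge> 0\<close>, since straight segments have finite action.\<close>

definition mane :: "(real ^ 'n \<Rightarrow> real) \<Rightarrow> real ^ 'n \<Rightarrow> real ^ 'n \<Rightarrow> real" where
  "mane V y x = enn2real (INF T\<in>{0<..}. INF \<gamma>\<in>torus_curves T y x. action V T \<gamma>)"

text \<open>Viscosity solutions of \<open>\<epsilon> v - \<epsilon> \<Delta>v + |Dv|\<^sup>2 = V\<close> on the torus.\<close>

definition visc_subsolution :: "real \<Rightarrow> (real ^ 'n \<Rightarrow> real) \<Rightarrow> (real ^ 'n \<Rightarrow> real) \<Rightarrow> bool" where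
  "visc_subsolution \<epsilon> V v \<longleftrightarrow>
     (\<forall>\<phi> z. C2 \<phi> \<and> (\<forall>\<^sub>F y in nhds z. v y - \<phi> y \<le> v z - \<phi> z)
        \<longrightarrow> \<epsilon> * v z - \<epsilon> * laplacian \<phi> z + (norm (grad \<phi> z))\<^sup>2 \<le> V z)"

definition visc_supersolution :: "real \<Rightarrow> (real ^ 'n \<Rightarrow> real) \<Rightarrow> (real ^ 'n \<Rightarrow> real) \<Rightarrow> bool" where
  "visc_supersolution \<epsilon> V v \<longleftrightarrow>
     (\<forall>\<phi> z. C2 \<phi> \<and> (\<forall>\<^sub>F y in nhds z. v z - \<phi> z \<le> v y - \<phi> y)
        \<longrightarrow> V z \<le> \<epsilon> * v z - \<epsilon> * laplacian \<phi> z + (norm (grad \<phi> z))\<^sup>2)"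

definition visc_solution :: "real \<Rightarrow> (real ^ 'n \<Rightarrow> real) \<Rightarrow> (real ^ 'n \<Rightarrow> real) \<Rightarrow> bool" where
  "visc_solution \<epsilon> V v \<longleftrightarrow> torus_fun v \<and> continuous_on UNIV v
     \<and> visc_subsolution \<epsilon> V v \<and> visc_supersolution \<epsilon> V v"

end

theory Submission
  imports Defs
begin

text \<open>
  Why the theorem holds. Near a zero \<open>p\<close> of \<open>V\<close>, with \<open>A\<close> the square root of half the Hessian, \<open>V\<close> is
  \<open>|A h|\<^sup>2\<close> to leading order at \<open>p + h\<close>, and \<open>\<kappa> + h \<bullet> A h / 2\<close> solves the equation up to small errors
  exactly when its Laplacian \<open>tr A\<close> equals its value \<open>\<kappa>\<close> at \<open>p\<close>. So \<open>\<kappa>\<close> is the largest value that the limit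
  can take at \<open>p\<close>. Away from the zeros, the limit solves the eikonal equation \<open>|Dv|\<^sup>2 = V\<close>, whose
  subsolutions grow from \<open>y\<close> to \<open>x\<close> by at most \<open>mane V y x\<close>. Hence \<open>v\<close> tends to the smallest of the functions
  \<open>\<kappa>\<^sub>i + mane V (x i)\<close>, called \<open>vstar\<close> below. Both inequalities are obtained by comparing \<open>v \<epsilon>\<close> with
  explicit functions for small \<open>\<epsilon>\<close>.

  Upper bound (\<open>upper_bound\<close>). Sums of a quadratic form or a cone and a logarithm that blows up at the
  boundary of a ball are local supersolutions, because the square of the gradient of the logarithm
  absorbs its Laplacian. They show that \<open>v \<epsilon>\<close> is at most \<open>\<kappa>\<close>, up to a small error, on a small ball
  around a zero (\<open>visc_subsolution_near_zero\<close>), and that the supremum of \<open>v \<epsilon>\<close> over balls of a fixed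
  radius has slope at most \<open>sqrt V\<close> up to a small error (\<open>visc_subsolution_ball_growth\<close>). Integrating
  this slope along a nearly optimal curve (\<open>curve_growth_le_action\<close>) gives the bound.

  Lower bound (\<open>lower_bound\<close>). The function \<open>vstar\<close> is modified slightly, with a parameter \<open>s < 1\<close>, to
  a function \<open>u\<close> of slope at most \<open>s * sqrt V\<close> such that near each zero \<open>p\<close> only paths from \<open>p\<close> itself
  matter. If \<open>u\<close> exceeded \<open>v \<epsilon>\<close>, doubling the variables would produce a point at which \<open>v \<epsilon>\<close> is touched
  from below by a paraboloid with slope at most \<open>s * sqrt V\<close>. Away from the zeros this contradicts the
  equation. Near \<open>p\<close> it is excluded by a strict quadratic subsolution (\<open>well_barrier\<close>), which
  lies above \<open>u\<close> close to \<open>p\<close> and below \<open>u\<close> on the boundary of a ball; the second property rests on the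
  lower bound for \<open>mane V p\<close> by a truncated quadratic form (\<open>well_calibration\<close>).

  Both halves compare functions with the action along arbitrary absolutely continuous curves. This
  requires that such curves are differentiable almost everywhere, which is proved first, by means
  of the Vitali covering theorem.
\<close>

section \<open>Almost everywhere differentiability of absolutely continuous functions\<close>

text \<open>The condition of \<open>abs_continuous_curve\<close> for values in any metric space, so that it applies to
  the coordinates of a curve and to real functions evaluated along a curve.\<close>

definition abs_cont_on :: "real \<Rightarrow> real \<Rightarrow> (real \<Rightarrow> 'a::metric_space) \<Rightarrow> bool" where
  "abs_cont_on a b f \<longleftrightarrow>
     (\<forall>e>0. \<exists>\<delta>>0. \<forall>D. D division_of \<Union>D \<and> \<Union>D \<subseteq> {a..b} \<and> (\<Sum>k\<in>D. Sup k - Inf k) < \<delta>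
        \<longrightarrow> (\<Sum>k\<in>D. dist (f (Inf k)) (f (Sup k))) < e)"

lemma abs_cont_onD:
  assumes "abs_cont_on a b f" "e > 0"
  obtains \<delta> where "\<delta> > 0"
    "\<And>D. D division_of \<Union>D \<Longrightarrow> \<Union>D \<subseteq> {a..b} \<Longrightarrow> (\<Sum>k\<in>D. Sup k - Inf k) < \<delta>
       \<Longrightarrow> (\<Sum>k\<in>D. dist (f (Inf k)) (f (Sup k))) < e"
  using assms unfolding abs_cont_on_def by meson

lemma sum_division_telescope:
  fixes f :: "real \<Rightarrow> 'a::real_normed_vector"
  assumes "a \<le> b" "d division_of {a..b}"
  shows "(\<Sum>k\<in>d. f (Sup k) - f (Inf k)) = f b - f a"
proof -
  have fin: "finite d" using assms by auto
  have kk: "Inf k \<in> k" if k: "k \<in> d" for k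
  proof -
    obtain u v where "k = cbox u v" "k \<noteq> {}" using division_ofD[OF assms(2)] k by meson
    then show ?thesis by auto
  qed
  have "(\<lambda>k. (Inf k, k)) ` d tagged_division_of {a..b}"
  proof (rule tagged_division_ofI)
    show "\<Union> {K. \<exists>x. (x, K) \<in> (\<lambda>k. (Inf k, k)) ` d} = {a..b}"
      using division_ofD(6)[OF assms(2)] by (auto simp: image_iff)
    show "finite ((\<lambda>k. (Inf k, k)) ` d)" using fin by auto
    fix x K assume "(x, K) \<in> (\<lambda>k. (Inf k, k)) ` d"
    then have K: "K \<in> d" "x = Inf K" by auto
    then show "x \<in> K" "K \<subseteq> {a..b}" "\<exists>a b. K = cbox a b" using kk division_ofD(2,4)[OF assms(2)] by auto
    fix x' K' assume "(x', K') \<in> (\<lambda>k. (Inf k, k)) ` d" "(x, K) \<noteq> (x', K')"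
    then show "interior K \<inter> interior K' = {}" using K division_ofD(5)[OF assms(2)] by auto
  qed
  from additive_tagged_division_1[OF assms(1) this, of f]
  show ?thesis
    by (subst (asm) sum.reindex) (auto simp: inj_on_def)
qed

text \<open>A closed interval is a closed ball of the line, so this is the Vitali covering theorem. The
  countable disjoint subfamily is cut down to a finite one, at the price of measure \<open>\<eta>\<close>, because
  absolute continuity speaks of finite families.\<close>

lemma vitali_intervals:
  fixes P :: "real \<Rightarrow> real \<Rightarrow> bool"
  assumes E: "E \<in> lmeasurable" and G: "open G" "E \<subseteq> G" and \<eta>: "\<eta> > 0"
    and cov: "\<And>x d. x \<in> E \<Longrightarrow> d > 0 \<Longrightarrow> \<exists>u v. u < x \<and> x < v \<and> v - u < d \<and> P u v"
  obtains I where "finite I"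
    "\<And>k. k \<in> I \<Longrightarrow> \<exists>u v. u < v \<and> k = {u..v} \<and> P u v \<and> {u..v} \<subseteq> G"
    "pairwise disjnt I" "measure lebesgue E - \<eta> < measure lebesgue (E \<inter> \<Union>I)"
proof -
  define K where "K = {(u,v). u < v \<and> P u v \<and> {u..v} \<subseteq> G}"
  define c where "c = (\<lambda>(u,v). (u + v) / 2 :: real)"
  define r where "r = (\<lambda>(u,v). (v - u) / 2 :: real)"
  have cb: "cball (c i) (r i) = {fst i..snd i}" for i
    unfolding c_def r_def by (cases i) (auto simp: cball_eq_atLeastAtMost field_simps)
  obtain C where C: "countable C" "C \<subseteq> K"
    "pairwise (\<lambda>i j. disjnt (cball (c i) (r i)) (cball (c j) (r j))) C"
    "negligible (E - (\<Union>i\<in>C. cball (c i) (r i)))"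
  proof (rule Vitali_covering_theorem_cballs[of K r E c])
    show "0 < r i" if "i \<in> K" for i using that unfolding K_def r_def by auto
    show "\<exists>i. i \<in> K \<and> x \<in> cball (c i) (r i) \<and> r i < d" if x: "x \<in> E" and d: "0 < d" for x d
    proof -
      obtain e where e: "e > 0" "ball x e \<subseteq> G" using G x by (meson open_contains_ball subsetD)
      obtain u v where uv: "u < x" "x < v" "v - u < min d e" "P u v"
        using cov[OF x, of "min d e"] d e by auto
      have "{u..v} \<subseteq> ball x e" using uv by (auto simp: dist_real_def)
      then have "(u,v) \<in> K" using uv e unfolding K_def by auto
      moreover have "r (u,v) < d" using uv unfolding r_def by auto
      ultimately show ?thesis using uv cb[of "(u,v)"] by (intro exI[of _ "(u,v)"]) auto
    qed
  qed
  let ?I = "\<lambda>i. {fst i..snd i} :: real set"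
  have meas: "E \<inter> ?I i \<in> lmeasurable" for i
    using E by (metis fmeasurable.Int lmeasurable_interval(1))
  have Eint: "measure lebesgue (E \<inter> \<Union>(?I ` C)) = measure lebesgue E"
  proof -
    have "negligible (E - \<Union>(?I ` C))" using C(4) by (simp add: cb)
    then have "negligible ((E \<inter> \<Union>(?I ` C) - E) \<union> (E - E \<inter> \<Union>(?I ` C)))"
      by (rule negligible_subset) auto
    then have "negligible ((E - E \<inter> \<Union>(?I ` C)) \<union> (E \<inter> \<Union>(?I ` C) - E))"
      by (simp add: Un_commute)
    from measure_negligible_symdiff[OF E this] show ?thesis .
  qed
  obtain D' where D': "D' \<subseteq> (\<lambda>i. E \<inter> ?I i) ` C" "finite D'"
     "measure lebesgue (\<Union>((\<lambda>i. E \<inter> ?I i) ` C)) - \<eta> < measure lebesgue (\<Union>D')"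
  proof (rule measure_countable_Union_approachable[of "(\<lambda>i. E \<inter> ?I i) ` C" \<eta> "measure lebesgue E"])
    show "measure lebesgue (\<Union>D') \<le> measure lebesgue E"
      if "D' \<subseteq> (\<lambda>i. E \<inter> ?I i) ` C" "finite D'" for D'
      using that meas E
      by (intro measure_mono_fmeasurable) (auto intro!: sets.finite_Union)
  qed (use C \<eta> meas in auto)
  then obtain F where F: "F \<subseteq> C" "finite F" "D' = (\<lambda>i. E \<inter> ?I i) ` F"
    by (meson finite_subset_image)
  have U: "\<Union>D' = E \<inter> \<Union>(?I ` F)" "\<Union>((\<lambda>i. E \<inter> ?I i) ` C) = E \<inter> \<Union>(?I ` C)" using F by auto
  show ?thesis
  proof
    show "finite (?I ` F)" using F by auto
    show "\<exists>u v. u < v \<and> k = {u..v} \<and> P u v \<and> {u..v} \<subseteq> G" if "k \<in> ?I ` F" for k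
    proof -
      obtain i where "i \<in> K" "k = ?I i" using \<open>k \<in> ?I ` F\<close> F(1) C(2) by blast
      then show ?thesis unfolding K_def by (cases i) auto
    qed
    show "pairwise disjnt (?I ` F)"
      unfolding pairwise_def
    proof (intro ballI impI)
      fix k k' assume "k \<in> ?I ` F" "k' \<in> ?I ` F" "k \<noteq> k'"
      then obtain i j where "i \<in> F" "j \<in> F" "k = ?I i" "k' = ?I j" "i \<noteq> j" by blast
      then show "disjnt k k'" using C(3) F(1) unfolding pairwise_def cb by blast
    qed
    show "measure lebesgue E - \<eta> < measure lebesgue (E \<inter> \<Union>(?I ` F))"
      using D'(3) Eint by (simp add: U)
  qed
qed

definition disjoint_intervals :: "real set set \<Rightarrow> bool" where
  "disjoint_intervals I \<longleftrightarrow> finite I \<and> pairwise disjnt I \<and> (\<forall>k\<in>I. \<exists>u v. u < v \<and> k = {u..v})"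

lemma disjoint_intervals_division:
  assumes "disjoint_intervals I"
  shows "I division_of \<Union>I"
proof (rule division_ofI)
  show "finite I" using assms by (simp add: disjoint_intervals_def)
  fix k assume k: "k \<in> I"
  then obtain u v where "u < v" "k = {u..v}" using assms unfolding disjoint_intervals_def by blast
  then show "k \<noteq> {}" "\<exists>a b. k = cbox a b" by auto
  show "k \<subseteq> \<Union>I" using k by auto
  fix k' assume "k' \<in> I" "k \<noteq> k'"
  then have "k \<inter> k' = {}" using k assms unfolding disjoint_intervals_def pairwise_def disjnt_def by auto
  then show "interior k \<inter> interior k' = {}" using interior_subset by blast
qed simp

lemma measure_disjoint_intervals:
  assumes "disjoint_intervals I"
  shows "\<Union>I \<in> lmeasurable" "measure lebesgue (\<Union>I) = (\<Sum>k\<in>I. Sup k - Inf k)"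
proof -
  have k: "k \<in> lmeasurable \<and> measure lebesgue k = Sup k - Inf k" if k: "k \<in> I" for k
  proof -
    obtain u v where "u < v" "k = {u..v}" using assms k unfolding disjoint_intervals_def by blast
    then show ?thesis by simp
  qed
  show "\<Union>I \<in> lmeasurable" using assms k unfolding disjoint_intervals_def by (intro fmeasurable.finite_Union) auto
  have "measure lebesgue (\<Union>I) = (\<Sum>k\<in>I. measure lebesgue k)"
    using assms k unfolding disjoint_intervals_def
    by (intro measure_Union'[of I lebesgue, simplified]) (auto simp: pairwise_def disjnt_def)
  also have "\<dots> = (\<Sum>k\<in>I. Sup k - Inf k)" using k by (intro sum.cong) auto
  finally show "measure lebesgue (\<Union>I) = (\<Sum>k\<in>I. Sup k - Inf k)" .
qed

text \<open>\<open>R\<close> consists of the gaps that \<open>J\<close> leaves in the members of \<open>I\<close>. The same \<open>R\<close> serves every \<open>f\<close>: the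
  identity function yields its total length, and then absolute continuity bounds the increments.\<close>

lemma disjoint_intervals_refine:
  assumes I: "disjoint_intervals I" and J: "disjoint_intervals J"
    and JI: "\<And>K. K \<in> J \<Longrightarrow> \<exists>k\<in>I. K \<subseteq> k"
  obtains R where "R division_of \<Union>R" "\<Union>R \<subseteq> \<Union>I"
    "\<And>f::real \<Rightarrow> real. (\<Sum>k\<in>I. f (Sup k) - f (Inf k)) =
        (\<Sum>k\<in>J. f (Sup k) - f (Inf k)) + (\<Sum>k\<in>R. f (Sup k) - f (Inf k))"
proof -
  have finI: "finite I" and finJ: "finite J" using I J unfolding disjoint_intervals_def by auto
  define Jk where "Jk k = {K\<in>J. K \<subseteq> k}" for k
  have "\<exists>q. Jk k \<subseteq> q \<and> q division_of k" if k: "k \<in> I" for k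
  proof -
    obtain u v where uv: "u < v" "k = {u..v}" using I k unfolding disjoint_intervals_def by blast
    have "Jk k division_of \<Union>(Jk k)"
      using disjoint_intervals_division[OF J] by (rule division_of_subset) (auto simp: Jk_def)
    moreover have "\<Union>(Jk k) \<subseteq> cbox u v" using uv unfolding Jk_def by auto
    ultimately obtain q where "Jk k \<subseteq> q" "q division_of cbox u v"
      by (rule partial_division_extend_interval)
    then show ?thesis using uv by auto
  qed
  then obtain q where q: "\<And>k. k \<in> I \<Longrightarrow> Jk k \<subseteq> q k" "\<And>k. k \<in> I \<Longrightarrow> q k division_of k" by metis
  have sep: "K \<noteq> K' \<and> interior K \<inter> interior K' = {}" if "k \<in> I" "k' \<in> I" "k \<noteq> k'" "K \<in> q k" "K' \<in> q k'" for k k' K K'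
  proof -
    have "k \<inter> k' = {}" using that I unfolding disjoint_intervals_def pairwise_def disjnt_def by auto
    moreover have "K \<subseteq> k" "K' \<subseteq> k'" "K \<noteq> {}" using division_ofD(2,3)[OF q(2)] that by auto
    ultimately show ?thesis using interior_subset by blast
  qed
  define R where "R = (\<Union>k\<in>I. q k - Jk k)"
  have finq: "finite (q k)" if "k \<in> I" for k using q(2)[OF that] by auto
  show ?thesis
  proof
    show "\<Union>R \<subseteq> \<Union>I" unfolding R_def using division_ofD(2)[OF q(2)] by blast
    show "R division_of \<Union>R"
    proof (rule division_ofI)
      show "finite R" unfolding R_def using finI finq by auto
      fix K assume K: "K \<in> R"
      then obtain k where k: "k \<in> I" "K \<in> q k" unfolding R_def by auto
      show "K \<noteq> {}" "\<exists>a b. K = cbox a b" using division_ofD(3,4)[OF q(2)] k by auto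
      show "K \<subseteq> \<Union>R" using K by auto
      fix K' assume K': "K' \<in> R" "K \<noteq> K'"
      then obtain k' where k': "k' \<in> I" "K' \<in> q k'" unfolding R_def by auto
      show "interior K \<inter> interior K' = {}"
      proof (cases "k = k'")
        case True then show ?thesis using division_ofD(5)[OF q(2)[OF k(1)]] k k' K'(2) by auto
      next
        case False then show ?thesis using sep k k' by blast
      qed
    qed simp
    fix f :: "real \<Rightarrow> real"
    let ?\<Delta> = "\<lambda>k. f (Sup k) - f (Inf k)"
    have "?\<Delta> k = sum ?\<Delta> (Jk k) + sum ?\<Delta> (q k - Jk k)" if k: "k \<in> I" for k
    proof -
      obtain u v where uv: "u < v" "k = {u..v}" using I k unfolding disjoint_intervals_def by blast
      have "sum ?\<Delta> (q k) = f v - f u" using sum_division_telescope[of u v "q k" f] q(2)[OF k] uv by auto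
      moreover have "sum ?\<Delta> (q k) = sum ?\<Delta> (Jk k) + sum ?\<Delta> (q k - Jk k)"
        using sum.subset_diff[OF q(1)[OF k] finq[OF k], of ?\<Delta>] by simp
      ultimately show ?thesis using uv by auto
    qed
    then have "sum ?\<Delta> I = (\<Sum>k\<in>I. sum ?\<Delta> (Jk k)) + (\<Sum>k\<in>I. sum ?\<Delta> (q k - Jk k))"
      by (simp add: sum.distrib[symmetric])
    also have "(\<Sum>k\<in>I. sum ?\<Delta> (Jk k)) = sum ?\<Delta> (\<Union>k\<in>I. Jk k)"
    proof (rule sum.UNION_disjoint[symmetric])
      show "\<forall>i\<in>I. finite (Jk i)" using finJ unfolding Jk_def by auto
      show "\<forall>i\<in>I. \<forall>j\<in>I. i \<noteq> j \<longrightarrow> Jk i \<inter> Jk j = {}" using sep q(1) by blast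
    qed (rule finI)
    also have "(\<Union>k\<in>I. Jk k) = J" using JI unfolding Jk_def by auto
    also have "(\<Sum>k\<in>I. sum ?\<Delta> (q k - Jk k)) = sum ?\<Delta> R"
      unfolding R_def
    proof (rule sum.UNION_disjoint[symmetric])
      show "\<forall>i\<in>I. finite (q i - Jk i)" using finq by auto
      show "\<forall>i\<in>I. \<forall>j\<in>I. i \<noteq> j \<longrightarrow> (q i - Jk i) \<inter> (q j - Jk j) = {}" using sep by blast
    qed (rule finI)
    finally show "sum ?\<Delta> I = sum ?\<Delta> J + sum ?\<Delta> R" .
  qed
qed

text \<open>The points with slopes above \<open>q\<close> at all scales, over intervals that contain the point in their interior. In
  this form the set is a countable intersection of open sets.\<close>

definition steep :: "(real \<Rightarrow> real) \<Rightarrow> real \<Rightarrow> real set" where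
  "steep f q = {x. \<forall>d>0. \<exists>u v. u < x \<and> x < v \<and> v - u < d \<and> f v - f u > q * (v - u)}"

lemma borel_steep: "steep f q \<in> sets borel"
proof -
  have "steep f q = (\<Inter>n. \<Union>{{u<..<v} |u v. v - u < inverse (Suc n) \<and> f v - f u > q * (v - u)})"
    (is "_ = ?R")
  proof
    show "steep f q \<subseteq> ?R"
    proof
      fix x assume x: "x \<in> steep f q"
      show "x \<in> ?R"
      proof
        fix n
        have "inverse (real (Suc n)) > 0" by simp
        then obtain u v where "u < x" "x < v" "v - u < inverse (Suc n)" "f v - f u > q * (v - u)"
          using x unfolding steep_def by blast
        then show "x \<in> \<Union>{{u<..<v} |u v. v - u < inverse (Suc n) \<and> f v - f u > q * (v - u)}"
          by (intro UnionI[of "{u<..<v}"]) auto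
      qed
    qed
    show "?R \<subseteq> steep f q"
    proof
      fix x assume x: "x \<in> ?R"
      show "x \<in> steep f q"
        unfolding steep_def
      proof (intro CollectI allI impI)
        fix d :: real assume "d > 0"
        then obtain n where n: "inverse (Suc n) < d" using reals_Archimedean by blast
        have "x \<in> \<Union>{{u<..<v} |u v. v - u < inverse (Suc n) \<and> f v - f u > q * (v - u)}"
          using x by blast
        then obtain u v where "x \<in> {u<..<v}" "v - u < inverse (Suc n)" "f v - f u > q * (v - u)" by blast
        then show "\<exists>u v. u < x \<and> x < v \<and> v - u < d \<and> f v - f u > q * (v - u)"
          using n by (intro exI[of _ u] exI[of _ v]) auto
      qed
    qed
  qed
  moreover have "open (\<Union>{{u<..<v} |u v. v - u < inverse (real (Suc n)) \<and> f v - f u > q * (v - u)})" for n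
    by (rule open_Union) auto
  ultimately show ?thesis by (auto intro!: sets.countable_INT)
qed

lemma steep_antimono: "q' \<le> q \<Longrightarrow> steep f q \<subseteq> steep f q'"
  unfolding steep_def
proof (clarify)
  fix x d :: real assume q: "q' \<le> q" and "d > 0"
    and "\<forall>d>0. \<exists>u v. u < x \<and> x < v \<and> v - u < d \<and> f v - f u > q * (v - u)"
  then obtain u v where uv: "u < x" "x < v" "v - u < d" "f v - f u > q * (v - u)" by blast
  then have "q' * (v - u) \<le> q * (v - u)" using q by (intro mult_right_mono) auto
  then show "\<exists>u v. u < x \<and> x < v \<and> v - u < d \<and> f v - f u > q' * (v - u)" using uv
    by (meson le_less_trans)
qed

lemma not_steepD:
  assumes "x \<notin> steep f q"
  obtains d where "d > 0" "\<And>u v. u < x \<Longrightarrow> x < v \<Longrightarrow> v - u < d \<Longrightarrow> f v - f u \<le> q * (v - u)"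
  using assms unfolding steep_def by (simp add: not_less) (meson not_le)

text \<open>The derivative is the supremum of the slopes \<open>q\<close> for which \<open>f\<close> is steep at \<open>x\<close>. Steepness
  involves intervals around \<open>x\<close>; continuity at \<open>x\<close> lets one endpoint tend to \<open>x\<close>, which turns their
  slopes into difference quotients.\<close>

lemma differentiable_if_not_steep:
  fixes f :: "real \<Rightarrow> real"
  assumes cont: "isCont f x"
    and N: "x \<notin> steep f N" "x \<notin> steep (\<lambda>t. - f t) N"
    and pq: "\<And>p q. p \<in> \<rat> \<Longrightarrow> q \<in> \<rat> \<Longrightarrow> p < q \<Longrightarrow> x \<notin> steep f q \<inter> steep (\<lambda>t. - f t) (- p)"
  shows "f differentiable at x"
proof -
  have pq': "x \<notin> steep f q \<inter> steep (\<lambda>t. - f t) (- p)" if "p < q" for p q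
  proof -
    obtain p' where p': "p' \<in> \<rat>" "p < p'" "p' < q" using Rats_dense_in_real[OF \<open>p < q\<close>] by blast
    obtain q' where q': "q' \<in> \<rat>" "p' < q'" "q' < q" using Rats_dense_in_real[of p' q] p'(3) by blast
    show ?thesis
      using pq[OF p'(1) q'(1,2)] steep_antimono[of q' q f] steep_antimono[of "-p'" "-p" "\<lambda>t. - f t"] p' q' by auto
  qed
  define S where "S = {q. x \<in> steep f q}"
  define D where "D = Sup S"
  have bdd: "q \<le> N" if "q \<in> S" for q
    using that N(1) steep_antimono[of N q f] unfolding S_def by force
  have "- N - 1 \<in> S"
  proof -
    obtain d where d: "d > 0" "\<And>u v. u < x \<Longrightarrow> x < v \<Longrightarrow> v - u < d \<Longrightarrow> - f v - - f u \<le> N * (v - u)"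
      using not_steepD[OF N(2)] by blast
    show ?thesis unfolding S_def steep_def
    proof (intro CollectI allI impI)
      fix d' :: real assume d': "d' > 0"
      define h where "h = min d d' / 3"
      have h: "h > 0" "2 * h < d" "2 * h < d'" using d d' unfolding h_def by auto
      have "- f (x + h) - - f (x - h) \<le> N * (x + h - (x - h))" using d(2)[of "x - h" "x + h"] h by auto
      then have "f (x + h) - f (x - h) > (- N - 1) * (x + h - (x - h))" using h by (simp add: algebra_simps)
      then show "\<exists>u v. u < x \<and> x < v \<and> v - u < d' \<and> (- N - 1) * (v - u) < f v - f u"
        using h by (intro exI[of _ "x - h"] exI[of _ "x + h"]) auto
    qed
  qed
  then have ne: "S \<noteq> {}" by auto
  have key: "\<exists>d>0. \<forall>u v. u < x \<longrightarrow> x < v \<longrightarrow> v - u < d \<longrightarrow> \<bar>f v - f u - D * (v - u)\<bar> \<le> e * (v - u)"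
    if e: "e > 0" for e
  proof -
    have "D + e \<notin> S"
      using cSup_upper[of "D + e" S] bdd e unfolding D_def bdd_above_def by auto
    then obtain d1 where d1: "d1 > 0" "\<And>u v. u < x \<Longrightarrow> x < v \<Longrightarrow> v - u < d1 \<Longrightarrow> f v - f u \<le> (D + e) * (v - u)"
      unfolding S_def using not_steepD by blast
    obtain q where q: "q \<in> S" "q > D - e" using less_cSupE[OF _ ne, of "D - e"] e unfolding D_def by auto
    have "x \<notin> steep (\<lambda>t. - f t) (- (D - e))" using pq'[OF q(2)] q(1) unfolding S_def by auto
    then obtain d2 where d2: "d2 > 0" "\<And>u v. u < x \<Longrightarrow> x < v \<Longrightarrow> v - u < d2 \<Longrightarrow> - f v - - f u \<le> - (D - e) * (v - u)"
      using not_steepD by blast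
    show ?thesis
    proof (intro exI[of _ "min d1 d2"] conjI allI impI)
      fix u v assume "u < x" "x < v" "v - u < min d1 d2"
      then show "\<bar>f v - f u - D * (v - u)\<bar> \<le> e * (v - u)" using d1(2)[of u v] d2(2)[of u v]
        by (auto simp: algebra_simps abs_le_iff)
    qed (use d1 d2 in auto)
  qed
  have "(f has_field_derivative D) (at x)"
    unfolding has_field_derivative_def has_derivative_at_alt
  proof (intro conjI allI impI)
    show "bounded_linear ((*) D)" by (rule bounded_linear_mult_right)
    fix e :: real assume e: "e > 0"
    obtain d where d: "d > 0" "\<And>u v. u < x \<Longrightarrow> x < v \<Longrightarrow> v - u < d \<Longrightarrow> \<bar>f v - f u - D * (v - u)\<bar> \<le> e * (v - u)"
      using key[OF e] by blast
    have cx: "(f \<longlongrightarrow> f x) (at_left x)" "(f \<longlongrightarrow> f x) (at_right x)"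
      using cont unfolding isCont_def by (auto simp: filterlim_at_split)
    show "\<exists>d>0. \<forall>y. norm (y - x) < d \<longrightarrow> norm (f y - f x - D * (y - x)) \<le> e * norm (y - x)"
    proof (intro exI[of _ d] conjI allI impI)
      show "d > 0" by fact
      fix y assume y: "norm (y - x) < d"
      consider "y = x" | "y > x" | "y < x" by linarith
      then show "norm (f y - f x - D * (y - x)) \<le> e * norm (y - x)"
      proof cases
        case 2
        have "\<bar>f y - f x - D * (y - x)\<bar> \<le> e * (y - x)"
        proof (rule tendsto_le[OF trivial_limit_at_left_real])
          show "((\<lambda>u. \<bar>f y - f u - D * (y - u)\<bar>) \<longlongrightarrow> \<bar>f y - f x - D * (y - x)\<bar>) (at_left x)"
            by (intro tendsto_intros cx)
          show "((\<lambda>u. e * (y - u)) \<longlongrightarrow> e * (y - x)) (at_left x)" by (intro tendsto_intros)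
          have "\<forall>\<^sub>F u in at_left x. u \<in> {y - d<..<x}"
            using y 2 by (intro eventually_at_left_real) auto
          then show "\<forall>\<^sub>F u in at_left x. \<bar>f y - f u - D * (y - u)\<bar> \<le> e * (y - u)"
            by eventually_elim (use 2 d(2) in auto)
        qed
        then show ?thesis using 2 by simp
      next
        case 3
        have "\<bar>f x - f y - D * (x - y)\<bar> \<le> e * (x - y)"
        proof (rule tendsto_le[OF trivial_limit_at_right_real])
          show "((\<lambda>u. \<bar>f u - f y - D * (u - y)\<bar>) \<longlongrightarrow> \<bar>f x - f y - D * (x - y)\<bar>) (at_right x)"
            by (intro tendsto_intros cx)
          show "((\<lambda>u. e * (u - y)) \<longlongrightarrow> e * (x - y)) (at_right x)" by (intro tendsto_intros)
          have "\<forall>\<^sub>F u in at_right x. u \<in> {x<..<y + d}"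
            using y 3 by (intro eventually_at_right_real) auto
          then show "\<forall>\<^sub>F u in at_right x. \<bar>f u - f y - D * (u - y)\<bar> \<le> e * (u - y)"
            by eventually_elim (use 3 d(2) in auto)
        qed
        moreover have "\<bar>f y - f x - D * (y - x)\<bar> = \<bar>f x - f y - D * (x - y)\<bar>"
          by (simp add: abs_if algebra_simps)
        ultimately show ?thesis using 3 by simp
      qed simp
    qed
  qed
  then show ?thesis by (metis real_differentiable_def)
qed

lemma abs_cont_on_continuous:
  assumes "abs_cont_on a b f"
  shows "continuous_on {a..b} f"
  unfolding continuous_on_iff
proof (intro ballI allI impI)
  fix x e :: real assume x: "x \<in> {a..b}" and e: "e > 0"
  obtain \<delta> where \<delta>: "\<delta> > 0" "\<And>D. D division_of \<Union>D \<Longrightarrow> \<Union>D \<subseteq> {a..b} \<Longrightarrow> (\<Sum>k\<in>D. Sup k - Inf k) < \<delta>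
       \<Longrightarrow> (\<Sum>k\<in>D. dist (f (Inf k)) (f (Sup k))) < e"
    using abs_cont_onD[OF assms e] by blast
  have *: "dist (f u) (f v) < e" if "u \<le> v" "u \<in> {a..b}" "v \<in> {a..b}" "v - u < \<delta>" for u v
  proof -
    have "{{u..v}} division_of \<Union>{{u..v}}" using that division_of_self[of u v] by (simp add: cbox_interval)
    then show ?thesis using \<delta>(2)[of "{{u..v}}"] that by auto
  qed
  show "\<exists>d>0. \<forall>x'\<in>{a..b}. dist x' x < d \<longrightarrow> dist (f x') (f x) < e"
  proof (intro exI[of _ \<delta>] conjI ballI impI)
    fix x' assume x': "x' \<in> {a..b}" "dist x' x < \<delta>"
    show "dist (f x') (f x) < e"
    proof (cases "x \<le> x'")
      case True then show ?thesis using *[of x x'] x x' by (auto simp: dist_commute dist_real_def)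
    next
      case False then show ?thesis using *[of x' x] x x' by (auto simp: dist_real_def)
    qed
  qed fact
qed

lemma abs_cont_on_uminus:
  fixes f :: "real \<Rightarrow> 'a::real_normed_vector"
  shows "abs_cont_on a b f \<Longrightarrow> abs_cont_on a b (\<lambda>t. - f t)"
  unfolding abs_cont_on_def by (simp add: dist_norm norm_minus_commute)

text \<open>If a part of this set inside an interval of length less than \<open>\<delta>\<close> had positive measure, disjoint
  intervals with slope above \<open>N\<close> would fill half of it; their increments add up to less than 1 by
  absolute continuity, which is false for large \<open>N\<close>.\<close>

lemma negligible_steep_unbounded:
  fixes f :: "real \<Rightarrow> real"
  assumes ac: "abs_cont_on a b f"
  shows "negligible {x \<in> {a<..<b}. \<forall>N::nat. x \<in> steep f N}" (is "negligible ?E")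
proof -
  obtain \<delta> where \<delta>: "\<delta> > 0" "\<And>D. D division_of \<Union>D \<Longrightarrow> \<Union>D \<subseteq> {a..b} \<Longrightarrow> (\<Sum>k\<in>D. Sup k - Inf k) < \<delta>
       \<Longrightarrow> (\<Sum>k\<in>D. dist (f (Inf k)) (f (Sup k))) < 1"
    using abs_cont_onD[OF ac zero_less_one] by blast
  have meas: "?E \<in> sets borel"
  proof -
    have "?E = {a<..<b} \<inter> (\<Inter>N::nat. steep f N)" by auto
    then show ?thesis using borel_steep by auto
  qed
  have "\<exists>U. openin (top_of_set ?E) U \<and> x \<in> U \<and> negligible U" if x: "x \<in> ?E" for x
  proof (intro exI conjI)
    let ?U = "?E \<inter> ball x (\<delta>/3)"
    let ?G = "{a<..<b} \<inter> ball x (\<delta>/3)"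
    show "openin (top_of_set ?E) ?U" by (simp add: openin_open_Int)
    show "x \<in> ?U" using x \<delta> by simp
    have UG: "?U \<subseteq> ?G" by auto
    have Ubm: "?U \<in> sets borel" using meas by auto
    have Gl: "?G \<in> lmeasurable" by (simp add: fmeasurable.Int)
    have Um: "?U \<in> lmeasurable" by (rule fmeasurableI2[OF Gl UG]) (use Ubm in auto)
    show "negligible ?U"
    proof (rule ccontr)
      assume "\<not> negligible ?U"
      then have m: "measure lebesgue ?U > 0" (is "?m > 0")
        using Um negligible_iff_measure[of ?U] by (simp add: zero_less_measure_iff less_le)
      have Go: "open ?G" by (intro open_Int) auto
      have m2: "?m / 2 > 0" using m by simp
      obtain N :: nat where N: "real N > 2 / ?m" using reals_Archimedean2 by blast
      obtain I where I: "finite I"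
        "\<And>k. k \<in> I \<Longrightarrow> \<exists>u v. u < v \<and> k = {u..v} \<and> f v - f u > real N * (v - u) \<and> {u..v} \<subseteq> ?G"
        "pairwise disjnt I" "?m - ?m/2 < measure lebesgue (?U \<inter> \<Union>I)"
      proof (rule vitali_intervals[OF Um Go UG m2, of "\<lambda>u v. f v - f u > real N * (v - u)"])
        show "\<exists>u v. u < x \<and> x < v \<and> v - u < d \<and> real N * (v - u) < f v - f u" if "x \<in> ?U" "d > 0" for x d
        proof -
          have "x \<in> steep f N" using that(1) by blast
          then show ?thesis using that(2) unfolding steep_def by blast
        qed
      qed blast
      have dI: "disjoint_intervals I" unfolding disjoint_intervals_def using I by blast
      have IG: "\<Union>I \<subseteq> ?G" using I(2) by blast
      have sumlen: "(\<Sum>k\<in>I. Sup k - Inf k) = measure lebesgue (\<Union>I)"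
        and Il: "\<Union>I \<in> lmeasurable" using measure_disjoint_intervals[OF dI] by auto
      have up: "measure lebesgue (\<Union>I) < \<delta>"
      proof -
        have "measure lebesgue (\<Union>I) \<le> measure lebesgue {x - \<delta>/3..x + \<delta>/3}"
          using IG Il by (intro measure_mono_fmeasurable) (auto simp: ball_eq_greaterThanLessThan dist_real_def)
        then show ?thesis using \<delta>(1) by simp
      qed
      have lo: "measure lebesgue (\<Union>I) > ?m / 2"
      proof -
        have "measure lebesgue (?U \<inter> \<Union>I) \<le> measure lebesgue (\<Union>I)"
          using Il Um by (intro measure_mono_fmeasurable) (auto intro: fmeasurableD fmeasurable.Int)
        then show ?thesis using I(4) by simp
      qed
      have "(\<Sum>k\<in>I. dist (f (Inf k)) (f (Sup k))) < 1"
        by (rule \<delta>(2)[OF disjoint_intervals_division[OF dI]]) (use IG up sumlen in auto)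
      moreover have "(\<Sum>k\<in>I. dist (f (Inf k)) (f (Sup k))) \<ge> (\<Sum>k\<in>I. real N * (Sup k - Inf k))"
      proof (rule sum_mono)
        fix k assume "k \<in> I"
        then obtain u v where "u < v" "k = {u..v}" "f v - f u > real N * (v - u)" using I(2) by blast
        then show "real N * (Sup k - Inf k) \<le> dist (f (Inf k)) (f (Sup k))" by (simp add: dist_real_def)
      qed
      moreover have "(\<Sum>k\<in>I. real N * (Sup k - Inf k)) = real N * measure lebesgue (\<Union>I)"
        by (simp only: sum_distrib_left[symmetric] sumlen)
      moreover have "real N * measure lebesgue (\<Union>I) \<ge> (2 / ?m) * (?m / 2)"
        using N lo m by (intro mult_mono) auto
      ultimately show False using m by simp
    qed
  qed
  then show ?thesis by (intro iffD2[OF locally_negligible_alt[of ?E]] ballI)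
qed

text \<open>Fill the set up to \<open>\<eta>\<close> by disjoint intervals \<open>I\<close> of slope below \<open>p\<close>, and then again, inside these, by
  disjoint intervals \<open>J\<close> of slope above \<open>q\<close>. Both have total length about \<open>m\<close>, so the gaps between them are
  so short that their increments are negligible by absolute continuity. Comparing the increments
  over \<open>I\<close> and \<open>J\<close> gives \<open>q m \<le> p m\<close> up to small errors.\<close>

lemma negligible_steep_crossing:
  fixes f :: "real \<Rightarrow> real"
  assumes ac: "abs_cont_on a b f" and pq: "p < q"
  shows "negligible ({a<..<b} \<inter> steep f q \<inter> steep (\<lambda>t. - f t) (- p))" (is "negligible ?E")
proof (rule ccontr)
  assume nn: "\<not> negligible ?E"
  have Em: "?E \<in> lmeasurable"
  proof (rule fmeasurableI2[of "{a<..<b}"])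
    have "?E \<in> sets borel" by (intro sets.Int borel_steep) auto
    then show "?E \<in> sets lebesgue" by auto
  qed auto
  define m where "m = measure lebesgue ?E"
  have m: "m > 0" using nn Em negligible_iff_measure[of ?E] unfolding m_def
    by (simp add: zero_less_measure_iff less_le)
  define e where "e = (q - p) * m / 4"
  have e: "e > 0" using m pq unfolding e_def by simp
  obtain \<delta> where \<delta>: "\<delta> > 0" "\<And>D. D division_of \<Union>D \<Longrightarrow> \<Union>D \<subseteq> {a..b} \<Longrightarrow> (\<Sum>k\<in>D. Sup k - Inf k) < \<delta>
       \<Longrightarrow> (\<Sum>k\<in>D. dist (f (Inf k)) (f (Sup k))) < e"
    using abs_cont_onD[OF ac e] by blast
  \<comment> \<open>The gaps have length less than \<open>3 \<eta>\<close>; the second bound makes the final inequality contradictory.\<close>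
  define \<eta> where "\<eta> = min (\<delta> / 3) ((q - p) * m / 2 / (2 * (q - p) + 3 * \<bar>p\<bar>))"
  have den: "2 * (q - p) + 3 * \<bar>p\<bar> > 0" using pq by (intro add_pos_nonneg) auto
  have \<eta>: "\<eta> > 0" "3 * \<eta> \<le> \<delta>" unfolding \<eta>_def using \<delta>(1) pq m den by auto
  have \<eta>2: "\<eta> * (2 * (q - p) + 3 * \<bar>p\<bar>) \<le> (q - p) * m / 2"
  proof -
    have "\<eta> \<le> (q - p) * m / 2 / (2 * (q - p) + 3 * \<bar>p\<bar>)" unfolding \<eta>_def by simp
    from this[unfolded pos_le_divide_eq[OF den]] show ?thesis .
  qed
  obtain T where T: "open T" "?E \<subseteq> T" "T - ?E \<in> lmeasurable" "emeasure lebesgue (T - ?E) < ennreal \<eta>"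
    using sets_lebesgue_outer_open[of ?E \<eta>] Em \<eta> by auto
  define G where "G = T \<inter> {a<..<b}"
  have G: "open G" "?E \<subseteq> G" "G \<subseteq> {a<..<b}" unfolding G_def using T by auto
  have Gl: "G \<in> lmeasurable" by (rule fmeasurableI2[of "{a<..<b}"]) (use G in auto)
  have Gm: "measure lebesgue G < m + \<eta>"
  proof -
    have "measure lebesgue (T - ?E) < \<eta>" using T(3,4) \<eta> by (simp add: emeasure_eq_measure2 ennreal_less_iff)
    moreover have "measure lebesgue (G - ?E) \<le> measure lebesgue (T - ?E)"
      using T(3) Gl Em by (intro measure_mono_fmeasurable) (auto simp: G_def)
    moreover have "measure lebesgue (G - ?E) = measure lebesgue G - m"
      unfolding m_def by (intro measurable_measure_Diff) (use Gl Em G(2) in auto)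
    ultimately show ?thesis by linarith
  qed
  obtain I where I: "finite I"
    "\<And>k. k \<in> I \<Longrightarrow> \<exists>u v. u < v \<and> k = {u..v} \<and> f v - f u < p * (v - u) \<and> {u..v} \<subseteq> G"
    "pairwise disjnt I" "measure lebesgue ?E - \<eta> < measure lebesgue (?E \<inter> \<Union>I)"
  proof (rule vitali_intervals[OF Em G(1,2) \<eta>(1), of "\<lambda>u v. f v - f u < p * (v - u)"])
    show "\<exists>u v. u < x \<and> x < v \<and> v - u < d \<and> f v - f u < p * (v - u)" if "x \<in> ?E" "d > 0" for x d
    proof -
      have "x \<in> steep (\<lambda>t. - f t) (- p)" using that(1) by blast
      then obtain u v where "u < x" "x < v" "v - u < d" "(- p) * (v - u) < - f v - - f u"
        using \<open>d > 0\<close> unfolding steep_def by blast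
      then show ?thesis by (intro exI[of _ u] exI[of _ v]) auto
    qed
  qed blast
  have dI: "disjoint_intervals I" unfolding disjoint_intervals_def using I by blast
  have IG: "\<Union>I \<subseteq> G" using I(2) by blast
  \<comment> \<open>Only interior points of the first family can be covered again inside it.\<close>
  define E1 where "E1 = ?E \<inter> \<Union>(interior ` I)"
  have "open (\<Union>(interior ` I))" by auto
  then have "\<Union>(interior ` I) \<in> sets lebesgue" by auto
  then have E1m: "E1 \<in> lmeasurable" unfolding E1_def
    using fmeasurable_Int_fmeasurable[OF Em] by blast
  have E1: "measure lebesgue E1 = measure lebesgue (?E \<inter> \<Union>I)"
  proof (rule measure_negligible_symdiff)
    show "?E \<inter> \<Union>I \<in> lmeasurable"
      using Em measure_disjoint_intervals(1)[OF dI] by (rule fmeasurable.Int)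
    have "(?E \<inter> \<Union>I - E1) \<union> (E1 - ?E \<inter> \<Union>I) \<subseteq> Inf ` I \<union> Sup ` I"
    proof
      fix x assume x: "x \<in> (?E \<inter> \<Union>I - E1) \<union> (E1 - ?E \<inter> \<Union>I)"
      have "E1 \<subseteq> ?E \<inter> \<Union>I" unfolding E1_def using interior_subset by blast
      then obtain k where k: "k \<in> I" "x \<in> k" "x \<notin> interior k" using x unfolding E1_def by blast
      then obtain u v where "u < v" "k = {u..v}" using I(2) by blast
      then have "x = Inf k \<or> x = Sup k" using k by auto
      then show "x \<in> Inf ` I \<union> Sup ` I" using k by auto
    qed
    then show "negligible ((?E \<inter> \<Union>I - E1) \<union> (E1 - ?E \<inter> \<Union>I))"
      by (rule negligible_subset[rotated]) (use I(1) in auto)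
  qed
  have E1G: "E1 \<subseteq> G" using G unfolding E1_def by blast
  obtain J where J: "finite J"
    "\<And>k. k \<in> J \<Longrightarrow> \<exists>u v. u < v \<and> k = {u..v} \<and> (f v - f u > q * (v - u) \<and> (\<exists>k\<in>I. {u..v} \<subseteq> k)) \<and> {u..v} \<subseteq> G"
    "pairwise disjnt J" "measure lebesgue E1 - \<eta> < measure lebesgue (E1 \<inter> \<Union>J)"
  proof (rule vitali_intervals[OF E1m G(1) E1G \<eta>(1), of "\<lambda>u v. f v - f u > q * (v - u) \<and> (\<exists>k\<in>I. {u..v} \<subseteq> k)"])
    show "\<exists>u v. u < x \<and> x < v \<and> v - u < d \<and> f v - f u > q * (v - u) \<and> (\<exists>k\<in>I. {u..v} \<subseteq> k)"
      if "x \<in> E1" "d > 0" for x d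
    proof -
      obtain k where k: "k \<in> I" "x \<in> interior k" using \<open>x \<in> E1\<close> unfolding E1_def by blast
      obtain r where r: "r > 0" "ball x r \<subseteq> k" using k(2) mem_interior by blast
      have "x \<in> steep f q" "min d r > 0" using \<open>x \<in> E1\<close> \<open>d > 0\<close> r unfolding E1_def by auto
      then obtain u v where uv: "u < x" "x < v" "v - u < min d r" "q * (v - u) < f v - f u"
        unfolding steep_def by blast
      have "{u..v} \<subseteq> ball x r" using uv by (auto simp: dist_real_def)
      then show ?thesis using uv k r by (intro exI[of _ u] exI[of _ v]) auto
    qed
  qed blast
  have dJ: "disjoint_intervals J" unfolding disjoint_intervals_def using J by blast
  have JI: "\<exists>k\<in>I. K \<subseteq> k" if "K \<in> J" for K using J(2)[OF that] by blast
  obtain R where R: "R division_of \<Union>R" "\<Union>R \<subseteq> \<Union>I"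
    "\<And>f::real \<Rightarrow> real. (\<Sum>k\<in>I. f (Sup k) - f (Inf k)) =
        (\<Sum>k\<in>J. f (Sup k) - f (Inf k)) + (\<Sum>k\<in>R. f (Sup k) - f (Inf k))"
    by (rule disjoint_intervals_refine[OF dI dJ JI]) (assumption | rule that)+
  define LI where "LI = (\<Sum>k\<in>I. Sup k - Inf k :: real)"
  define LJ where "LJ = (\<Sum>k\<in>J. Sup k - Inf k :: real)"
  define LR where "LR = (\<Sum>k\<in>R. Sup k - Inf k :: real)"
  have L: "LI = LJ + LR" using R(3)[of "\<lambda>x. x"] unfolding LI_def LJ_def LR_def by simp
  have LI: "LI < m + \<eta>"
  proof -
    have "LI = measure lebesgue (\<Union>I)" unfolding LI_def using measure_disjoint_intervals(2)[OF dI] by simp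
    also have "\<dots> \<le> measure lebesgue G"
      using IG Gl measure_disjoint_intervals(1)[OF dI] by (intro measure_mono_fmeasurable) auto
    finally show ?thesis using Gm by simp
  qed
  have LJ: "LJ > m - 2 * \<eta>"
  proof -
    have "LJ = measure lebesgue (\<Union>J)" unfolding LJ_def using measure_disjoint_intervals(2)[OF dJ] by simp
    moreover have "measure lebesgue (E1 \<inter> \<Union>J) \<le> measure lebesgue (\<Union>J)"
      using E1m measure_disjoint_intervals(1)[OF dJ]
      by (intro measure_mono_fmeasurable) (auto intro: fmeasurableD fmeasurable.Int)
    ultimately show ?thesis using J(4) E1 I(4) unfolding m_def by linarith
  qed
  have LR: "LR < 3 * \<eta>" using L LI LJ by linarith
  have "0 \<le> LR" unfolding LR_def
  proof (rule sum_nonneg)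
    fix k assume "k \<in> R"
    then obtain u v where "k = cbox u v" "k \<noteq> {}" using division_ofD(3,4)[OF R(1)] by meson
    then show "0 \<le> Sup k - Inf k" by auto
  qed
  have "(\<Sum>k\<in>R. dist (f (Inf k)) (f (Sup k))) < e"
  proof (rule \<delta>(2)[OF R(1)])
    have "{a<..<b} \<subseteq> {a..b}" by auto
    then show "\<Union>R \<subseteq> {a..b}" using R(2) IG G(3) by (meson order_trans)
    show "(\<Sum>k\<in>R. Sup k - Inf k) < \<delta>" using LR \<eta> unfolding LR_def by linarith
  qed
  moreover have "(\<Sum>k\<in>R. f (Sup k) - f (Inf k)) \<ge> (\<Sum>k\<in>R. - dist (f (Inf k)) (f (Sup k)))"
    by (rule sum_mono) (auto simp: dist_real_def)
  moreover have "(\<Sum>k\<in>R. - dist (f (Inf k)) (f (Sup k))) = - (\<Sum>k\<in>R. dist (f (Inf k)) (f (Sup k)))"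
    by (rule sum_negf)
  moreover have "(\<Sum>k\<in>I. f (Sup k) - f (Inf k)) \<le> p * LI"
    unfolding LI_def sum_distrib_left
  proof (rule sum_mono)
    fix k assume "k \<in> I"
    then obtain u v where "u < v" "k = {u..v}" "f v - f u < p * (v - u)" using I(2) by blast
    then show "f (Sup k) - f (Inf k) \<le> p * (Sup k - Inf k)" by simp
  qed
  moreover have "(\<Sum>k\<in>J. f (Sup k) - f (Inf k)) \<ge> q * LJ"
    unfolding LJ_def sum_distrib_left
  proof (rule sum_mono)
    fix k assume "k \<in> J"
    then obtain u v where "u < v" "k = {u..v}" "f v - f u > q * (v - u)" using J(2) by blast
    then show "f (Sup k) - f (Inf k) \<ge> q * (Sup k - Inf k)" by simp
  qed
  ultimately have "q * LJ - e < p * LI" using R(3)[of f] by linarith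
  then have "(q - p) * LJ < e + p * LR" using L by (simp add: algebra_simps)
  moreover have "p * LR \<le> \<bar>p\<bar> * (3 * \<eta>)"
    using LR \<open>0 \<le> LR\<close> by (intro mult_mono) auto
  moreover have "(q - p) * LJ \<ge> (q - p) * (m - 2 * \<eta>)" using LJ pq by (intro mult_left_mono) auto
  ultimately have "(q - p) * (m - 2 * \<eta>) < e + \<bar>p\<bar> * (3 * \<eta>)" by linarith
  then have "(q - p) * m < e + \<eta> * (2 * (q - p) + 3 * \<bar>p\<bar>)" by (simp add: algebra_simps)
  then show False using \<eta>2 e unfolding e_def by linarith
qed

text \<open>A point of non-differentiability has an infinite derivate or two derivates separated by
  rational numbers; these are countably many null sets.\<close>

theorem abs_cont_on_differentiable_ae:
  fixes f :: "real \<Rightarrow> real"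
  assumes ac: "abs_cont_on a b f"
  shows "negligible {x \<in> {a<..<b}. \<not> f differentiable at x}"
proof -
  let ?A = "{x \<in> {a<..<b}. \<forall>N::nat. x \<in> steep f N}"
  let ?B = "{x \<in> {a<..<b}. \<forall>N::nat. x \<in> steep (\<lambda>t. - f t) N}"
  let ?Q = "{(p,q) \<in> \<rat> \<times> \<rat>. p < (q::real)}"
  let ?C = "\<Union>(p,q)\<in>?Q. {a<..<b} \<inter> steep f q \<inter> steep (\<lambda>t. - f t) (- p)"
  have "countable (\<rat> \<times> \<rat> :: (real \<times> real) set)" by (simp add: countable_rat)
  then have "countable ?Q" by (rule countable_subset[rotated]) blast
  then have "countable ((\<lambda>(p,q). {a<..<b} \<inter> steep f q \<inter> steep (\<lambda>t. - f t) (- p)) ` ?Q)"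
    by (rule countable_image)
  then have "negligible ?C"
  proof (rule negligible_countable_Union)
    fix k assume "k \<in> (\<lambda>(p,q). {a<..<b} \<inter> steep f q \<inter> steep (\<lambda>t. - f t) (- p)) ` ?Q"
    then obtain p q where "p < q" and k: "k = {a<..<b} \<inter> steep f q \<inter> steep (\<lambda>t. - f t) (- p)" by blast
    then show "negligible k" unfolding k by (intro negligible_steep_crossing[OF ac])
  qed
  moreover have "negligible ?A" "negligible ?B"
    using negligible_steep_unbounded[OF ac] negligible_steep_unbounded[OF abs_cont_on_uminus[OF ac]] by auto
  ultimately have "negligible (?A \<union> ?B \<union> ?C)" by (simp add: negligible_Un)
  moreover have "{x \<in> {a<..<b}. \<not> f differentiable at x} \<subseteq> ?A \<union> ?B \<union> ?C"
  proof (rule subsetI, rule ccontr)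
    fix x assume x: "x \<in> {x \<in> {a<..<b}. \<not> f differentiable at x}" and n: "x \<notin> ?A \<union> ?B \<union> ?C"
    have xab: "a < x" "x < b" using x by auto
    have cont: "isCont f x"
      using abs_cont_on_continuous[OF ac] xab by (intro continuous_on_interior) auto
    have "x \<notin> ?A" "x \<notin> ?B" using n by (simp_all only: Un_iff de_Morgan_disj simp_thms)
    then obtain N1 N2 :: nat where "x \<notin> steep f N1" "x \<notin> steep (\<lambda>t. - f t) N2" using xab by auto
    then have N: "x \<notin> steep f (max N1 N2)" "x \<notin> steep (\<lambda>t. - f t) (max N1 N2)"
      using steep_antimono[of "real N1" "real (max N1 N2)" f]
        steep_antimono[of "real N2" "real (max N1 N2)" "\<lambda>t. - f t"] by auto
    have "f differentiable at x"
    proof (rule differentiable_if_not_steep[OF cont N])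
      fix p q :: real assume "p \<in> \<rat>" "q \<in> \<rat>" "p < q"
      then have pq: "(p, q) \<in> ?Q" by auto
      show "x \<notin> steep f q \<inter> steep (\<lambda>t. - f t) (- p)"
      proof
        assume "x \<in> steep f q \<inter> steep (\<lambda>t. - f t) (- p)"
        then have "x \<in> ?C" by (intro UN_I[OF pq]) (use xab in simp)
        then have "x \<in> ?A \<union> ?B \<union> ?C" by (rule UnI2)
        with n show False by (rule notE)
      qed
    qed
    then show False using x by auto
  qed
  ultimately show ?thesis by (rule negligible_subset)
qed

section \<open>Growth of functions along curves of finite action\<close>

lemma abs_continuous_curve_iff: "abs_continuous_curve a b \<gamma> \<longleftrightarrow> abs_cont_on a b \<gamma>"
  unfolding abs_continuous_curve_def abs_cont_on_def ..

text \<open>A local Lipschitz bound suffices, since each term of a sum of increments less than \<open>r\<close> is less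
  than \<open>r\<close>.\<close>

lemma abs_cont_on_dist_le:
  fixes g :: "real \<Rightarrow> 'a::metric_space" and f :: "real \<Rightarrow> 'b::metric_space"
  assumes g: "abs_cont_on a b g" and r: "r > 0" and L: "L \<ge> 0"
    and le: "\<And>s t. s \<in> {a..b} \<Longrightarrow> t \<in> {a..b} \<Longrightarrow> dist (g s) (g t) \<le> r \<Longrightarrow> dist (f s) (f t) \<le> L * dist (g s) (g t)"
  shows "abs_cont_on a b f"
  unfolding abs_cont_on_def
proof (intro allI impI)
  fix e :: real assume e: "e > 0"
  have "min r (e / (L + 1)) > 0" using r e L by simp
  then obtain \<delta> where \<delta>: "\<delta> > 0" "\<And>D. D division_of \<Union>D \<Longrightarrow> \<Union>D \<subseteq> {a..b} \<Longrightarrow> (\<Sum>k\<in>D. Sup k - Inf k) < \<delta>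
       \<Longrightarrow> (\<Sum>k\<in>D. dist (g (Inf k)) (g (Sup k))) < min r (e / (L + 1))"
    using abs_cont_onD[OF g] by blast
  show "\<exists>\<delta>>0. \<forall>D. D division_of \<Union>D \<and> \<Union>D \<subseteq> {a..b} \<and> (\<Sum>k\<in>D. Sup k - Inf k) < \<delta>
        \<longrightarrow> (\<Sum>k\<in>D. dist (f (Inf k)) (f (Sup k))) < e"
  proof (intro exI[of _ \<delta>] conjI allI impI)
    fix D assume "D division_of \<Union>D \<and> \<Union>D \<subseteq> {a..b} \<and> (\<Sum>k\<in>D. Sup k - Inf k) < \<delta>"
    then have D: "D division_of \<Union>D" "\<Union>D \<subseteq> {a..b}" "(\<Sum>k\<in>D. Sup k - Inf k) < \<delta>" by auto
    have S: "(\<Sum>k\<in>D. dist (g (Inf k)) (g (Sup k))) < min r (e / (L + 1))" using \<delta>(2)[OF D] .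
    have fin: "finite D" using D(1) by auto
    have "(\<Sum>k\<in>D. dist (f (Inf k)) (f (Sup k))) \<le> (\<Sum>k\<in>D. L * dist (g (Inf k)) (g (Sup k)))"
    proof (rule sum_mono)
      fix k assume k: "k \<in> D"
      then obtain u v where uv: "k = cbox u v" "k \<noteq> {}" using division_ofD(3,4)[OF D(1)] by meson
      then have "Inf k \<in> k" "Sup k \<in> k" by auto
      then have uk: "Inf k \<in> {a..b}" "Sup k \<in> {a..b}" using k D(2) by blast+
      have "dist (g (Inf k)) (g (Sup k)) \<le> (\<Sum>k\<in>D. dist (g (Inf k)) (g (Sup k)))"
        by (rule member_le_sum[OF k]) (use fin in auto)
      then have "dist (g (Inf k)) (g (Sup k)) \<le> r" using S by simp
      then show "dist (f (Inf k)) (f (Sup k)) \<le> L * dist (g (Inf k)) (g (Sup k))" using le uk by blast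
    qed
    also have "\<dots> = L * (\<Sum>k\<in>D. dist (g (Inf k)) (g (Sup k)))" by (simp add: sum_distrib_left)
    also have "\<dots> \<le> L * (e / (L + 1))" using S L by (intro mult_left_mono) auto
    also have "\<dots> < e" using L e by (simp add: field_simps)
    finally show "(\<Sum>k\<in>D. dist (f (Inf k)) (f (Sup k))) < e" .
  qed fact
qed

lemma abs_cont_on_vector_differentiable_ae:
  fixes \<gamma> :: "real \<Rightarrow> 'a::euclidean_space"
  assumes ac: "abs_cont_on a b \<gamma>"
  shows "negligible {t \<in> {a<..<b}. \<not> \<gamma> differentiable at t}"
proof -
  have "abs_cont_on a b (\<lambda>t. \<gamma> t \<bullet> i)" if "i \<in> Basis" for i
    by (rule abs_cont_on_dist_le[OF ac, of 1 1])
      (use that in \<open>auto simp: dist_norm inner_diff_left[symmetric] intro!: Basis_le_norm\<close>)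
  then have "negligible (\<Union>i\<in>Basis. {t \<in> {a<..<b}. \<not> (\<lambda>t. \<gamma> t \<bullet> i) differentiable at t})"
    using abs_cont_on_differentiable_ae[of a b] by (intro negligible_Union finite_imageI finite_Basis) blast
  moreover have "{t \<in> {a<..<b}. \<not> \<gamma> differentiable at t} \<subseteq> (\<Union>i\<in>Basis. {t \<in> {a<..<b}. \<not> (\<lambda>t. \<gamma> t \<bullet> i) differentiable at t})"
    using differentiable_componentwise_within[of \<gamma> _ UNIV] by auto
  ultimately show ?thesis by (rule negligible_subset)
qed

definition diff_points :: "real \<Rightarrow> (real \<Rightarrow> 'a::real_normed_vector) \<Rightarrow> real set" where
  "diff_points T \<gamma> = {t \<in> {0<..<T}. \<gamma> differentiable at t}"

text \<open>The value 0 off \<open>diff_points\<close> makes this a Lebesgue measurable function on the whole line.\<close>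

definition velocity :: "real \<Rightarrow> (real \<Rightarrow> 'a::real_normed_vector) \<Rightarrow> real \<Rightarrow> 'a" where
  "velocity T \<gamma> t = (if t \<in> diff_points T \<gamma> then vector_derivative \<gamma> (at t) else 0)"

lemma negligible_not_diff_points:
  fixes \<gamma> :: "real \<Rightarrow> 'a::euclidean_space"
  assumes ac: "abs_cont_on 0 T \<gamma>"
  shows "negligible ({0..T} - diff_points T \<gamma>)"
proof -
  have "negligible ({t \<in> {0<..<T}. \<not> \<gamma> differentiable at t} \<union> {0, T})"
    using abs_cont_on_vector_differentiable_ae[OF ac] by (intro negligible_Un) auto
  then show ?thesis by (rule negligible_subset) (auto simp: diff_points_def)
qed

lemma velocity_deriv:
  assumes "t \<in> diff_points T \<gamma>"
  shows "(\<gamma> has_vector_derivative velocity T \<gamma> t) (at t)"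
  using assms unfolding velocity_def diff_points_def by (simp add: vector_derivative_works[symmetric])

lemma diff_points_lebesgue:
  fixes \<gamma> :: "real \<Rightarrow> 'a::euclidean_space"
  assumes ac: "abs_cont_on 0 T \<gamma>"
  shows "diff_points T \<gamma> \<in> sets lebesgue"
proof -
  have "diff_points T \<gamma> = {0..T} - ({0..T} - diff_points T \<gamma>)" by (auto simp: diff_points_def)
  moreover have "{0..T} - diff_points T \<gamma> \<in> sets lebesgue"
    using negligible_not_diff_points[OF ac] by (rule negligible_imp_sets)
  ultimately show ?thesis by (metis sets.Diff lmeasurable_interval(1) fmeasurableD)
qed

lemma continuous_imp_borel_measurable_lebesgue:
  fixes f :: "real \<Rightarrow> 'a::topological_space"
  assumes "continuous_on UNIV f"
  shows "f \<in> borel_measurable lebesgue"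
  using borel_measurable_continuous_onI[OF assms] by (intro measurable_completion) simp

lemma clamp_curve_continuous:
  fixes \<gamma> :: "real \<Rightarrow> 'a::euclidean_space"
  assumes ac: "abs_cont_on 0 T \<gamma>" and T: "0 \<le> T"
  shows "continuous_on UNIV (\<lambda>t. \<gamma> (max 0 (min T t)))"
  by (rule continuous_on_compose2[OF abs_cont_on_continuous[OF ac]]) (use T in \<open>auto intro!: continuous_intros\<close>)

text \<open>Difference quotients converge at the points of differentiability. Freezing the curve outside
  \<open>{0..T}\<close> makes them continuous on the whole line.\<close>

lemma velocity_measurable:
  fixes \<gamma> :: "real \<Rightarrow> 'a::euclidean_space"
  assumes ac: "abs_cont_on 0 T \<gamma>" and T: "0 \<le> T"
  shows "velocity T \<gamma> \<in> borel_measurable lebesgue"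
proof -
  let ?c = "\<lambda>t. \<gamma> (max 0 (min T t))"
  let ?D = "\<lambda>n t. indicat_real (diff_points T \<gamma>) t *\<^sub>R (real (Suc n) *\<^sub>R (?c (t + 1 / real (Suc n)) - ?c t))"
  have meas: "?D n \<in> borel_measurable lebesgue" for n
  proof (rule borel_measurable_scaleR)
    show "indicat_real (diff_points T \<gamma>) \<in> borel_measurable lebesgue"
      by (intro borel_measurable_indicator diff_points_lebesgue[OF ac])
    have "continuous_on UNIV (\<lambda>t. real (Suc n) *\<^sub>R (?c (t + 1 / real (Suc n)) - ?c t))"
      by (intro continuous_intros continuous_on_compose2[OF clamp_curve_continuous[OF ac T], of _ "\<lambda>t. t + 1 / real (Suc n)"]
          clamp_curve_continuous[OF ac T]) auto
    then show "(\<lambda>t. real (Suc n) *\<^sub>R (?c (t + 1 / real (Suc n)) - ?c t)) \<in> borel_measurable lebesgue"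
      by (rule continuous_imp_borel_measurable_lebesgue)
  qed
  have "(\<lambda>n. ?D n t) \<longlonglongrightarrow> velocity T \<gamma> t" for t
  proof (cases "t \<in> diff_points T \<gamma>")
    case False then show ?thesis by (simp add: velocity_def)
  next
    case True
    then have t: "0 < t" "t < T" by (auto simp: diff_points_def)
    have ev: "\<forall>\<^sub>F n in sequentially. 1 / real (Suc n) < T - t"
      using t by (intro order_tendstoD(2)[OF LIMSEQ_inverse_real_of_nat[unfolded inverse_eq_divide]]) auto
    have "((\<lambda>h. (\<gamma> (t + h) - \<gamma> t) /\<^sub>R h) \<longlongrightarrow> velocity T \<gamma> t) (at 0)"
    proof (rule LIM_zero_cancel, rule tendsto_norm_zero_cancel, rule Lim_transform_eventually)
      show "((\<lambda>h. norm (\<gamma> (t + h) - \<gamma> t - h *\<^sub>R velocity T \<gamma> t) / norm h) \<longlongrightarrow> 0) (at 0)"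
        using velocity_deriv[OF True] unfolding has_vector_derivative_def has_derivative_at by blast
      show "\<forall>\<^sub>F h in at 0. norm (\<gamma> (t + h) - \<gamma> t - h *\<^sub>R velocity T \<gamma> t) / norm h
          = norm ((\<gamma> (t + h) - \<gamma> t) /\<^sub>R h - velocity T \<gamma> t)"
      proof (rule eventually_mono)
        show "\<forall>\<^sub>F h in at (0::real). h \<noteq> 0" by (simp add: eventually_at_filter)
        fix h :: real assume "h \<noteq> 0"
        then have "(\<gamma> (t + h) - \<gamma> t) /\<^sub>R h - velocity T \<gamma> t = (\<gamma> (t + h) - \<gamma> t - h *\<^sub>R velocity T \<gamma> t) /\<^sub>R h"
          by (simp add: algebra_simps)
        then show "norm (\<gamma> (t + h) - \<gamma> t - h *\<^sub>R velocity T \<gamma> t) / norm h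
          = norm ((\<gamma> (t + h) - \<gamma> t) /\<^sub>R h - velocity T \<gamma> t)"
          by (simp add: divide_inverse mult.commute)
      qed
    qed
    moreover have "filterlim (\<lambda>n. 1 / real (Suc n)) (at 0) sequentially"
      using LIMSEQ_inverse_real_of_nat by (auto simp: filterlim_at inverse_eq_divide)
    ultimately have "(\<lambda>n. (\<gamma> (t + 1 / real (Suc n)) - \<gamma> t) /\<^sub>R (1 / real (Suc n))) \<longlonglongrightarrow> velocity T \<gamma> t"
      by (rule filterlim_compose)
    then show ?thesis
    proof (rule Lim_transform_eventually)
      show "\<forall>\<^sub>F n in sequentially. (\<gamma> (t + 1 / real (Suc n)) - \<gamma> t) /\<^sub>R (1 / real (Suc n)) = ?D n t"
        using ev
      proof eventually_elim
        case (elim n)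
        then have "max 0 (min T (t + 1 / real (Suc n))) = t + 1 / real (Suc n)" "max 0 (min T t) = t"
          using t by auto
        then show ?case using True by simp
      qed
    qed
  qed
  then show ?thesis by (intro borel_measurable_LIMSEQ_metric[of ?D, OF meas])
qed

text \<open>The arbitrary values of \<open>vector_derivative\<close> fall on a null set, so the integrand is measurable. For a
  non-measurable integrand the integral in \<open>action\<close> would be a lower integral, which is not additive.\<close>

lemma action_eq_velocity:
  fixes \<gamma> :: "real \<Rightarrow> real ^ 'n"
  assumes ac: "abs_cont_on 0 T \<gamma>" and T: "0 \<le> T" and V: "continuous_on UNIV V"
  defines "F \<equiv> \<lambda>t. (norm (velocity T \<gamma> t))\<^sup>2 / 4 + V (\<gamma> (max 0 (min T t)))"
  shows "F \<in> borel_measurable lebesgue"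
    "action V T \<gamma> = (\<integral>\<^sup>+t. ennreal (F t) * indicator {0..T} t \<partial>lebesgue)"
    "(\<lambda>t. ennreal ((norm (vector_derivative \<gamma> (at t)))\<^sup>2 / 4 + V (\<gamma> t)) * indicator {0..T} t) \<in> borel_measurable lebesgue"
proof -
  have "(\<lambda>t. V (\<gamma> (max 0 (min T t)))) \<in> borel_measurable lebesgue"
    by (intro continuous_imp_borel_measurable_lebesgue
        continuous_on_compose2[OF V clamp_curve_continuous[OF ac T]]) auto
  moreover have "(\<lambda>t. (norm (velocity T \<gamma> t))\<^sup>2 / 4) \<in> borel_measurable lebesgue"
    using velocity_measurable[OF ac T] by measurable
  ultimately show m: "F \<in> borel_measurable lebesgue"
    unfolding F_def by (rule borel_measurable_add[rotated])
  have ae: "AE t in lebesgue. ennreal ((norm (vector_derivative \<gamma> (at t)))\<^sup>2 / 4 + V (\<gamma> t)) * indicator {0..T} t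
     = ennreal (F t) * indicator {0..T} t"
  proof (rule AE_I')
    show "{0..T} - diff_points T \<gamma> \<in> null_sets lebesgue"
      using negligible_not_diff_points[OF ac] by (simp add: negligible_iff_null_sets)
    show "{t \<in> space lebesgue. ennreal ((norm (vector_derivative \<gamma> (at t)))\<^sup>2 / 4 + V (\<gamma> t)) * indicator {0..T} t
     \<noteq> ennreal (F t) * indicator {0..T} t} \<subseteq> {0..T} - diff_points T \<gamma>"
      by (auto simp: F_def velocity_def indicator_def diff_points_def max_def min_def)
  qed
  show "action V T \<gamma> = (\<integral>\<^sup>+t. ennreal (F t) * indicator {0..T} t \<partial>lebesgue)"
    unfolding action_def by (rule nn_integral_cong_AE[OF ae])
  have "(\<lambda>t. F t * indicator {0..T} t) \<in> borel_measurable lebesgue"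
    using m by (intro borel_measurable_times borel_measurable_indicator) auto
  then have "(\<lambda>t. ((norm (vector_derivative \<gamma> (at t)))\<^sup>2 / 4 + V (\<gamma> t)) * indicator {0..T} t) \<in> borel_measurable lebesgue"
  proof (rule borel_measurable_AE)
    show "AE t in lebesgue. F t * indicator {0..T} t = ((norm (vector_derivative \<gamma> (at t)))\<^sup>2 / 4 + V (\<gamma> t)) * indicator {0..T} t"
    proof (rule AE_I')
      show "{0..T} - diff_points T \<gamma> \<in> null_sets lebesgue"
        using negligible_not_diff_points[OF ac] by (simp add: negligible_iff_null_sets)
    qed (auto simp: F_def velocity_def indicator_def diff_points_def max_def min_def)
  qed
  then have "(\<lambda>t. ennreal (((norm (vector_derivative \<gamma> (at t)))\<^sup>2 / 4 + V (\<gamma> t)) * indicator {0..T} t)) \<in> borel_measurable lebesgue"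
    by measurable
  moreover have "(\<lambda>t. ennreal (((norm (vector_derivative \<gamma> (at t)))\<^sup>2 / 4 + V (\<gamma> t)) * indicator {0..T} t))
      = (\<lambda>t. ennreal ((norm (vector_derivative \<gamma> (at t)))\<^sup>2 / 4 + V (\<gamma> t)) * indicator {0..T} t)"
    by (auto simp: indicator_def)
  ultimately show "(\<lambda>t. ennreal ((norm (vector_derivative \<gamma> (at t)))\<^sup>2 / 4 + V (\<gamma> t)) * indicator {0..T} t) \<in> borel_measurable lebesgue"
    by simp
qed

lemma sum_content_eq_measure:
  fixes q :: "real set set"
  assumes q: "q division_of S"
  shows "S \<in> lmeasurable" "(\<Sum>k\<in>q. Sup k - Inf k) = measure lebesgue S"
proof -
  have "((\<lambda>x. 1) has_integral measure lborel k) k" if "k \<in> q" for k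
  proof -
    obtain u v where "k = cbox u v" using division_ofD(4)[OF q \<open>k \<in> q\<close>] by blast
    then show ?thesis using has_integral_const[of "1::real" u v] by simp
  qed
  then have "((\<lambda>x. 1) has_integral (\<Sum>k\<in>q. measure lborel k)) S"
    by (intro has_integral_combine_division[OF q]) auto
  moreover have "(\<Sum>k\<in>q. Sup k - Inf k) = (\<Sum>k\<in>q. measure lborel k)"
  proof (rule sum.cong[OF refl])
    fix k assume "k \<in> q"
    then obtain u v where "k = cbox u v" "k \<noteq> {}" using division_ofD(3,4)[OF q] by meson
    then show "Sup k - Inf k = measure lborel k" by auto
  qed
  moreover show "S \<in> lmeasurable" using q lmeasurable_division by blast
  ultimately show "(\<Sum>k\<in>q. Sup k - Inf k) = measure lebesgue S"
    by (metis integral_unique lmeasure_integral)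
qed

text \<open>In a gauge integral this disposes of the tags in \<open>N\<close>: their intervals are kept inside \<open>U\<close>.\<close>

lemma abs_cont_on_sum_near_negligible:
  fixes f :: "real \<Rightarrow> real"
  assumes f: "abs_cont_on a b f" and N: "negligible N" and \<eta>: "\<eta> > 0"
  obtains U where "open U" "N \<subseteq> U"
    "\<And>p. p tagged_partial_division_of {a..b} \<Longrightarrow> (\<And>x K. (x, K) \<in> p \<Longrightarrow> K \<subseteq> U) \<Longrightarrow>
       (\<Sum>(x, K)\<in>p. f (Sup K) - f (Inf K)) \<le> \<eta>"
proof -
  obtain \<delta> where \<delta>: "\<delta> > 0" "\<And>D. D division_of \<Union>D \<Longrightarrow> \<Union>D \<subseteq> {a..b} \<Longrightarrow> (\<Sum>k\<in>D. Sup k - Inf k) < \<delta>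
       \<Longrightarrow> (\<Sum>k\<in>D. dist (f (Inf k)) (f (Sup k))) < \<eta>"
    using abs_cont_onD[OF f \<eta>] by blast
  obtain U where U: "open U" "N \<subseteq> U" "U - N \<in> lmeasurable" "emeasure lebesgue (U - N) < ennreal \<delta>"
    using sets_lebesgue_outer_open[OF negligible_imp_sets[OF N] \<delta>(1)] by blast
  have "U = (U - N) \<union> N" using U(2) by auto
  then have Ul: "U \<in> lmeasurable" using fmeasurable.Un[OF U(3) negligible_imp_measurable[OF N]] by simp
  have "measure lebesgue U \<le> measure lebesgue (U - N) + measure lebesgue N"
    using \<open>U = (U - N) \<union> N\<close> measure_Un_le[of "U - N" lebesgue N] U(3) negligible_imp_sets[OF N]
    by (metis fmeasurableD)
  moreover have "measure lebesgue (U - N) < \<delta>" using U(3,4) \<delta> by (simp add: emeasure_eq_measure2 ennreal_less_iff)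
  ultimately have Um: "measure lebesgue U < \<delta>" using negligible_imp_measure0[OF N] by simp
  show ?thesis
  proof (rule that[OF U(1,2)])
    fix p :: "(real \<times> real set) set" assume p: "p tagged_partial_division_of {a..b}" and K: "\<And>x K. (x, K) \<in> p \<Longrightarrow> K \<subseteq> U"
    have q: "snd ` p division_of \<Union>(snd ` p)" by (rule partial_division_of_tagged_division[OF p])
    have "(\<Sum>(x, K)\<in>p. f (Sup K) - f (Inf K)) = (\<Sum>(x, K)\<in>p. if K = {} then 0 else f (Sup K) - f (Inf K))"
      using tagged_partial_division_ofD(2)[OF p] by (intro sum.cong[OF refl]) fastforce
    also have "\<dots> = (\<Sum>K\<in>snd ` p. if K = {} then 0 else f (Sup K) - f (Inf K))"
    proof (rule sum.over_tagged_division_lemma[OF tagged_partial_division_of_Union_self[OF p]])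
      fix u v :: real assume "box u v = {}"
      then show "(if cbox u v = {} then 0 else f (Sup (cbox u v)) - f (Inf (cbox u v))) = 0"
        by (auto simp: box_eq_empty)
    qed
    also have "\<dots> \<le> (\<Sum>K\<in>snd ` p. dist (f (Inf K)) (f (Sup K)))"
      by (rule sum_mono) (auto simp: dist_real_def)
    also have "\<dots> < \<eta>"
    proof (rule \<delta>(2)[OF q])
      show "\<Union>(snd ` p) \<subseteq> {a..b}" using tagged_partial_division_ofD(3)[OF p] by fastforce
      have "(\<Sum>K\<in>snd ` p. Sup K - Inf K) = measure lebesgue (\<Union>(snd ` p))"
        by (rule sum_content_eq_measure[OF q])
      also have "\<dots> \<le> measure lebesgue U"
      proof (rule measure_mono_fmeasurable)
        show "\<Union>(snd ` p) \<subseteq> U" using K by fastforce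
      qed (use Ul sum_content_eq_measure(1)[OF q] in auto)
      finally show "(\<Sum>K\<in>snd ` p. Sup K - Inf K) < \<delta>" using Um by simp
    qed
    finally show "(\<Sum>(x, K)\<in>p. f (Sup K) - f (Inf K)) \<le> \<eta>" by simp
  qed
qed

text \<open>Where the curve is differentiable, \<open>\<psi> \<circ> \<gamma>\<close> grows at a rate of at most
  \<open>(sqrt V + e) |\<gamma>'| \<le> |\<gamma>'|\<^sup>2 / 4 + (sqrt V + e)\<^sup>2\<close>. The rate is integrated by means of a gauge: the
  increments over a fine tagged division are bounded by Riemann sums of the Lagrangian at tags where
  \<open>\<gamma>\<close> is differentiable, and by the preceding lemma at the other tags. This covers functions \<open>\<psi>\<close> whose
  slope is bounded but which have no derivative.\<close>

theorem curve_growth_le_action: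
  fixes \<gamma> :: "real \<Rightarrow> real ^ 'n" and V \<psi> :: "real ^ 'n \<Rightarrow> real"
  assumes ac: "abs_cont_on 0 T \<gamma>" and T: "0 < T" and V: "continuous_on UNIV V"
    and VB: "\<And>y. 0 \<le> V y" "\<And>y. V y \<le> B"
    and r: "r > 0" and e: "e \<ge> 0"
    and \<psi>: "\<And>y z. dist y z \<le> r \<Longrightarrow> \<bar>\<psi> z - \<psi> y\<bar> \<le> (sqrt (V y) + e) * dist y z"
  shows "ennreal (\<psi> (\<gamma> T) - \<psi> (\<gamma> 0)) \<le> action V T \<gamma> + ennreal ((2 * e * sqrt B + e\<^sup>2) * T)"
proof (cases "action V T \<gamma> = \<infinity>")
  case True then show ?thesis by simp
next
  case False
  define F where "F t = (norm (velocity T \<gamma> t))\<^sup>2 / 4 + V (\<gamma> (max 0 (min T t)))" for t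
  define G where "G = diff_points T \<gamma>"
  note actF = action_eq_velocity[OF ac less_imp_le[OF T] V, folded F_def]
  have F0: "F t \<ge> 0" for t unfolding F_def using VB by simp
  obtain A where A: "A \<ge> 0" "action V T \<gamma> = ennreal A" using False by (cases "action V T \<gamma>") auto
  have B0: "B \<ge> 0" using VB order_trans by blast
  define f where "f t = \<psi> (\<gamma> t)" for t
  define L where "L = sqrt B + e"
  define c where "c = 2 * e * sqrt B + e\<^sup>2"
  have L0: "L \<ge> 0" unfolding L_def using B0 e by simp
  have c0: "c \<ge> 0" unfolding c_def using B0 e by simp
  have VL: "sqrt (V y) + e \<le> L" "0 \<le> sqrt (V y) + e" for y unfolding L_def using VB[of y] e by auto
  have V2: "(sqrt (V y) + e)\<^sup>2 \<le> V y + c" for y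
  proof -
    have "(sqrt (V y) + e)\<^sup>2 = V y + 2 * e * sqrt (V y) + e\<^sup>2" using VB[of y] by (simp add: power2_sum)
    also have "2 * e * sqrt (V y) \<le> 2 * e * sqrt B" using e VB[of y] by (intro mult_left_mono) auto
    finally show ?thesis unfolding c_def by simp
  qed
  have facts: "abs_cont_on 0 T f"
  proof (rule abs_cont_on_dist_le[OF ac r L0])
    fix s t assume st: "dist (\<gamma> s) (\<gamma> t) \<le> r"
    have "dist (f s) (f t) = \<bar>\<psi> (\<gamma> t) - \<psi> (\<gamma> s)\<bar>" unfolding f_def dist_real_def by simp
    also have "\<dots> \<le> (sqrt (V (\<gamma> s)) + e) * dist (\<gamma> s) (\<gamma> t)" by (rule \<psi>[OF st])
    also have "\<dots> \<le> L * dist (\<gamma> s) (\<gamma> t)" using VL by (intro mult_right_mono) auto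
    finally show "dist (f s) (f t) \<le> L * dist (\<gamma> s) (\<gamma> t)" .
  qed
  have int: "(F has_integral A) {0..T}"
  proof -
    have "(\<lambda>t. F t * indicator {0..T} t) \<in> borel_measurable lebesgue"
      using actF(1) by (intro borel_measurable_times borel_measurable_indicator) auto
    moreover have "(\<integral>\<^sup>+t. ennreal (F t * indicator {0..T} t) \<partial>lebesgue) = ennreal A"
      unfolding A(2)[symmetric] actF(2) by (intro nn_integral_cong) (auto simp: indicator_def)
    ultimately have "((\<lambda>t. F t * indicator {0..T} t) has_integral A) UNIV"
      by (subst has_integral_iff_nn_integral_lebesgue) (use F0 A in auto)
    moreover have "(\<lambda>t. F t * indicator {0..T} t) = (\<lambda>t. if t \<in> {0..T} then F t else 0)"
      by (auto simp: indicator_def)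
    ultimately show ?thesis by (simp only: has_integral_restrict_UNIV)
  qed
  have main: "f T - f 0 \<le> (A + c * T) + \<eta> * (2 + L * T)" if \<eta>: "\<eta> > 0" for \<eta>
  proof -
    obtain g1 where g1: "gauge g1"
      "\<And>p. p tagged_division_of {0..T} \<Longrightarrow> g1 fine p \<Longrightarrow> norm ((\<Sum>(x,K)\<in>p. measure lborel K *\<^sub>R F x) - A) < \<eta>"
      using int[unfolded has_integral_real] \<eta> by meson
    obtain U where U: "open U" "{0..T} - G \<subseteq> U"
      "\<And>p. p tagged_partial_division_of {0..T} \<Longrightarrow> (\<And>x K. (x, K) \<in> p \<Longrightarrow> K \<subseteq> U) \<Longrightarrow>
         (\<Sum>(x, K)\<in>p. f (Sup K) - f (Inf K)) \<le> \<eta>"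
      using abs_cont_on_sum_near_negligible[OF facts negligible_not_diff_points[OF ac] \<eta>] unfolding G_def by metis
    have "\<exists>d>0. \<forall>s. dist s t < d \<longrightarrow> dist (\<gamma> s) (\<gamma> t) \<le> (norm (velocity T \<gamma> t) + \<eta>) * \<bar>s - t\<bar> \<and> dist (\<gamma> s) (\<gamma> t) \<le> r"
      if t: "t \<in> G" for t
    proof -
      let ?w = "velocity T \<gamma> t"
      have "\<exists>d>0. \<forall>s. norm (s - t) < d \<longrightarrow> norm (\<gamma> s - \<gamma> t - (s - t) *\<^sub>R ?w) \<le> \<eta> * norm (s - t)"
        using velocity_deriv[of t T \<gamma>] t \<eta> unfolding G_def has_vector_derivative_def has_derivative_at_alt by blast
      then obtain d where d: "d > 0" "\<And>s. norm (s - t) < d \<Longrightarrow> norm (\<gamma> s - \<gamma> t - (s - t) *\<^sub>R ?w) \<le> \<eta> * norm (s - t)"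
        by blast
      have P: "norm ?w + \<eta> > 0" using \<eta> by (simp add: add_nonneg_pos)
      show ?thesis
      proof (intro exI[of _ "min d (r / (norm ?w + \<eta>))"] conjI allI impI)
        show "0 < min d (r / (norm ?w + \<eta>))" using d P r by simp
        fix s assume s: "dist s t < min d (r / (norm ?w + \<eta>))"
        have "norm (\<gamma> s - \<gamma> t) \<le> norm (\<gamma> s - \<gamma> t - (s - t) *\<^sub>R ?w) + norm ((s - t) *\<^sub>R ?w)"
          using norm_triangle_ineq[of "\<gamma> s - \<gamma> t - (s - t) *\<^sub>R ?w" "(s - t) *\<^sub>R ?w"] by simp
        also have "\<dots> \<le> \<eta> * \<bar>s - t\<bar> + \<bar>s - t\<bar> * norm ?w" using d(2)[of s] s by (auto simp: dist_real_def)
        finally show *: "dist (\<gamma> s) (\<gamma> t) \<le> (norm ?w + \<eta>) * \<bar>s - t\<bar>" by (simp add: dist_norm algebra_simps)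
        have "(norm ?w + \<eta>) * \<bar>s - t\<bar> \<le> (norm ?w + \<eta>) * (r / (norm ?w + \<eta>))"
          using s P by (intro mult_left_mono) (auto simp: dist_real_def)
        then show "dist (\<gamma> s) (\<gamma> t) \<le> r" using * P by simp
      qed
    qed
    then obtain dt where dt: "\<And>t. t \<in> G \<Longrightarrow> dt t > 0"
      "\<And>t s. t \<in> G \<Longrightarrow> dist s t < dt t \<Longrightarrow> dist (\<gamma> s) (\<gamma> t) \<le> (norm (velocity T \<gamma> t) + \<eta>) * \<bar>s - t\<bar> \<and> dist (\<gamma> s) (\<gamma> t) \<le> r"
      by metis
    \<comment> \<open>Fineness for the Lagrangian, closeness to the tangent at good tags, confinement to \<open>U\<close> at bad ones.\<close>
    define g where "g t = g1 t \<inter> (if t \<in> G then ball t (dt t) else if t \<in> {0..T} then U else UNIV)" for t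
    have "gauge g"
      unfolding g_def gauge_def using g1(1) U dt(1) by (auto simp: gauge_def open_Int)
    then obtain p where p: "p tagged_division_of {0..T}" "g fine p"
      using fine_division_exists_real by metis
    have finp: "finite p" using p(1) by auto
    have "g1 fine p" using p(2) unfolding fine_def g_def by blast
    then have FA: "(\<Sum>(x,K)\<in>p. measure lborel K *\<^sub>R F x) \<le> A + \<eta>" using g1(2)[OF p(1)] by (auto simp: abs_if split: if_splits)
    define pG where "pG = {(x, K) \<in> p. x \<in> G}"
    define pN where "pN = {(x, K) \<in> p. x \<notin> G}"
    have sub: "pG \<subseteq> p" "pN \<subseteq> p" and un: "p = pG \<union> pN" "pG \<inter> pN = {}" unfolding pG_def pN_def by auto
    have fins: "finite pG" "finite pN" using sub finp finite_subset by auto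
    have cont: "measure lborel K = Sup K - Inf K \<and> Inf K \<le> x \<and> x \<le> Sup K \<and> Inf K \<in> K \<and> Sup K \<in> K" if "(x, K) \<in> p" for x K
    proof -
      obtain u v where "K = cbox u v" using tagged_division_ofD(4)[OF p(1) \<open>(x, K) \<in> p\<close>] by blast
      then show ?thesis using tagged_division_ofD(2)[OF p(1) that] by auto
    qed
    have "f T - f 0 = (\<Sum>(x,K)\<in>p. f (Sup K) - f (Inf K))"
      using additive_tagged_division_1[OF less_imp_le[OF T] p(1), of f] by simp
    also have "\<dots> = (\<Sum>(x,K)\<in>pG. f (Sup K) - f (Inf K)) + (\<Sum>(x,K)\<in>pN. f (Sup K) - f (Inf K))"
      unfolding un(1) by (rule sum.union_disjoint[OF fins un(2)])
    also have "(\<Sum>(x,K)\<in>pN. f (Sup K) - f (Inf K)) \<le> \<eta>"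
    proof (rule U(3))
      show "pN tagged_partial_division_of {0..T}"
        using tagged_partial_division_subset[of p "{0..T}" pN] p(1) sub unfolding tagged_division_of_def by auto
      fix x K assume xK: "(x, K) \<in> pN"
      then have "x \<in> {0..T}" using tagged_division_ofD(2,3)[OF p(1)] sub by blast
      then have "g x \<subseteq> U" using xK unfolding pN_def g_def by auto
      then show "K \<subseteq> U" using p(2) xK sub unfolding fine_def by blast
    qed
    also have "(\<Sum>(x,K)\<in>pG. f (Sup K) - f (Inf K)) \<le> (\<Sum>(x,K)\<in>pG. measure lborel K *\<^sub>R F x + (c + \<eta> * L) * measure lborel K)"
    proof (rule sum_mono, clarify)
      fix x K assume xK: "(x, K) \<in> pG"
      then have xp: "(x, K) \<in> p" "x \<in> G" unfolding pG_def by auto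
      have "K \<subseteq> ball x (dt x)" using p(2) xp unfolding fine_def g_def by fastforce
      then have ends: "dist (Inf K) x < dt x" "dist (Sup K) x < dt x"
        using cont[OF xp(1)] by (auto simp: dist_commute)
      let ?w = "velocity T \<gamma> x"
      have x0T: "max 0 (min T x) = x" using xp(2) unfolding G_def diff_points_def by auto
      have est: "\<bar>f s - f x\<bar> \<le> (sqrt (V (\<gamma> x)) + e) * (norm ?w + \<eta>) * \<bar>s - x\<bar>" if s: "dist s x < dt x" for s
      proof -
        have "\<bar>f s - f x\<bar> \<le> (sqrt (V (\<gamma> x)) + e) * dist (\<gamma> x) (\<gamma> s)"
          unfolding f_def using dt(2)[OF xp(2) s] by (intro \<psi>) (simp add: dist_commute)
        also have "\<dots> \<le> (sqrt (V (\<gamma> x)) + e) * ((norm ?w + \<eta>) * \<bar>s - x\<bar>)"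
          using dt(2)[OF xp(2) s] VL by (intro mult_left_mono) (auto simp: dist_commute)
        finally show ?thesis by (simp add: mult.assoc)
      qed
      have "f (Sup K) - f (Inf K) \<le> \<bar>f (Sup K) - f x\<bar> + \<bar>f (Inf K) - f x\<bar>" by simp
      also have "\<dots> \<le> (sqrt (V (\<gamma> x)) + e) * (norm ?w + \<eta>) * \<bar>Sup K - x\<bar> + (sqrt (V (\<gamma> x)) + e) * (norm ?w + \<eta>) * \<bar>Inf K - x\<bar>"
        using est ends by (intro add_mono) auto
      also have "\<dots> = (sqrt (V (\<gamma> x)) + e) * (norm ?w + \<eta>) * measure lborel K"
      proof -
        have "measure lborel K = \<bar>Sup K - x\<bar> + \<bar>Inf K - x\<bar>" using cont[OF xp(1)] by auto
        then show ?thesis by (simp only: distrib_left)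
      qed
      also have "\<dots> \<le> (F x + (c + \<eta> * L)) * measure lborel K"
      proof (rule mult_right_mono)
        let ?s = "sqrt (V (\<gamma> x)) + e"
        \<comment> \<open>Young inequality.\<close>
        have "?s * norm ?w \<le> (norm ?w)\<^sup>2 / 4 + ?s\<^sup>2"
          using zero_le_power2[of "norm ?w / 2 - ?s"] by (simp add: power2_eq_square algebra_simps)
        moreover have "?s * \<eta> \<le> \<eta> * L" using VL \<eta> by (simp add: mult.commute)
        ultimately show "?s * (norm ?w + \<eta>) \<le> F x + (c + \<eta> * L)"
          using V2[of "\<gamma> x"] unfolding F_def x0T by (simp add: algebra_simps)
      qed simp
      finally show "f (Sup K) - f (Inf K) \<le> measure lborel K *\<^sub>R F x + (c + \<eta> * L) * measure lborel K"
        by (simp add: algebra_simps)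
    qed
    also have "\<dots> \<le> (\<Sum>(x,K)\<in>p. measure lborel K *\<^sub>R F x + (c + \<eta> * L) * measure lborel K)"
      by (rule sum_mono2[OF finp sub(1)]) (use F0 c0 \<eta> L0 in auto)
    also have "\<dots> = (\<Sum>(x,K)\<in>p. measure lborel K *\<^sub>R F x) + (c + \<eta> * L) * (\<Sum>(x,K)\<in>p. measure lborel K)"
      by (simp add: sum.distrib sum_distrib_left case_prod_unfold)
    also have "(\<Sum>(x,K)\<in>p. measure lborel K) = T"
      using additive_content_tagged_division[of p 0 T] p(1) T by (simp add: box_real)
    finally have "f T - f 0 \<le> (\<Sum>(x,K)\<in>p. measure lborel K *\<^sub>R F x) + (c + \<eta> * L) * T + \<eta>" by simp
    then show ?thesis using FA by (simp add: algebra_simps)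
  qed
  have "f T - f 0 \<le> A + c * T"
  proof (rule field_le_epsilon)
    fix \<eta>' :: real assume \<eta>': "\<eta>' > 0"
    have P: "2 + L * T > 0" using L0 T by (simp add: add_pos_nonneg)
    show "f T - f 0 \<le> A + c * T + \<eta>'"
      using main[of "\<eta>' / (2 + L * T)"] \<eta>' P by simp
  qed
  then have "ennreal (f T - f 0) \<le> ennreal (A + c * T)" by (rule ennreal_leI)
  also have "\<dots> = action V T \<gamma> + ennreal (c * T)" using A c0 T by (simp add: ennreal_plus)
  finally show ?thesis unfolding f_def c_def .
qed

section \<open>The critical potential\<close>

lemma abs_cont_on_add:
  fixes f g :: "real \<Rightarrow> 'a::real_normed_vector"
  assumes f: "abs_cont_on a b f" and g: "abs_cont_on a b g"
  shows "abs_cont_on a b (\<lambda>t. f t + g t)"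
  unfolding abs_cont_on_def
proof (intro allI impI)
  fix e :: real assume "e > 0"
  then have e: "e / 2 > 0" by simp
  obtain \<delta>1 where \<delta>1: "\<delta>1 > 0" "\<And>D. D division_of \<Union>D \<Longrightarrow> \<Union>D \<subseteq> {a..b} \<Longrightarrow> (\<Sum>k\<in>D. Sup k - Inf k) < \<delta>1
       \<Longrightarrow> (\<Sum>k\<in>D. dist (f (Inf k)) (f (Sup k))) < e / 2" using abs_cont_onD[OF f e] by blast
  obtain \<delta>2 where \<delta>2: "\<delta>2 > 0" "\<And>D. D division_of \<Union>D \<Longrightarrow> \<Union>D \<subseteq> {a..b} \<Longrightarrow> (\<Sum>k\<in>D. Sup k - Inf k) < \<delta>2
       \<Longrightarrow> (\<Sum>k\<in>D. dist (g (Inf k)) (g (Sup k))) < e / 2" using abs_cont_onD[OF g e] by blast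
  show "\<exists>\<delta>>0. \<forall>D. D division_of \<Union>D \<and> \<Union>D \<subseteq> {a..b} \<and> (\<Sum>k\<in>D. Sup k - Inf k) < \<delta>
        \<longrightarrow> (\<Sum>k\<in>D. dist (f (Inf k) + g (Inf k)) (f (Sup k) + g (Sup k))) < e"
  proof (intro exI[of _ "min \<delta>1 \<delta>2"] conjI allI impI)
    fix D assume "D division_of \<Union>D \<and> \<Union>D \<subseteq> {a..b} \<and> (\<Sum>k\<in>D. Sup k - Inf k) < min \<delta>1 \<delta>2"
    then have D: "D division_of \<Union>D" "\<Union>D \<subseteq> {a..b}" "(\<Sum>k\<in>D. Sup k - Inf k) < \<delta>1" "(\<Sum>k\<in>D. Sup k - Inf k) < \<delta>2" by auto
    have "(\<Sum>k\<in>D. dist (f (Inf k) + g (Inf k)) (f (Sup k) + g (Sup k)))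
      \<le> (\<Sum>k\<in>D. dist (f (Inf k)) (f (Sup k)) + dist (g (Inf k)) (g (Sup k)))"
      by (rule sum_mono) (rule dist_triangle_add)
    also have "\<dots> < e" using \<delta>1(2)[OF D(1-3)] \<delta>2(2)[OF D(1,2,4)] by (simp add: sum.distrib)
    finally show "(\<Sum>k\<in>D. dist (f (Inf k) + g (Inf k)) (f (Sup k) + g (Sup k))) < e" .
  qed (use \<delta>1 \<delta>2 in auto)
qed

lemma abs_cont_on_id: "abs_cont_on a b (\<lambda>t::real. t)"
  unfolding abs_cont_on_def
proof (intro allI impI)
  fix e :: real assume "e > 0"
  moreover have "(\<Sum>k\<in>D. dist (Inf k) (Sup k)) = (\<Sum>k\<in>D. Sup k - Inf k)" if D: "D division_of \<Union>D" for D :: "real set set"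
  proof (rule sum.cong[OF refl])
    fix k assume "k \<in> D"
    then obtain u v where "k = cbox u v" "k \<noteq> {}" using division_ofD(3,4)[OF D] by meson
    then show "dist (Inf k) (Sup k) = Sup k - Inf k" by (auto simp: dist_real_def)
  qed
  ultimately show "\<exists>\<delta>>0. \<forall>D. D division_of \<Union>D \<and> \<Union>D \<subseteq> {a..b} \<and> (\<Sum>k\<in>D. Sup k - Inf k) < \<delta>
        \<longrightarrow> (\<Sum>k\<in>D. dist (Inf k) (Sup k)) < e"
    by (intro exI[of _ e]) auto
qed

lemma abs_cont_on_lipschitz:
  fixes f :: "real \<Rightarrow> 'a::metric_space"
  assumes "0 \<le> L" "\<And>s t. dist (f s) (f t) \<le> L * dist s t"
  shows "abs_cont_on a b f"
  by (rule abs_cont_on_dist_le[OF abs_cont_on_id zero_less_one assms(1)]) (rule assms(2))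

text \<open>A monotone 1-Lipschitz change of time maps non-overlapping intervals to non-overlapping ones and
  does not lengthen them; an interval that collapses to a point has no increment.\<close>

lemma abs_cont_on_comp_mono:
  fixes f :: "real \<Rightarrow> 'a::metric_space"
  assumes f: "abs_cont_on c d f" and s: "\<And>t. t \<in> {a..b} \<Longrightarrow> s t \<in> {c..d}"
    and mono: "\<And>u v. u \<le> v \<Longrightarrow> s u \<le> s v" and lip: "\<And>u v. u \<le> v \<Longrightarrow> s v - s u \<le> v - u"
  shows "abs_cont_on a b (\<lambda>t. f (s t))"
  unfolding abs_cont_on_def
proof (intro allI impI)
  fix e :: real assume "e > 0"
  then obtain \<delta> where \<delta>: "\<delta> > 0" "\<And>D. D division_of \<Union>D \<Longrightarrow> \<Union>D \<subseteq> {c..d} \<Longrightarrow> (\<Sum>k\<in>D. Sup k - Inf k) < \<delta>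
       \<Longrightarrow> (\<Sum>k\<in>D. dist (f (Inf k)) (f (Sup k))) < e" using abs_cont_onD[OF f] by blast
  show "\<exists>\<delta>>0. \<forall>D. D division_of \<Union>D \<and> \<Union>D \<subseteq> {a..b} \<and> (\<Sum>k\<in>D. Sup k - Inf k) < \<delta>
        \<longrightarrow> (\<Sum>k\<in>D. dist (f (s (Inf k))) (f (s (Sup k)))) < e"
  proof (intro exI[of _ \<delta>] conjI allI impI)
    fix D assume "D division_of \<Union>D \<and> \<Union>D \<subseteq> {a..b} \<and> (\<Sum>k\<in>D. Sup k - Inf k) < \<delta>"
    then have D: "D division_of \<Union>D" "\<Union>D \<subseteq> {a..b}" "(\<Sum>k\<in>D. Sup k - Inf k) < \<delta>" by auto
    have fin: "finite D" using D(1) by auto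
    have K: "Inf k \<le> Sup k \<and> k = {Inf k..Sup k} \<and> Inf k \<in> {a..b} \<and> Sup k \<in> {a..b}" if k: "k \<in> D" for k
    proof -
      obtain u v where uv: "k = cbox u v" "k \<noteq> {}" using division_ofD(3,4)[OF D(1)] k by meson
      have "k \<subseteq> {a..b}" using k D(2) by blast
      then show ?thesis using uv by auto
    qed
    define D0 where "D0 = {k\<in>D. s (Inf k) < s (Sup k)}"
    define I where "I k = {s (Inf k)..s (Sup k)}" for k
    have D0: "finite D0" "D0 \<subseteq> D" using fin unfolding D0_def by auto
    have sep: "interior (I k) \<inter> interior (I k') = {}" if k: "k \<in> D0" "k' \<in> D0" "k \<noteq> k'" for k k'
    proof -
      have kD: "k \<in> D" "k' \<in> D" using k D0 by auto
      have lt: "Inf k < Sup k" "Inf k' < Sup k'"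
        using k mono[of "Sup k" "Inf k"] mono[of "Sup k'" "Inf k'"] unfolding D0_def by (force simp: not_less)+
      have "interior k \<inter> interior k' = {}" using division_ofD(5)[OF D(1) kD k(3)] .
      then have "{Inf k<..<Sup k} \<inter> {Inf k'<..<Sup k'} = {}"
        using K[OF kD(1)] K[OF kD(2)] interior_atLeastAtMost_real by metis
      then have "Sup k \<le> Inf k' \<or> Sup k' \<le> Inf k"
        using lt greaterThanLessThan_empty_iff[of "max (Inf k) (Inf k')" "min (Sup k) (Sup k')"]
        by (auto simp: Int_greaterThanLessThan max_def min_def split: if_splits)
      then have "s (Sup k) \<le> s (Inf k') \<or> s (Sup k') \<le> s (Inf k)" using mono by blast
      then show ?thesis unfolding I_def by auto
    qed
    have ne: "interior (I k) \<noteq> {}" if "k \<in> D0" for k using that unfolding D0_def I_def by auto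
    have inj: "inj_on I D0" using sep ne by (metis inf.idem inj_onI)
    have div: "I ` D0 division_of \<Union>(I ` D0)"
    proof (rule division_ofI)
      fix k assume "k \<in> I ` D0"
      then obtain k0 where k0: "k0 \<in> D0" "k = I k0" by auto
      show "k \<noteq> {}" using ne[OF k0(1)] k0(2) interior_subset by blast
      show "\<exists>a b. k = cbox a b" unfolding k0(2) I_def cbox_interval[symmetric] by blast
      fix k' assume "k' \<in> I ` D0" "k \<noteq> k'"
      then show "interior k \<inter> interior k' = {}" using sep k0 by auto
    qed (use D0 in auto)
    have SI: "Sup (I k) = s (Sup k)" "Inf (I k) = s (Inf k)" if "k \<in> D0" for k using that unfolding I_def D0_def by auto
    have "(\<Sum>k\<in>D. dist (f (s (Inf k))) (f (s (Sup k)))) = (\<Sum>k\<in>D0. dist (f (s (Inf k))) (f (s (Sup k))))"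
    proof (rule sum.mono_neutral_right[OF fin D0(2)], rule ballI)
      fix k assume "k \<in> D - D0"
      then have "s (Inf k) = s (Sup k)" using K mono[of "Inf k" "Sup k"] unfolding D0_def by force
      then show "dist (f (s (Inf k))) (f (s (Sup k))) = 0" by simp
    qed
    also have "\<dots> = (\<Sum>k\<in>I ` D0. dist (f (Inf k)) (f (Sup k)))"
      using SI by (simp add: sum.reindex[OF inj])
    also have "\<dots> < e"
    proof (rule \<delta>(2)[OF div])
      show "\<Union>(I ` D0) \<subseteq> {c..d}"
      proof
        fix t assume "t \<in> \<Union>(I ` D0)"
        then obtain k where "k \<in> D" "t \<in> {s (Inf k)..s (Sup k)}" using D0 unfolding I_def by auto
        then show "t \<in> {c..d}" using K[of k] s[of "Inf k"] s[of "Sup k"] by auto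
      qed
      have "(\<Sum>k\<in>I ` D0. Sup k - Inf k) = (\<Sum>k\<in>D0. s (Sup k) - s (Inf k))"
        using SI by (simp add: sum.reindex[OF inj])
      also have "\<dots> \<le> (\<Sum>k\<in>D0. Sup k - Inf k)"
        by (intro sum_mono lip) (use K D0 in auto)
      also have "\<dots> \<le> (\<Sum>k\<in>D. Sup k - Inf k)"
        by (rule sum_mono2[OF fin D0(2)]) (use K in auto)
      finally show "(\<Sum>k\<in>I ` D0. Sup k - Inf k) < \<delta>" using D(3) by simp
    qed
    finally show "(\<Sum>k\<in>D. dist (f (s (Inf k))) (f (s (Sup k)))) < e" .
  qed fact
qed

lemma int_lattice_add: "k \<in> int_lattice \<Longrightarrow> l \<in> int_lattice \<Longrightarrow> k + l \<in> int_lattice"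
  and int_lattice_diff: "k \<in> int_lattice \<Longrightarrow> l \<in> int_lattice \<Longrightarrow> k - l \<in> int_lattice"
  and int_lattice_minus: "k \<in> int_lattice \<Longrightarrow> - k \<in> int_lattice"
  and int_lattice_0: "0 \<in> int_lattice"
  unfolding int_lattice_def by auto

lemma torus_funD: "torus_fun f \<Longrightarrow> y - x \<in> int_lattice \<Longrightarrow> f y = f x"
  unfolding torus_fun_def by (metis add.commute diff_add_cancel)

lemma nn_integral_eq_has_integral:
  fixes F :: "real \<Rightarrow> real"
  assumes F0: "\<And>t. F t \<ge> 0" and A: "A \<ge> 0"
    and m: "(\<lambda>t. ennreal (F t) * indicator {a..b} t) \<in> borel_measurable lebesgue"
  shows "(\<integral>\<^sup>+t. ennreal (F t) * indicator {a..b} t \<partial>lebesgue) = ennreal A \<longleftrightarrow> (F has_integral A) {a..b}"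
proof -
  let ?G = "\<lambda>t. if t \<in> {a..b} then F t else 0"
  have e: "(\<lambda>t. ennreal (?G t)) = (\<lambda>t. ennreal (F t) * indicator {a..b} t)" by (auto simp: indicator_def)
  have "(\<lambda>t. enn2real (ennreal (F t) * indicator {a..b} t)) \<in> borel_measurable lebesgue" using m by measurable
  moreover have "(\<lambda>t. enn2real (ennreal (F t) * indicator {a..b} t)) = ?G" using F0 by (auto simp: indicator_def)
  ultimately have mG: "?G \<in> borel_measurable lebesgue" by simp
  have "(F has_integral A) {a..b} \<longleftrightarrow> (?G has_integral A) UNIV" by (simp only: has_integral_restrict_UNIV)
  also have "\<dots> \<longleftrightarrow> (\<integral>\<^sup>+t. ennreal (?G t) \<partial>lebesgue) = ennreal A"
    by (subst has_integral_iff_nn_integral_lebesgue) (use F0 mG A in auto)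
  finally show ?thesis unfolding e by simp
qed

locale torus_potential =
  fixes V :: "real ^ 'n \<Rightarrow> real" and B :: real
  assumes periodic: "torus_fun V" and cont: "continuous_on UNIV V"
    and nonneg: "\<And>y. 0 \<le> V y" and bounded: "\<And>y. V y \<le> B"
begin

lemma B_nonneg: "0 \<le> B" using nonneg bounded order_trans by blast

definition lagrangian :: "(real \<Rightarrow> real ^ 'n) \<Rightarrow> real \<Rightarrow> real" where
  "lagrangian \<gamma> t = (norm (vector_derivative \<gamma> (at t)))\<^sup>2 / 4 + V (\<gamma> t)"

lemma lagrangian_nonneg: "0 \<le> lagrangian \<gamma> t"
  unfolding lagrangian_def using nonneg by simp

lemma action_eq_iff_has_integral:
  assumes ac: "abs_cont_on 0 T \<gamma>" and T: "0 \<le> T" and A: "0 \<le> A"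
  shows "action V T \<gamma> = ennreal A \<longleftrightarrow> (lagrangian \<gamma> has_integral A) {0..T}"
  unfolding action_def
  using nn_integral_eq_has_integral[where F = "lagrangian \<gamma>" and a = 0 and b = T, OF lagrangian_nonneg A] action_eq_velocity(3)[OF ac T cont]
  by (simp add: lagrangian_def)

lemma mane_le_action:
  assumes "0 < T" "\<gamma> \<in> torus_curves T y x" "action V T \<gamma> \<le> ennreal A" "0 \<le> A"
  shows "mane V y x \<le> A"
proof -
  have "(INF T\<in>{0<..}. INF \<gamma>\<in>torus_curves T y x. action V T \<gamma>) \<le> action V T \<gamma>"
    using assms by (intro INF_lower2[of T] INF_lower) auto
  then have "(INF T\<in>{0<..}. INF \<gamma>\<in>torus_curves T y x. action V T \<gamma>) \<le> ennreal A" using assms by simp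
  then show ?thesis unfolding mane_def using assms(4) by (intro enn2real_leI)
qed

lemma mane_nonneg: "0 \<le> mane V y x" unfolding mane_def by simp

text \<open>At speed at most \<open>2 sqrt (M + e)\<close> the kinetic and the potential part of the Lagrangian are both at
  most \<open>M + e\<close>. The summand \<open>e\<close> in the time keeps it positive when the endpoints coincide.\<close>

lemma mane_segment_curve:
  assumes e: "e > 0" and M: "\<And>z. z \<in> closed_segment y x \<Longrightarrow> V z \<le> M"
  obtains T \<gamma> where "0 < T" "\<gamma> \<in> torus_curves T y x"
    "action V T \<gamma> \<le> ennreal (sqrt (M + e) * (dist y x + e))"
proof -
  have M0: "M \<ge> 0" using M[of y] nonneg[of y] by auto
  define s where "s = sqrt (M + e)"
  have s: "s > 0" "s\<^sup>2 = M + e" unfolding s_def using M0 e by auto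
  define T where "T = (dist y x + e) / (2 * s)"
  have T: "T > 0" unfolding T_def using e s by (simp add: add_nonneg_pos)
  define \<gamma> where "\<gamma> t = y + (t / T) *\<^sub>R (x - y)" for t
  have sp: "norm ((1 / T) *\<^sub>R (x - y)) \<le> 2 * s"
  proof -
    have "norm (x - y) \<le> T * (2 * s)" unfolding T_def using s e by (simp add: dist_norm norm_minus_commute)
    then have "norm (x - y) / T \<le> 2 * s" using T by (simp add: divide_le_eq mult.commute)
    then show ?thesis using T by simp
  qed
  have ac: "abs_cont_on 0 T \<gamma>"
  proof (rule abs_cont_on_lipschitz[of "2 * s"])
    fix u v
    have "\<gamma> u - \<gamma> v = (u - v) *\<^sub>R ((1 / T) *\<^sub>R (x - y))" unfolding \<gamma>_def by (simp add: algebra_simps diff_divide_distrib)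
    then have "dist (\<gamma> u) (\<gamma> v) = \<bar>u - v\<bar> * norm ((1 / T) *\<^sub>R (x - y))" unfolding dist_norm by simp
    also have "\<dots> \<le> \<bar>u - v\<bar> * (2 * s)" by (rule mult_left_mono[OF sp]) simp
    finally show "dist (\<gamma> u) (\<gamma> v) \<le> 2 * s * dist u v" by (simp add: dist_real_def mult.commute)
  qed (use s in auto)
  show ?thesis
  proof (rule that[OF T])
    show "\<gamma> \<in> torus_curves T y x"
      unfolding torus_curves_def abs_continuous_curve_iff using ac T by (auto simp: \<gamma>_def int_lattice_0)
    have vd: "vector_derivative \<gamma> (at t) = (1 / T) *\<^sub>R (x - y)" for t
      unfolding \<gamma>_def by (rule vector_derivative_at) (auto intro!: derivative_eq_intros simp: divide_inverse)
    have le: "(norm (vector_derivative \<gamma> (at t)))\<^sup>2 / 4 + V (\<gamma> t) \<le> 2 * s\<^sup>2" if t: "t \<in> {0..T}" for t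
    proof -
      have "(norm ((1 / T) *\<^sub>R (x - y)))\<^sup>2 \<le> (2 * s)\<^sup>2" by (rule power_mono[OF sp]) simp
      moreover have "\<gamma> t \<in> closed_segment y x"
        unfolding closed_segment_def \<gamma>_def using t T by (auto intro!: exI[of _ "t / T"] simp: algebra_simps)
      then have "V (\<gamma> t) \<le> s\<^sup>2" using M e s by fastforce
      ultimately show ?thesis unfolding vd by (simp add: power_mult_distrib)
    qed
    have "action V T \<gamma> \<le> (\<integral>\<^sup>+t. ennreal (2 * s\<^sup>2) * indicator {0..T} t \<partial>lebesgue)"
      unfolding action_def by (rule nn_integral_mono) (auto simp: indicator_def intro!: ennreal_leI le)
    also have "\<dots> = ennreal (2 * s\<^sup>2) * ennreal T" using T by (simp add: nn_integral_cmult_indicator)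
    also have "\<dots> = ennreal (2 * s\<^sup>2 * T)" using T by (simp add: ennreal_mult)
    also have "2 * s\<^sup>2 * T = s * (dist y x + e)" unfolding T_def power2_eq_square using s(1) by simp
    finally show "action V T \<gamma> \<le> ennreal (sqrt (M + e) * (dist y x + e))" unfolding s_def .
  qed
qed

lemma mane_le_segment:
  assumes M: "\<And>z. z \<in> closed_segment y x \<Longrightarrow> V z \<le> M"
  shows "mane V y x \<le> sqrt M * dist y x"
proof -
  have M0: "M \<ge> 0" using M[of y] nonneg[of y] by auto
  have "mane V y x \<le> sqrt (M + e) * (dist y x + e)" if e: "e > 0" for e
  proof -
    obtain T \<gamma> where "0 < T" "\<gamma> \<in> torus_curves T y x" "action V T \<gamma> \<le> ennreal (sqrt (M + e) * (dist y x + e))"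
      using mane_segment_curve[OF e M] by blast
    then show ?thesis using e M0 by (intro mane_le_action) auto
  qed
  then have ev: "\<forall>\<^sub>F e in at_right 0. mane V y x \<le> sqrt (M + e) * (dist y x + e)"
    by (auto simp: eventually_at_filter)
  have "((\<lambda>e. sqrt (M + e) * (dist y x + e)) \<longlongrightarrow> sqrt (M + 0) * (dist y x + 0)) (at_right 0)"
    by (intro tendsto_intros)
  then show ?thesis using tendsto_lowerbound[OF _ ev] by simp
qed

lemma mane_approx:
  assumes e: "e > 0"
  obtains T \<gamma> A where "0 < T" "\<gamma> \<in> torus_curves T y x" "0 \<le> A" "action V T \<gamma> = ennreal A" "A < mane V y x + e"
proof -
  let ?E = "INF T\<in>{0<..}. INF \<gamma>\<in>torus_curves T y x. action V T \<gamma>"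
  obtain T0 \<gamma>0 where 0: "0 < T0" "\<gamma>0 \<in> torus_curves T0 y x" "action V T0 \<gamma>0 \<le> ennreal (sqrt (B + 1) * (dist y x + 1))"
    using mane_segment_curve[OF zero_less_one bounded, of y x] by blast
  have "?E \<le> action V T0 \<gamma>0" using 0 by (intro INF_lower2[of T0] INF_lower) auto
  then have fin: "?E < top" using 0(3) by (meson ennreal_less_top le_less_trans)
  then have "?E = ennreal (mane V y x)" unfolding mane_def by simp
  also have "\<dots> < ennreal (mane V y x + e)" using e mane_nonneg by (simp add: ennreal_less_iff)
  finally obtain T \<gamma> where T: "0 < T" "\<gamma> \<in> torus_curves T y x" "action V T \<gamma> < ennreal (mane V y x + e)"
    unfolding INF_less_iff by auto
  then obtain A where A: "0 \<le> A" "action V T \<gamma> = ennreal A" by (cases "action V T \<gamma>") auto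
  have "A < mane V y x + e" using T(3) unfolding A(2) by (simp only: ennreal_less_iff[OF A(1)])
  then show ?thesis using T(1,2) A that by blast
qed

text \<open>Two nearly optimal curves are concatenated. Their lifts fit together only modulo the lattice, so
  the second one is translated by a lattice vector. Written as a sum of two curves, each at rest
  outside its own time interval, the concatenation is absolutely continuous because its summands
  are reparametrised curves.\<close>

lemma mane_triangle: "mane V y z \<le> mane V y x + mane V x z"
proof (rule field_le_epsilon)
  fix e :: real assume "e > 0"
  then have e2: "e / 2 > 0" by simp
  obtain T1 \<gamma>1 A1 where 1: "0 < T1" "\<gamma>1 \<in> torus_curves T1 y x" "0 \<le> A1" "action V T1 \<gamma>1 = ennreal A1" "A1 < mane V y x + e / 2"
    using mane_approx[OF e2] by blast
  obtain T2 \<gamma>2 A2 where 2: "0 < T2" "\<gamma>2 \<in> torus_curves T2 x z" "0 \<le> A2" "action V T2 \<gamma>2 = ennreal A2" "A2 < mane V x z + e / 2"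
    using mane_approx[OF e2] by blast
  have ac1: "abs_cont_on 0 T1 \<gamma>1" and ac2: "abs_cont_on 0 T2 \<gamma>2"
    using 1(2) 2(2) unfolding torus_curves_def abs_continuous_curve_iff by auto
  \<comment> \<open>The lattice vector by which the lifts differ at the junction.\<close>
  define k where "k = \<gamma>1 T1 - \<gamma>2 0"
  have k: "k \<in> int_lattice"
    using 1(2) 2(2) int_lattice_diff[of "\<gamma>1 T1 - x" "\<gamma>2 0 - x"] unfolding torus_curves_def k_def by auto
  define \<gamma> where "\<gamma> t = \<gamma>1 (min T1 t) + (\<gamma>2 (max 0 (t - T1)) + (- \<gamma>2 0))" for t
  have g1: "\<gamma> t = \<gamma>1 t" if "t \<le> T1" for t using that unfolding \<gamma>_def by (simp add: min_def max_def)
  have g2: "\<gamma> t = \<gamma>2 (t - T1) + k" if "t \<ge> T1" for t using that unfolding \<gamma>_def k_def by (auto simp: min_def max_def)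
  let ?T = "T1 + T2"
  have ac: "abs_cont_on 0 ?T \<gamma>"
    unfolding \<gamma>_def
  proof (intro abs_cont_on_add)
    show "abs_cont_on 0 ?T (\<lambda>t. \<gamma>1 (min T1 t))"
      by (rule abs_cont_on_comp_mono[OF ac1]) (use 1 2 in \<open>auto simp: min_def\<close>)
    show "abs_cont_on 0 ?T (\<lambda>t. \<gamma>2 (max 0 (t - T1)))"
      by (rule abs_cont_on_comp_mono[OF ac2]) (use 1 2 in \<open>auto simp: max_def\<close>)
    show "abs_cont_on 0 ?T (\<lambda>t. - \<gamma>2 0)" by (rule abs_cont_on_lipschitz[of 0]) auto
  qed
  have vd1: "vector_derivative \<gamma> (at t) = vector_derivative \<gamma>1 (at t)" if t: "t < T1" for t
  proof -
    have "(\<gamma> has_vector_derivative d) (at t) \<longleftrightarrow> (\<gamma>1 has_vector_derivative d) (at t)" for d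
      using has_vector_derivative_transform_within_open[of \<gamma> d t "{..<T1}" \<gamma>1]
        has_vector_derivative_transform_within_open[of \<gamma>1 d t "{..<T1}" \<gamma>] t g1 by auto
    then show ?thesis unfolding vector_derivative_def by simp
  qed
  have vd2: "vector_derivative \<gamma> (at t) = vector_derivative \<gamma>2 (at (t - T1))" if t: "t > T1" for t
  proof -
    let ?h = "\<lambda>t. \<gamma>2 (t - T1) + k"
    have "(\<gamma> has_vector_derivative d) (at t) \<longleftrightarrow> (?h has_vector_derivative d) (at t)" for d
      using has_vector_derivative_transform_within_open[of \<gamma> d t "{T1<..}" ?h]
        has_vector_derivative_transform_within_open[of ?h d t "{T1<..}" \<gamma>] t g2 by auto
    moreover have "(?h has_vector_derivative d) (at t) \<longleftrightarrow> (\<gamma>2 has_vector_derivative d) (at (t - T1))" for d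
    proof -
      have "?h (t + h) - ?h t = \<gamma>2 (t - T1 + h) - \<gamma>2 (t - T1)" for h by (simp add: algebra_simps)
      then show ?thesis unfolding has_vector_derivative_def has_derivative_at by simp
    qed
    ultimately show ?thesis unfolding vector_derivative_def by simp
  qed
  have "(lagrangian \<gamma> has_integral A1) {0..T1}"
  proof (rule has_integral_spike_finite[of "{T1}"])
    show "(lagrangian \<gamma>1 has_integral A1) {0..T1}"
      using action_eq_iff_has_integral[OF ac1 _ 1(3)] 1 by simp
    show "lagrangian \<gamma> t = lagrangian \<gamma>1 t" if "t \<in> {0..T1} - {T1}" for t
      using that vd1[of t] g1[of t] unfolding lagrangian_def by auto
  qed simp
  moreover have "(lagrangian \<gamma> has_integral A2) {T1..?T}"
  proof (rule has_integral_spike_finite[of "{T1}"])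
    have "(lagrangian \<gamma>2 has_integral A2) {0..T2}"
      using action_eq_iff_has_integral[OF ac2 _ 2(3)] 2 by simp
    then show "((\<lambda>t. lagrangian \<gamma>2 (t - T1)) has_integral A2) {T1..?T}"
      using has_integral_affinity'[of "lagrangian \<gamma>2" A2 0 T2 1 "- T1"] by (simp add: algebra_simps)
    show "lagrangian \<gamma> t = lagrangian \<gamma>2 (t - T1)" if "t \<in> {T1..?T} - {T1}" for t
      using that vd2[of t] g2[of t] periodic k unfolding lagrangian_def torus_fun_def by auto
  qed simp
  ultimately have "(lagrangian \<gamma> has_integral A1 + A2) {0..?T}"
    by (rule has_integral_combine[rotated 2]) (use 1 2 in auto)
  then have "action V ?T \<gamma> = ennreal (A1 + A2)"
    using action_eq_iff_has_integral[OF ac, of "A1 + A2"] 1 2 by simp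
  moreover have "\<gamma> \<in> torus_curves ?T y z"
    using ac 1 2 g1[of 0] g2[of ?T] int_lattice_add[OF k, of "\<gamma>2 T2 - z"]
    unfolding torus_curves_def abs_continuous_curve_iff by (auto simp: algebra_simps)
  ultimately have "mane V y z \<le> A1 + A2" using 1 2 by (intro mane_le_action[of ?T \<gamma>]) auto
  then show "mane V y z \<le> mane V y x + mane V x z + e" using 1(5) 2(5) by simp
qed

lemma torus_curves_shift:
  "y - y' \<in> int_lattice \<Longrightarrow> x - x' \<in> int_lattice \<Longrightarrow> torus_curves T y x = torus_curves T y' x'"
proof -
  have *: "torus_curves T y x \<subseteq> torus_curves T y' x'"
    if "y - y' \<in> int_lattice" "x - x' \<in> int_lattice" for y x y' x'
  proof
    fix \<gamma> assume "\<gamma> \<in> torus_curves T y x"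
    then show "\<gamma> \<in> torus_curves T y' x'"
      using int_lattice_add[of "\<gamma> 0 - y" "y - y'"] int_lattice_add[of "\<gamma> T - x" "x - x'"] that
      unfolding torus_curves_def by auto
  qed
  assume d: "y - y' \<in> int_lattice" "x - x' \<in> int_lattice"
  have d': "y' - y \<in> int_lattice" "x' - x \<in> int_lattice"
    using int_lattice_minus[OF d(1)] int_lattice_minus[OF d(2)] by simp_all
  show "torus_curves T y x = torus_curves T y' x'" using *[OF d] *[OF d'] by (rule subset_antisym)
qed

lemma mane_periodic: "torus_fun (mane V y)"
  unfolding torus_fun_def mane_def
proof (intro allI ballI)
  fix z k :: "real ^ 'n" assume "k \<in> int_lattice"
  then have "torus_curves T y (z + k) = torus_curves T y z" for T
    by (intro torus_curves_shift) (auto simp: int_lattice_0)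
  then show "enn2real (INF T\<in>{0<..}. INF \<gamma>\<in>torus_curves T y (z + k). action V T \<gamma>) =
      enn2real (INF T\<in>{0<..}. INF \<gamma>\<in>torus_curves T y z. action V T \<gamma>)" by simp
qed

lemma mane_diff_le_segment:
  assumes "\<And>z. z \<in> closed_segment y x \<Longrightarrow> V z \<le> M"
  shows "mane V p x \<le> mane V p y + sqrt M * dist y x"
  using mane_triangle[of p x y] mane_le_segment[of y x M] assms by fastforce

text \<open>A function with slope at most \<open>sqrt V\<close> calibrates the action. The error \<open>e\<close> contributes in proportion
  to the duration of a fixed nearly optimal curve and therefore disappears as \<open>e\<close> tends to 0.\<close>

lemma calibration_le_mane:
  assumes per: "torus_fun \<psi>"
    and \<psi>: "\<And>e. e > 0 \<Longrightarrow> \<exists>r>0. \<forall>y z. dist y z \<le> r \<longrightarrow> \<bar>\<psi> z - \<psi> y\<bar> \<le> (sqrt (V y) + e) * dist y z"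
  shows "\<psi> x - \<psi> y \<le> mane V y x"
proof (rule field_le_epsilon)
  fix \<eta> :: real assume \<eta>: "\<eta> > 0"
  obtain T \<gamma> A where 1: "0 < T" "\<gamma> \<in> torus_curves T y x" "0 \<le> A" "action V T \<gamma> = ennreal A" "A < mane V y x + \<eta>"
    using mane_approx[OF \<eta>] by blast
  have ac: "abs_cont_on 0 T \<gamma>" using 1(2) unfolding torus_curves_def abs_continuous_curve_iff by auto
  have ends: "\<psi> (\<gamma> T) = \<psi> x" "\<psi> (\<gamma> 0) = \<psi> y"
    using 1(2) torus_funD[OF per] unfolding torus_curves_def by auto
  have "\<psi> x - \<psi> y \<le> A + (2 * e * sqrt B + e\<^sup>2) * T" if e: "e > 0" for e
  proof -
    obtain r where r: "r > 0" "\<And>y z. dist y z \<le> r \<Longrightarrow> \<bar>\<psi> z - \<psi> y\<bar> \<le> (sqrt (V y) + e) * dist y z"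
      using \<psi>[OF e] by blast
    have nn: "0 \<le> (2 * e * sqrt B + e\<^sup>2) * T" using e B_nonneg 1 by simp
    have "ennreal (\<psi> x - \<psi> y) \<le> ennreal A + ennreal ((2 * e * sqrt B + e\<^sup>2) * T)"
      using curve_growth_le_action[OF ac 1(1) cont nonneg bounded r(1) less_imp_le[OF e] r(2)] 1(4) ends by simp
    also have "\<dots> = ennreal (A + (2 * e * sqrt B + e\<^sup>2) * T)" using nn 1 by (simp add: ennreal_plus)
    finally show ?thesis using nn 1 by (subst (asm) ennreal_le_iff) auto
  qed
  then have ev: "\<forall>\<^sub>F e in at_right 0. \<psi> x - \<psi> y \<le> A + (2 * e * sqrt B + e\<^sup>2) * T"
    by (auto simp: eventually_at_filter)
  have "((\<lambda>e. A + (2 * e * sqrt B + e\<^sup>2) * T) \<longlongrightarrow> A + (2 * 0 * sqrt B + 0\<^sup>2) * T) (at_right 0)"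
    by (intro tendsto_intros)
  then have "\<psi> x - \<psi> y \<le> A" using tendsto_lowerbound[OF _ ev] by simp
  then show "\<psi> x - \<psi> y \<le> mane V y x + \<eta>" using 1(5) by simp
qed

end

section \<open>Square roots of positive definite matrices\<close>

text \<open>A maximiser of the Rayleigh quotient over the unit sphere of \<open>S\<close> is an eigenvector: moving away from
  it along the defect \<open>g = f e - l e\<close> changes the quotient to first order by \<open>2 |g|\<^sup>2\<close>.\<close>

lemma selfadjoint_eigenvector:
  fixes f :: "'a::euclidean_space \<Rightarrow> 'a"
  assumes f: "linear f" and sa: "\<And>x y. f x \<bullet> y = x \<bullet> f y"
    and S: "subspace S" "\<And>x. x \<in> S \<Longrightarrow> f x \<in> S" "S \<noteq> {0}"
  obtains e l where "e \<in> S" "norm e = 1" "f e = l *\<^sub>R e"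
proof -
  interpret f: linear f by fact
  obtain w where w: "w \<in> S" "w \<noteq> 0" using S(1,3) subspace_0 by blast
  have comp: "compact (S \<inter> sphere 0 1)" using closed_subspace[OF S(1)] by (intro closed_Int_compact) auto
  have ne: "S \<inter> sphere 0 1 \<noteq> {}"
    using w subspace_scale[OF S(1) w(1), of "1 / norm w"] by (force simp: sphere_def)
  have "continuous_on (S \<inter> sphere 0 1) (\<lambda>x. x \<bullet> f x)"
    by (intro continuous_intros linear_continuous_on linear_linear[THEN iffD2, OF f] | simp add: linear_conv_bounded_linear[symmetric] f)+
  then obtain e where e: "e \<in> S \<inter> sphere 0 1" "\<And>x. x \<in> S \<inter> sphere 0 1 \<Longrightarrow> x \<bullet> f x \<le> e \<bullet> f e"
    using continuous_attains_sup[OF comp ne] by blast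
  define l where "l = e \<bullet> f e"
  define g where "g = f e - l *\<^sub>R e"
  have eS: "e \<in> S" "norm e = 1" using e(1) by auto
  have gS: "g \<in> S" unfolding g_def using S eS by (intro subspace_diff subspace_scale) auto
  have q: "x \<bullet> f x \<le> l * (norm x)\<^sup>2" if x: "x \<in> S" for x
  proof (cases "x = 0")
    case False
    let ?u = "(1 / norm x) *\<^sub>R x"
    have "?u \<in> S \<inter> sphere 0 1" using x False subspace_scale[OF S(1) x] by auto
    then have "?u \<bullet> f ?u \<le> l" using e(2) unfolding l_def by blast
    moreover have "?u \<bullet> f ?u = (x \<bullet> f x) / (norm x)\<^sup>2" by (simp add: f.scale power2_eq_square)
    ultimately have "(x \<bullet> f x) / (norm x)\<^sup>2 \<le> l" by (simp only:)
    then show ?thesis using False by (simp add: divide_le_eq)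
  qed (simp add: f.zero)
  define C where "C = l * (norm g)\<^sup>2 - g \<bullet> f g"
  have ineq: "2 * (norm g)\<^sup>2 \<le> t * C" if t: "t > 0" for t
  proof -
    have m: "e + t *\<^sub>R g \<in> S" using eS gS S(1) by (intro subspace_add subspace_scale) auto
    have ee: "e \<bullet> e = 1" using eS by (simp add: dot_square_norm)
    have "(e + t *\<^sub>R g) \<bullet> f (e + t *\<^sub>R g) = l + 2 * t * (f e \<bullet> g) + t\<^sup>2 * (g \<bullet> f g)"
      using sa[of e g] unfolding l_def by (simp add: f.add f.scale inner_add_left inner_add_right power2_eq_square inner_commute algebra_simps)
    moreover have "(norm (e + t *\<^sub>R g))\<^sup>2 = 1 + 2 * t * (e \<bullet> g) + t\<^sup>2 * (norm g)\<^sup>2"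
      unfolding power2_norm_eq_inner using ee by (simp add: inner_add_left inner_add_right power2_eq_square inner_commute algebra_simps)
    ultimately have "l + 2 * t * (f e \<bullet> g) + t\<^sup>2 * (g \<bullet> f g) \<le> l * (1 + 2 * t * (e \<bullet> g) + t\<^sup>2 * (norm g)\<^sup>2)"
      using q[OF m] by simp
    then have "2 * t * (f e \<bullet> g - l * (e \<bullet> g)) \<le> t\<^sup>2 * C" unfolding C_def by (simp add: algebra_simps)
    moreover have "f e \<bullet> g - l * (e \<bullet> g) = (norm g)\<^sup>2"
      unfolding power2_norm_eq_inner by (simp add: g_def inner_diff_left)
    ultimately have "t * (2 * (norm g)\<^sup>2) \<le> t * (t * C)" by (simp add: power2_eq_square algebra_simps)
    then show ?thesis using t by simp
  qed
  have "2 * (norm g)\<^sup>2 \<le> 0"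
  proof (rule tendsto_lowerbound)
    show "((\<lambda>t. t * C) \<longlongrightarrow> 0) (at_right 0)" by (rule tendsto_mult_left_zero) (rule tendsto_ident_at)
    show "\<forall>\<^sub>F t in at_right 0. 2 * (norm g)\<^sup>2 \<le> t * C" using ineq by (auto simp: eventually_at_filter)
  qed simp
  then have "g = 0" by simp
  then show ?thesis using that[OF eS, of l] unfolding g_def by simp
qed

text \<open>The orthogonal complement of an eigenvector within \<open>S\<close> is invariant and of smaller dimension.\<close>

theorem selfadjoint_eigenbasis:
  fixes f :: "'a::euclidean_space \<Rightarrow> 'a"
  assumes f: "linear f" and sa: "\<And>x y. f x \<bullet> y = x \<bullet> f y"
    and S: "subspace S" "\<And>x. x \<in> S \<Longrightarrow> f x \<in> S"
  shows "\<exists>E. finite E \<and> E \<subseteq> S \<and> (\<forall>b\<in>E. norm b = 1 \<and> (\<exists>l. f b = l *\<^sub>R b)) \<and>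
     (\<forall>b\<in>E. \<forall>c\<in>E. b \<noteq> c \<longrightarrow> b \<bullet> c = 0) \<and> (\<forall>x\<in>S. x = (\<Sum>b\<in>E. (x \<bullet> b) *\<^sub>R b))"
  using S
proof (induction "dim S" arbitrary: S rule: less_induct)
  case (less S)
  interpret f: linear f by fact
  show ?case
  proof (cases "S = {0}")
    case True then show ?thesis by (intro exI[of _ "{}"]) auto
  next
    case False
    obtain e l where e: "e \<in> S" "norm e = 1" "f e = l *\<^sub>R e"
      using selfadjoint_eigenvector[OF f sa less.prems False] by blast
    have ee: "e \<bullet> e = 1" using e(2) by (simp add: dot_square_norm)
    define S' where "S' = {x \<in> S. x \<bullet> e = 0}"
    have S': "subspace S'"
      unfolding S'_def subspace_def
      using less.prems(1) by (auto simp: subspace_0 subspace_add subspace_scale inner_add_left)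
    have inv: "f x \<in> S'" if "x \<in> S'" for x
      using that less.prems(2) sa[of x e] unfolding S'_def by (auto simp: e(3))
    have sub: "S' \<subseteq> S" unfolding S'_def by auto
    have "e \<notin> S'" unfolding S'_def using ee by simp
    then have "span S' \<subset> span S"
      using sub e(1) S' less.prems(1) by (auto simp: span_eq_iff[THEN iffD2])
    then have "dim S' < dim S" by (rule dim_psubset)
    then obtain E where E: "finite E" "E \<subseteq> S'" "\<forall>b\<in>E. norm b = 1 \<and> (\<exists>l. f b = l *\<^sub>R b)"
      "\<forall>b\<in>E. \<forall>c\<in>E. b \<noteq> c \<longrightarrow> b \<bullet> c = 0" "\<forall>x\<in>S'. x = (\<Sum>b\<in>E. (x \<bullet> b) *\<^sub>R b)"
      using less.hyps[OF _ S' inv] by blast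
    have orth: "b \<bullet> e = 0" if "b \<in> E" for b using that E(2) unfolding S'_def by auto
    have eE: "e \<notin> E" using E(2) \<open>e \<notin> S'\<close> by auto
    show ?thesis
    proof (intro exI[of _ "insert e E"] conjI)
      show "\<forall>b\<in>insert e E. norm b = 1 \<and> (\<exists>l. f b = l *\<^sub>R b)" using E(3) e by auto
      show "\<forall>b\<in>insert e E. \<forall>c\<in>insert e E. b \<noteq> c \<longrightarrow> b \<bullet> c = 0"
        using E(4) orth by (auto simp: inner_commute)
      show "\<forall>x\<in>S. x = (\<Sum>b\<in>insert e E. (x \<bullet> b) *\<^sub>R b)"
      proof
        fix x assume x: "x \<in> S"
        let ?y = "x - (x \<bullet> e) *\<^sub>R e"
        have "?y \<in> S'" unfolding S'_def
          using x e(1) less.prems(1) ee by (auto simp: subspace_diff subspace_scale inner_diff_left)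
        then have "?y = (\<Sum>b\<in>E. (?y \<bullet> b) *\<^sub>R b)" using E(5) by blast
        also have "\<dots> = (\<Sum>b\<in>E. (x \<bullet> b) *\<^sub>R b)"
          by (rule sum.cong) (auto simp: inner_diff_left orth inner_commute[of e])
        finally show "x = (\<Sum>b\<in>insert e E. (x \<bullet> b) *\<^sub>R b)" using E(1) eE by (simp add: algebra_simps)
      qed
    qed (use E e sub in auto)
  qed
qed

lemma symmetric_matrix_dot:
  fixes M :: "real ^ 'n ^ 'n"
  shows "transpose M = M \<longleftrightarrow> (\<forall>x y. (M *v x) \<bullet> y = x \<bullet> (M *v y))"
proof
  assume "transpose M = M"
  then show "\<forall>x y. (M *v x) \<bullet> y = x \<bullet> (M *v y)"
    by (metis dot_lmul_matrix inner_commute transpose_matrix_vector)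
next
  assume s: "\<forall>x y. (M *v x) \<bullet> y = x \<bullet> (M *v y)"
  have "(transpose M *v x) \<bullet> y = (M *v x) \<bullet> y" for x y
    using s by (metis dot_lmul_matrix transpose_matrix_vector)
  then have "transpose M *v x = M *v x" for x by (metis vector_eq_rdot)
  then show "transpose M = M" by (simp add: matrix_eq)
qed

lemma symmetric_eigenbasis:
  fixes M :: "real ^ 'n ^ 'n"
  assumes "transpose M = M"
  obtains E where "finite E" "\<And>b. b \<in> E \<Longrightarrow> b \<bullet> b = 1" "\<And>b. b \<in> E \<Longrightarrow> M *v b = (b \<bullet> (M *v b)) *\<^sub>R b"
    "\<And>b c. b \<in> E \<Longrightarrow> c \<in> E \<Longrightarrow> b \<noteq> c \<Longrightarrow> b \<bullet> c = 0" "\<And>x. x = (\<Sum>b\<in>E. (x \<bullet> b) *\<^sub>R b)"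
proof -
  obtain E where E: "finite E" "\<forall>b\<in>E. norm b = 1 \<and> (\<exists>l. M *v b = l *\<^sub>R b)"
     "\<forall>b\<in>E. \<forall>c\<in>E. b \<noteq> c \<longrightarrow> b \<bullet> c = 0" "\<forall>x. x = (\<Sum>b\<in>E. (x \<bullet> b) *\<^sub>R b)"
    using selfadjoint_eigenbasis[of "(*v) M" UNIV] symmetric_matrix_dot[of M] assms by auto
  have n: "b \<bullet> b = 1" if "b \<in> E" for b using E(2) that by (simp add: dot_square_norm)
  show ?thesis
  proof (rule that[OF E(1) n])
    fix b assume b: "b \<in> E"
    then obtain l where "M *v b = l *\<^sub>R b" using E(2) by auto
    then show "M *v b = (b \<bullet> (M *v b)) *\<^sub>R b" using n[OF b] by simp
  qed (use E in auto)
qed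

text \<open>The root has the same eigenbasis, with the square roots of the eigenvalues.\<close>

lemma positive_definite_sqrt_exists:
  fixes M :: "real ^ 'n ^ 'n"
  assumes M: "positive_definite M"
  shows "\<exists>R. positive_definite R \<and> R ** R = M"
proof -
  have MT: "transpose M = M" using M unfolding positive_definite_def by blast
  obtain E where E: "finite E" "\<And>b. b \<in> E \<Longrightarrow> b \<bullet> b = 1" "\<And>b. b \<in> E \<Longrightarrow> M *v b = (b \<bullet> (M *v b)) *\<^sub>R b"
    "\<And>b c. b \<in> E \<Longrightarrow> c \<in> E \<Longrightarrow> b \<noteq> c \<Longrightarrow> b \<bullet> c = 0" "\<And>x. x = (\<Sum>b\<in>E. (x \<bullet> b) *\<^sub>R b)"
    by (rule symmetric_eigenbasis[OF MT]) (rule that; assumption)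
  define l where "l b = b \<bullet> (M *v b)" for b
  have l: "l b > 0" if "b \<in> E" for b
    using M E(2)[OF that] unfolding positive_definite_def l_def by (metis inner_zero_left zero_neq_one)
  define g where "g x = (\<Sum>b\<in>E. (sqrt (l b) * (x \<bullet> b)) *\<^sub>R b)" for x
  have lin: "linear g"
    by (rule linearI) (auto simp: g_def inner_add_left algebra_simps sum.distrib scaleR_sum_right)
  define R where "R = matrix g"
  have R: "R *v x = g x" for x unfolding R_def using matrix_works[of g] lin by simp
  have gb: "g x \<bullet> c = sqrt (l c) * (x \<bullet> c)" if c: "c \<in> E" for x c
  proof -
    have "g x \<bullet> c = (\<Sum>b\<in>E. (sqrt (l b) * (x \<bullet> b)) * (b \<bullet> c))" unfolding g_def by (simp add: inner_sum_left)
    also have "\<dots> = (\<Sum>b\<in>E. if b = c then sqrt (l c) * (x \<bullet> c) else 0)"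
      using E(2,4) c by (intro sum.cong) auto
    finally show ?thesis using E(1) c by simp
  qed
  have "g (g x) = M *v x" for x
  proof -
    have "g (g x) = (\<Sum>b\<in>E. (x \<bullet> b) *\<^sub>R (M *v b))"
      unfolding g_def[of "g x"]
    proof (rule sum.cong[OF refl])
      fix b assume b: "b \<in> E"
      have "sqrt (l b) * (g x \<bullet> b) = l b * (x \<bullet> b)" using l[OF b] gb[OF b, of x] by simp
      then show "(sqrt (l b) * (g x \<bullet> b)) *\<^sub>R b = (x \<bullet> b) *\<^sub>R (M *v b)"
        by (subst E(3)[OF b]) (simp add: l_def mult.commute)
    qed
    also have "\<dots> = M *v (\<Sum>b\<in>E. (x \<bullet> b) *\<^sub>R b)"
      by (simp add: linear_sum[OF matrix_vector_mul_linear] matrix_vector_mult_scaleR)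
    finally show ?thesis using E(5)[of x] by simp
  qed
  then have "R ** R = M" by (simp add: matrix_eq R matrix_vector_mul_assoc[symmetric])
  moreover have "positive_definite R"
    unfolding positive_definite_def symmetric_matrix_dot R
  proof (intro conjI allI impI)
    fix x y
    have "g x \<bullet> y = (\<Sum>b\<in>E. sqrt (l b) * (x \<bullet> b) * (b \<bullet> y))" for x y unfolding g_def by (simp add: inner_sum_left)
    then show "g x \<bullet> y = x \<bullet> g y" by (subst inner_commute[of x]) (auto intro!: sum.cong simp: inner_commute)
  next
    fix w :: "real ^ 'n" assume w: "w \<noteq> 0"
    have eq: "w \<bullet> g w = (\<Sum>b\<in>E. sqrt (l b) * (w \<bullet> b)\<^sup>2)"
      unfolding g_def by (simp add: inner_sum_right power2_eq_square mult.assoc)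
    obtain c where c: "c \<in> E" "w \<bullet> c \<noteq> 0"
      using E(5)[of w] w by (metis (no_types, lifting) scaleR_zero_left sum.neutral)
    show "0 < w \<bullet> g w" unfolding eq
      by (rule sum_pos2[OF E(1) c(1)]) (use l c in \<open>auto intro!: mult_nonneg_nonneg simp: less_imp_le\<close>)
  qed
  ultimately show ?thesis by blast
qed

text \<open>If \<open>(P - Q) b = l b\<close>, then \<open>0 = |P b|\<^sup>2 - |Q b|\<^sup>2 = l (b \<bullet> (P + Q) b)\<close>, so every eigenvalue of the
  symmetric matrix \<open>P - Q\<close> vanishes.\<close>

lemma positive_definite_sqrt_unique:
  fixes P Q :: "real ^ 'n ^ 'n"
  assumes P: "positive_definite P" and Q: "positive_definite Q" and eq: "P ** P = Q ** Q"
  shows "P = Q"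
proof -
  have sym: "(P *v x) \<bullet> y = x \<bullet> (P *v y)" "(Q *v x) \<bullet> y = x \<bullet> (Q *v y)" for x y
    using P Q symmetric_matrix_dot unfolding positive_definite_def by metis+
  have DT: "transpose (P - Q) = P - Q"
    unfolding symmetric_matrix_dot using sym by (simp add: matrix_vector_mult_diff_rdistrib inner_diff_left inner_diff_right)
  obtain E where E: "finite E" "\<And>b. b \<in> E \<Longrightarrow> b \<bullet> b = 1"
    "\<And>b. b \<in> E \<Longrightarrow> (P - Q) *v b = (b \<bullet> ((P - Q) *v b)) *\<^sub>R b"
    "\<And>b c. b \<in> E \<Longrightarrow> c \<in> E \<Longrightarrow> b \<noteq> c \<Longrightarrow> b \<bullet> c = 0" "\<And>x. x = (\<Sum>b\<in>E. (x \<bullet> b) *\<^sub>R b)"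
    by (rule symmetric_eigenbasis[OF DT]) (rule that; assumption)
  have "(P - Q) *v b = 0" if b: "b \<in> E" for b
  proof -
    define l where "l = b \<bullet> ((P - Q) *v b)"
    have D: "P *v b - Q *v b = l *\<^sub>R b" using E(3)[OF b] unfolding l_def by (simp add: matrix_vector_mult_diff_rdistrib)
    have "(P *v b) \<bullet> (P *v b) = (Q *v b) \<bullet> (Q *v b)"
      unfolding sym by (simp add: matrix_vector_mul_assoc eq)
    then have "(P *v b - Q *v b) \<bullet> (P *v b + Q *v b) = 0"
      by (simp add: inner_diff_left inner_add_right inner_diff_right inner_commute)
    then have "l * (b \<bullet> (P *v b) + b \<bullet> (Q *v b)) = 0" unfolding D by (simp add: inner_add_right distrib_left)
    moreover have "b \<noteq> 0" using E(2)[OF b] by auto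
    then have "b \<bullet> (P *v b) + b \<bullet> (Q *v b) > 0" using P Q unfolding positive_definite_def by (simp add: add_pos_pos)
    ultimately have "l = 0" by simp
    then show ?thesis using E(3)[OF b] unfolding l_def by simp
  qed
  then have "(P - Q) *v (\<Sum>b\<in>E. (x \<bullet> b) *\<^sub>R b) = 0" for x
    by (simp add: linear_sum[OF matrix_vector_mul_linear] matrix_vector_mult_scaleR)
  then have "(P - Q) *v x = 0" for x by (simp only: E(5)[symmetric])
  then have "P *v x = Q *v x" for x by (simp add: matrix_vector_mult_diff_rdistrib)
  then show ?thesis by (simp add: matrix_eq)
qed

theorem pd_sqrt_works:
  assumes "positive_definite M"
  shows "positive_definite (pd_sqrt M)" "pd_sqrt M ** pd_sqrt M = M"
proof -
  have "\<exists>!R. positive_definite R \<and> R ** R = M"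
    using positive_definite_sqrt_exists[OF assms] positive_definite_sqrt_unique by metis
  from theI'[OF this] show "positive_definite (pd_sqrt M)" "pd_sqrt M ** pd_sqrt M = M"
    unfolding pd_sqrt_def by auto
qed

lemma positive_definite_half:
  "positive_definite M \<Longrightarrow> positive_definite ((1/2) *\<^sub>R M)"
  unfolding positive_definite_def by (simp add: transpose_scalar scaleR_matrix_vector_assoc[symmetric])

text \<open>\<open>l\<close> is the smallest eigenvalue.\<close>

lemma positive_definite_coercive:
  fixes A :: "real ^ 'n ^ 'n"
  assumes A: "positive_definite A"
  obtains l where "l > 0" "\<And>y. l * (norm y)\<^sup>2 \<le> y \<bullet> (A *v y)" "\<And>y. l * norm y \<le> norm (A *v y)"
proof -
  have AT: "transpose A = A" using A unfolding positive_definite_def by blast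
  obtain E where E: "finite E" "\<And>b. b \<in> E \<Longrightarrow> b \<bullet> b = 1" "\<And>b. b \<in> E \<Longrightarrow> A *v b = (b \<bullet> (A *v b)) *\<^sub>R b"
    "\<And>b c. b \<in> E \<Longrightarrow> c \<in> E \<Longrightarrow> b \<noteq> c \<Longrightarrow> b \<bullet> c = 0" "\<And>x. x = (\<Sum>b\<in>E. (x \<bullet> b) *\<^sub>R b)"
    by (rule symmetric_eigenbasis[OF AT]) (rule that; assumption)
  have ne: "E \<noteq> {}"
  proof
    assume "E = {}"
    then have "(1 :: real ^ 'n) = 0" using E(5)[of 1] by simp
    then show False by simp
  qed
  define l where "l = Min ((\<lambda>b. b \<bullet> (A *v b)) ` E)"
  have "l \<in> (\<lambda>b. b \<bullet> (A *v b)) ` E" unfolding l_def using E(1) ne by (intro Min_in) auto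
  then obtain b where "b \<in> E" "l = b \<bullet> (A *v b)" by auto
  then have l: "l > 0" using E(2)[of b] A unfolding positive_definite_def by (metis inner_zero_left zero_neq_one)
  have le: "l \<le> b \<bullet> (A *v b)" if "b \<in> E" for b unfolding l_def using E(1) that by (intro Min_le) auto
  have q: "l * (norm y)\<^sup>2 \<le> y \<bullet> (A *v y)" for y
  proof -
    have "y \<bullet> (A *v y) = y \<bullet> (A *v (\<Sum>b\<in>E. (y \<bullet> b) *\<^sub>R b))" using E(5)[of y] by simp
    also have "\<dots> = (\<Sum>b\<in>E. (y \<bullet> b) * (y \<bullet> (A *v b)))"
      by (simp add: linear_sum[OF matrix_vector_mul_linear] matrix_vector_mult_scaleR inner_sum_right)
    also have "\<dots> = (\<Sum>b\<in>E. (b \<bullet> (A *v b)) * (y \<bullet> b)\<^sup>2)"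
    proof (rule sum.cong[OF refl])
      fix b assume b: "b \<in> E"
      have "y \<bullet> (A *v b) = (b \<bullet> (A *v b)) * (y \<bullet> b)" by (subst E(3)[OF b]) simp
      then show "(y \<bullet> b) * (y \<bullet> (A *v b)) = (b \<bullet> (A *v b)) * (y \<bullet> b)\<^sup>2" by (simp add: power2_eq_square)
    qed
    also have "\<dots> \<ge> (\<Sum>b\<in>E. l * (y \<bullet> b)\<^sup>2)" by (intro sum_mono mult_right_mono le) auto
    also have "(\<Sum>b\<in>E. l * (y \<bullet> b)\<^sup>2) = l * (y \<bullet> (\<Sum>b\<in>E. (y \<bullet> b) *\<^sub>R b))"
      by (simp add: inner_sum_right sum_distrib_left power2_eq_square)
    also have "\<dots> = l * (norm y)\<^sup>2" using E(5)[of y] by (simp add: power2_norm_eq_inner)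
    finally show ?thesis by simp
  qed
  have "l * norm y \<le> norm (A *v y)" for y
  proof (cases "y = 0")
    case False
    have "l * norm y * norm y \<le> norm (A *v y) * norm y"
      using q[of y] norm_cauchy_schwarz[of y "A *v y"] by (simp add: power2_eq_square algebra_simps)
    then show ?thesis using False by simp
  qed simp
  with l q show ?thesis using that by blast
qed

lemma positive_definite_trace_pos:
  fixes A :: "real ^ 'n ^ 'n"
  assumes A: "positive_definite A"
  shows "0 < trace A"
  unfolding trace_def
proof (rule sum_pos)
  fix i :: 'n
  have "axis i 1 \<noteq> (0 :: real ^ 'n)" by (simp add: axis_eq_0_iff)
  then have "0 < axis i 1 \<bullet> (A *v axis i 1)" using A unfolding positive_definite_def by blast
  also have "axis i 1 \<bullet> (A *v axis i 1) = A $ i $ i"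
    by (simp add: inner_axis' matrix_vector_mul_component inner_axis)
  finally show "0 < A $ i $ i" .
qed auto

section \<open>Second order calculus at a well and smooth test functions\<close>

lemma grad_eqI:
  fixes f :: "real ^ 'n \<Rightarrow> real"
  assumes "(f has_derivative (\<lambda>h. D \<bullet> h)) (at z)"
  shows "grad f z = D"
  unfolding grad_def
proof (rule the_equality)
  show "GDERIV f z :> D" using assms unfolding gderiv_def by (simp add: inner_commute)
  fix D' assume "GDERIV f z :> D'"
  then have "(\<lambda>h. h \<bullet> D') = (\<lambda>h. D \<bullet> h)"
    using assms unfolding gderiv_def by (rule has_derivative_unique)
  then show "D' = D" by (metis inner_commute vector_eq_ldot)
qed

lemma has_derivative_grad:
  fixes f :: "real ^ 'n \<Rightarrow> real"
  assumes "f differentiable at z"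
  shows "(f has_derivative (\<lambda>h. grad f z \<bullet> h)) (at z)"
proof -
  obtain f' where f': "(f has_derivative f') (at z)" using assms unfolding differentiable_def by blast
  define D where "D = adjoint f' 1"
  have "f' h = D \<bullet> h" for h
    using adjoint_works[OF has_derivative_linear[OF f'], of h 1] unfolding D_def by (simp add: inner_commute)
  then have "(f has_derivative (\<lambda>h. D \<bullet> h)) (at z)" using f' by (metis (no_types, lifting) ext)
  then show ?thesis using grad_eqI by metis
qed

lemma C2_has_derivative:
  assumes "C2 f"
  shows "(f has_derivative (\<lambda>h. grad f z \<bullet> h)) (at z)"
    "(grad f has_derivative (\<lambda>h. hess f z *v h)) (at z)"
  using assms has_derivative_grad jacobian_works[of "grad f" "at z"]
  unfolding C2_def hess_def by auto

lemma C2_continuous: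
  assumes "C2 f"
  shows "continuous_on UNIV f"
  using C2_has_derivative(1)[OF assms] has_derivative_continuous continuous_at_imp_continuous_on by blast

text \<open>The mean value theorem is applied along the segment to \<open>V\<close> minus its quadratic part; the gradient
  vanishes at the minimum.\<close>

lemma C2_taylor_at_zero_min:
  fixes V :: "real ^ 'n \<Rightarrow> real"
  assumes V: "C2 V" "\<And>z. 0 \<le> V z" "V p = 0" and e: "e > 0"
  obtains r where "r > 0" "\<And>h. norm h < r \<Longrightarrow> \<bar>V (p + h) - (1/2) * (h \<bullet> (hess V p *v h))\<bar> \<le> e * (norm h)\<^sup>2"
proof -
  let ?H = "hess V p"
  have "(\<lambda>h. grad V p \<bullet> h) = (\<lambda>h. 0)"
    by (rule has_derivative_local_min[OF C2_has_derivative(1)[OF V(1)]]) (use V in auto)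
  then have g0: "grad V p = 0" by (metis inner_eq_zero_iff)
  have "\<exists>d>0. \<forall>y. norm (y - p) < d \<longrightarrow> norm (grad V y - grad V p - ?H *v (y - p)) \<le> e * norm (y - p)"
    using C2_has_derivative(2)[OF V(1), of p] e unfolding has_derivative_at_alt by blast
  then obtain r where r: "r > 0" "\<And>y. norm (y - p) < r \<Longrightarrow> norm (grad V y - ?H *v (y - p)) \<le> e * norm (y - p)"
    using g0 by auto
  show ?thesis
  proof (rule that[OF r(1)])
    fix h :: "real ^ 'n" assume h: "norm h < r"
    let ?q = "h \<bullet> (?H *v h)"
    define \<phi> where "\<phi> t = V (p + t *\<^sub>R h) - (1/2) * t\<^sup>2 * ?q" for t :: real
    have d: "(\<phi> has_real_derivative (grad V (p + t *\<^sub>R h) \<bullet> h - t * ?q)) (at t)" for t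
    proof -
      have "((\<lambda>t. V (p + t *\<^sub>R h)) has_derivative (\<lambda>s. grad V (p + t *\<^sub>R h) \<bullet> (s *\<^sub>R h))) (at t)"
        by (rule has_derivative_compose[OF _ C2_has_derivative(1)[OF V(1)]]) (auto intro!: derivative_eq_intros)
      then have "((\<lambda>t. V (p + t *\<^sub>R h)) has_real_derivative (grad V (p + t *\<^sub>R h) \<bullet> h)) (at t)"
        unfolding has_field_derivative_def by (simp add: mult_commute_abs)
      then show ?thesis unfolding \<phi>_def by (auto intro!: derivative_eq_intros simp: power2_eq_square)
    qed
    obtain t where t: "0 < t" "t < 1" "\<phi> 1 - \<phi> 0 = (1 - 0) * (grad V (p + t *\<^sub>R h) \<bullet> h - t * ?q)"
      using MVT2[of 0 1 \<phi> "\<lambda>t. grad V (p + t *\<^sub>R h) \<bullet> h - t * ?q"] d by auto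
    have "norm (t *\<^sub>R h) \<le> norm h" using t by (simp add: mult_left_le_one_le)
    then have n: "norm (grad V (p + t *\<^sub>R h) - ?H *v (t *\<^sub>R h)) \<le> e * norm (t *\<^sub>R h)"
      using r(2)[of "p + t *\<^sub>R h"] h by simp
    have "\<phi> 1 - \<phi> 0 = (grad V (p + t *\<^sub>R h) - ?H *v (t *\<^sub>R h)) \<bullet> h"
      using t(3) by (simp add: inner_diff_left inner_diff_right matrix_vector_mult_scaleR inner_commute)
    then have "\<bar>\<phi> 1 - \<phi> 0\<bar> \<le> norm (grad V (p + t *\<^sub>R h) - ?H *v (t *\<^sub>R h)) * norm h"
      using Cauchy_Schwarz_ineq2 by metis
    also have "\<dots> \<le> (e * norm (t *\<^sub>R h)) * norm h" by (rule mult_right_mono[OF n]) simp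
    also have "\<dots> \<le> (e * norm h) * norm h"
      using \<open>norm (t *\<^sub>R h) \<le> norm h\<close> e by (intro mult_right_mono mult_left_mono) auto
    finally show "\<bar>V (p + h) - (1/2) * ?q\<bar> \<le> e * (norm h)\<^sup>2"
      unfolding \<phi>_def using V(3) by (simp add: power2_eq_square mult.assoc)
  qed
qed

text \<open>Half of the Hessian form is \<open>|A h|\<^sup>2\<close>, and the coercivity of \<open>A\<close> turns the error \<open>o(|h|\<^sup>2)\<close> into a
  relative one.\<close>

lemma potential_near_zero:
  fixes V :: "real ^ 'n \<Rightarrow> real"
  assumes V: "C2 V" "\<And>z. 0 \<le> V z" "V p = 0" and pd: "positive_definite (hess V p)" and c: "c > 0"
  defines "A \<equiv> pd_sqrt ((1/2) *\<^sub>R hess V p)"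
  obtains r where "r > 0"
    "\<And>h. norm h < r \<Longrightarrow> (1 - c) * (norm (A *v h))\<^sup>2 \<le> V (p + h) \<and> V (p + h) \<le> (1 + c) * (norm (A *v h))\<^sup>2"
proof -
  note A = pd_sqrt_works[OF positive_definite_half[OF pd], folded A_def]
  have q: "(1/2) * (h \<bullet> (hess V p *v h)) = (norm (A *v h))\<^sup>2" for h
  proof -
    have "(1/2) * (h \<bullet> (hess V p *v h)) = h \<bullet> ((A ** A) *v h)"
      unfolding A(2) by (simp add: scaleR_matrix_vector_assoc[symmetric])
    also have "\<dots> = (A *v h) \<bullet> (A *v h)"
      using A(1) symmetric_matrix_dot[of A] unfolding positive_definite_def by (simp add: matrix_vector_mul_assoc[symmetric])
    finally show ?thesis by (simp add: power2_norm_eq_inner)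
  qed
  obtain l where l: "l > 0" "\<And>y. l * norm y \<le> norm (A *v y)"
    using positive_definite_coercive[OF A(1)] by metis
  have cl: "c * l\<^sup>2 > 0" using c l by simp
  obtain r where r: "r > 0" "\<And>h. norm h < r \<Longrightarrow> \<bar>V (p + h) - (1/2) * (h \<bullet> (hess V p *v h))\<bar> \<le> c * l\<^sup>2 * (norm h)\<^sup>2"
    by (rule C2_taylor_at_zero_min[OF V cl]) (rule that; assumption)
  show ?thesis
  proof (rule that[OF r(1)])
    fix h :: "real ^ 'n" assume "norm h < r"
    then have "\<bar>V (p + h) - (norm (A *v h))\<^sup>2\<bar> \<le> c * (l * norm h)\<^sup>2" using r(2)[of h] q by (simp add: power_mult_distrib mult.assoc)
    also have "\<dots> \<le> c * (norm (A *v h))\<^sup>2"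
      using l c by (intro mult_left_mono power_mono) auto
    finally show "(1 - c) * (norm (A *v h))\<^sup>2 \<le> V (p + h) \<and> V (p + h) \<le> (1 + c) * (norm (A *v h))\<^sup>2"
      by (auto simp: algebra_simps abs_le_iff)
  qed
qed

text \<open>Quadratic forms and, with the other two terms, polynomials that touch a function of \<open>|y - x|\<^sup>2\<close>
  from above along the sphere \<open>|y - x|\<^sup>2 = s\<close>.\<close>

definition quartic :: "real ^ 'n \<Rightarrow> real ^ 'n ^ 'n \<Rightarrow> real \<Rightarrow> real \<Rightarrow> real \<Rightarrow> real ^ 'n \<Rightarrow> real" where
  "quartic x X a b s y = (1/2) * ((y - x) \<bullet> (X *v (y - x))) + a * ((y - x) \<bullet> (y - x)) + b * ((y - x) \<bullet> (y - x) - s)\<^sup>2"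

lemma quartic_derivs:
  fixes X :: "real ^ 'n ^ 'n"
  assumes X: "transpose X = X"
  shows "C2 (quartic x X a b s)"
    "grad (quartic x X a b s) y = X *v (y - x) + (2 * a + 4 * b * ((y - x) \<bullet> (y - x) - s)) *\<^sub>R (y - x)"
    "laplacian (quartic x X a b s) y = trace X + real CARD('n) * (2 * a + 4 * b * ((y - x) \<bullet> (y - x) - s)) + 8 * b * ((y - x) \<bullet> (y - x))"
proof -
  let ?P = "quartic x X a b s"
  define G where "G y = X *v (y - x) + (2 * a + 4 * b * ((y - x) \<bullet> (y - x) - s)) *\<^sub>R (y - x)" for y
  define H :: "real ^ 'n \<Rightarrow> real ^ 'n ^ 'n" where
    "H y = X + mat (2 * a + 4 * b * ((y - x) \<bullet> (y - x) - s)) + (\<chi> i j. 8 * b * (y - x) $ i * (y - x) $ j)" for y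
  have symX: "(X *v u) \<bullet> w = u \<bullet> (X *v w)" for u w using X symmetric_matrix_dot by metis
  have dP: "(?P has_derivative (\<lambda>h. G y \<bullet> h)) (at y)" for y
  proof -
    have "(?P has_derivative (\<lambda>h. (1/2) * (h \<bullet> (X *v (y - x)) + (y - x) \<bullet> (X *v h)) + a * (h \<bullet> (y - x) + (y - x) \<bullet> h)
        + b * (2 * ((y - x) \<bullet> (y - x) - s) * (h \<bullet> (y - x) + (y - x) \<bullet> h)))) (at y)"
      unfolding quartic_def
      by (auto intro!: derivative_eq_intros bounded_linear.has_derivative[OF matrix_vector_mul_bounded_linear] simp: algebra_simps inner_commute)
    moreover have "(1/2) * (h \<bullet> (X *v (y - x)) + (y - x) \<bullet> (X *v h)) + a * (h \<bullet> (y - x) + (y - x) \<bullet> h)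
        + b * (2 * ((y - x) \<bullet> (y - x) - s) * (h \<bullet> (y - x) + (y - x) \<bullet> h)) = G y \<bullet> h" for h
    proof -
      have "(y - x) \<bullet> (X *v h) = h \<bullet> (X *v (y - x))" using symX[of h "y - x"] by (simp add: inner_commute)
      then show ?thesis unfolding G_def by (simp add: inner_add_left inner_commute algebra_simps)
    qed
    ultimately show ?thesis by simp
  qed
  have grad: "grad ?P = G" using grad_eqI[OF dP] by (rule ext)
  have dG: "(G has_derivative (\<lambda>h. H y *v h)) (at y)" for y
  proof -
    have "(G has_derivative (\<lambda>h. X *v h + ((2 * a + 4 * b * ((y - x) \<bullet> (y - x) - s)) *\<^sub>R h
        + (4 * b * (h \<bullet> (y - x) + (y - x) \<bullet> h)) *\<^sub>R (y - x)))) (at y)"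
      unfolding G_def
      by (auto intro!: derivative_eq_intros bounded_linear.has_derivative[OF matrix_vector_mul_bounded_linear] simp: algebra_simps inner_commute)
    moreover have "X *v h + ((2 * a + 4 * b * ((y - x) \<bullet> (y - x) - s)) *\<^sub>R h
        + (4 * b * (h \<bullet> (y - x) + (y - x) \<bullet> h)) *\<^sub>R (y - x)) = H y *v h" for h
    proof -
      have 1: "mat c *v h = c *\<^sub>R h" for c :: real
        by (simp add: vec_eq_iff matrix_vector_mult_def mat_def if_distrib[of "\<lambda>z. z * _"] cong: if_cong)
      have 2: "(\<chi> i j. 8 * b * w $ i * w $ j) *v h = (8 * b * (w \<bullet> h)) *\<^sub>R w" for w
      proof -
        have "(\<Sum>j\<in>UNIV. 8 * b * w $ i * w $ j * h $ j) = (8 * b * (w \<bullet> h)) * w $ i" for i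
        proof -
          have "(\<Sum>j\<in>UNIV. 8 * b * w $ i * w $ j * h $ j) = (\<Sum>j\<in>UNIV. (8 * b * w $ i) * (w $ j * h $ j))"
            by (simp only: mult.assoc)
          also have "\<dots> = (8 * b * w $ i) * (w \<bullet> h)"
            unfolding inner_vec_def by (simp add: sum_distrib_left)
          finally show ?thesis by simp
        qed
        then show ?thesis by (simp add: vec_eq_iff matrix_vector_mult_def)
      qed
      show ?thesis unfolding H_def matrix_vector_mult_add_rdistrib 1 2 by (simp add: inner_commute)
    qed
    ultimately show ?thesis by simp
  qed
  have hess: "hess ?P = H"
  proof
    fix y
    have "frechet_derivative G (at y) = (\<lambda>h. H y *v h)" using frechet_derivative_at[OF dG] by simp
    then show "hess ?P y = H y" unfolding hess_def jacobian_def grad by (simp add: matrix_of_matrix_vector_mul)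
  qed
  show "grad ?P y = X *v (y - x) + (2 * a + 4 * b * ((y - x) \<bullet> (y - x) - s)) *\<^sub>R (y - x)"
    unfolding grad G_def ..
  have "trace (H y) = trace X + real CARD('n) * (2 * a + 4 * b * ((y - x) \<bullet> (y - x) - s)) + 8 * b * ((y - x) \<bullet> (y - x))"
    unfolding H_def trace_def by (simp add: sum.distrib mat_def inner_vec_def sum_distrib_left mult.assoc)
  then show "laplacian ?P y = trace X + real CARD('n) * (2 * a + 4 * b * ((y - x) \<bullet> (y - x) - s)) + 8 * b * ((y - x) \<bullet> (y - x))"
    unfolding laplacian_def hess .
  have "continuous_on UNIV H"
    unfolding H_def mat_def
  proof (intro continuous_intros continuous_on_vec_lambda)
    fix i j :: 'n
    show "continuous_on UNIV (\<lambda>y. if i = j then 2 * a + 4 * b * ((y - x) \<bullet> (y - x) - s) else 0)"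
    proof (cases "i = j")
      case True
      have "continuous_on UNIV (\<lambda>y. 2 * a + 4 * b * ((y - x) \<bullet> (y - x) - s))" by (intro continuous_intros)
      then show ?thesis using True by simp
    next
      case False
      then show ?thesis by simp
    qed
  qed
  show "C2 ?P"
    unfolding C2_def hess grad
  proof (intro conjI allI)
    show "?P differentiable at z" "G differentiable at z" for z
      using dP dG unfolding differentiable_def by blast+
  qed fact
qed

section \<open>Logarithmic barriers for viscosity solutions\<close>

lemma trace_scaleR: "trace (c *\<^sub>R (X :: real ^ 'n ^ 'n)) = c * trace X"
  unfolding trace_def by (simp add: sum_distrib_left)

lemma mat_vector_mult: "mat c *v (h :: real ^ 'n) = c *\<^sub>R h"
  by (simp add: vec_eq_iff matrix_vector_mult_def mat_def if_distrib[of "\<lambda>z. z * _"] cong: if_cong)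

text \<open>The barrier \<open>\<phi>\<close> is finite only inside the ball, so it is no test function itself. Since
  \<open>|ln (1 + w) - w| \<le> 2 w\<^sup>2\<close> for small \<open>w\<close>, replacing the logarithm by a parabola in \<open>|y - x|\<^sup>2\<close> gives a quartic
  polynomial that touches \<open>\<phi>\<close> from above at \<open>z\<close>. Its second derivative is four times that of the
  logarithm, hence the coefficient 16 instead of 4.\<close>

lemma visc_subsolution_log_barrier:
  fixes v :: "real ^ 'n \<Rightarrow> real"
  assumes sub: "visc_subsolution \<epsilon> V v" and X: "transpose X = X" and K: "K > 0" and z: "norm (z - x) < r"
  defines "\<phi> \<equiv> \<lambda>y. (1/2) * ((y - x) \<bullet> (X *v (y - x))) - K * ln (r\<^sup>2 - (norm (y - x))\<^sup>2)"
  assumes ev: "\<forall>\<^sub>F y in nhds z. v y - \<phi> y \<le> v z - \<phi> z"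
  defines "b \<equiv> K / (r\<^sup>2 - (norm (z - x))\<^sup>2)"
  shows "\<epsilon> * v z - \<epsilon> * (trace X + 2 * real CARD('n) * b + 16 * b\<^sup>2 * (norm (z - x))\<^sup>2 / K)
     + (norm (X *v (z - x) + (2 * b) *\<^sub>R (z - x)))\<^sup>2 \<le> V z"
proof -
  define R where "R = r\<^sup>2 - (norm (z - x))\<^sup>2"
  have R: "R > 0"
    using power_strict_mono[OF z norm_ge_zero, of 2] unfolding R_def by simp
  define s where "s = (z - x) \<bullet> (z - x)"
  have s: "s = (norm (z - x))\<^sup>2" unfolding s_def by (simp add: power2_norm_eq_inner)
  define \<beta> where "\<beta> = 2 * b\<^sup>2 / K"
  let ?P = "quartic x X b \<beta> s"
  have "((\<lambda>y. (y - x) \<bullet> (y - x)) \<longlongrightarrow> (z - x) \<bullet> (z - x)) (nhds z)"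
    by (intro tendsto_intros filterlim_ident)
  then have "\<forall>\<^sub>F y in nhds z. dist ((y - x) \<bullet> (y - x)) s < R / 2"
    unfolding s_def using R by (intro tendstoD) auto
  then have "\<forall>\<^sub>F y in nhds z. v y - ?P y \<le> v z - ?P z"
    using ev
  proof eventually_elim
    case (elim y)
    let ?t = "(y - x) \<bullet> (y - x)"
    define u where "u = (?t - s) / R"
    have u: "\<bar>- u\<bar> \<le> 1 / 2" using elim(1) R unfolding u_def dist_real_def by (simp add: divide_le_eq)
    have tR: "r\<^sup>2 - ?t = R * (1 + - u)" using R unfolding u_def R_def s[symmetric] by (simp add: field_simps)
    have "ln (r\<^sup>2 - ?t) = ln R + ln (1 + - u)" unfolding tR using R u by (intro ln_mult_pos) (auto simp: abs_le_iff)
    moreover have "\<bar>ln (1 + - u) - (- u)\<bar> \<le> 2 * (- u)\<^sup>2" by (rule abs_ln_one_plus_x_minus_x_bound[OF u])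
    ultimately have "- ln (r\<^sup>2 - ?t) \<le> - ln R + (u + 2 * u\<^sup>2)" by (simp add: abs_le_iff)
    then have "K * (- ln (r\<^sup>2 - ?t)) \<le> K * (- ln R + (u + 2 * u\<^sup>2))" using K by (intro mult_left_mono) auto
    moreover have "K * u = b * (?t - s)" unfolding u_def b_def R_def[symmetric] by simp
    moreover have "K * (2 * u\<^sup>2) = \<beta> * (?t - s)\<^sup>2"
      unfolding u_def \<beta>_def b_def R_def[symmetric] using K by (simp add: power_divide power2_eq_square)
    ultimately have le: "- K * ln (r\<^sup>2 - ?t) + K * ln R \<le> b * (?t - s) + \<beta> * (?t - s)\<^sup>2"
      by (simp add: algebra_simps)
    have "?P y - ?P z = (1/2) * ((y - x) \<bullet> (X *v (y - x))) - (1/2) * ((z - x) \<bullet> (X *v (z - x))) + (b * (?t - s) + \<beta> * (?t - s)\<^sup>2)"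
      unfolding quartic_def s_def by (simp add: algebra_simps)
    moreover have "\<phi> y - \<phi> z = (1/2) * ((y - x) \<bullet> (X *v (y - x))) - (1/2) * ((z - x) \<bullet> (X *v (z - x))) + (- K * ln (r\<^sup>2 - ?t) + K * ln R)"
      unfolding \<phi>_def R_def by (simp add: power2_norm_eq_inner)
    ultimately show ?case using elim(2) le by linarith
  qed
  then have "\<epsilon> * v z - \<epsilon> * laplacian ?P z + (norm (grad ?P z))\<^sup>2 \<le> V z"
    using sub quartic_derivs(1)[OF X] unfolding visc_subsolution_def by blast
  moreover have "grad ?P z = X *v (z - x) + (2 * b) *\<^sub>R (z - x)"
    using quartic_derivs(2)[OF X, of x b \<beta> s z] unfolding s_def by simp
  moreover have "laplacian ?P z = trace X + 2 * real CARD('n) * b + 16 * b\<^sup>2 * (norm (z - x))\<^sup>2 / K"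
    using quartic_derivs(3)[OF X, of x b \<beta> s z] unfolding s_def \<beta>_def by (simp add: power2_norm_eq_inner)
  ultimately show ?thesis by simp
qed

lemma visc_supersolution_quadratic:
  fixes v :: "real ^ 'n \<Rightarrow> real"
  assumes sup: "visc_supersolution \<epsilon> V v" and X: "transpose X = X"
    and ev: "\<forall>\<^sub>F y in nhds z. v z - (1/2) * ((z - x) \<bullet> (X *v (z - x))) \<le> v y - (1/2) * ((y - x) \<bullet> (X *v (y - x)))"
  shows "V z \<le> \<epsilon> * v z - \<epsilon> * trace X + (norm (X *v (z - x)))\<^sup>2"
proof -
  have P: "quartic x X 0 0 0 = (\<lambda>y. (1/2) * ((y - x) \<bullet> (X *v (y - x))))" unfolding quartic_def by simp
  have "V z \<le> \<epsilon> * v z - \<epsilon> * laplacian (quartic x X 0 0 0) z + (norm (grad (quartic x X 0 0 0) z))\<^sup>2"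
    using sup quartic_derivs(1)[OF X, of x 0 0 0] ev unfolding visc_supersolution_def P by blast
  then show ?thesis by (simp add: quartic_derivs(2,3)[OF X])
qed

text \<open>\<open>exp ((w + K ln (r\<^sup>2 - |y - x|\<^sup>2)) / K)\<close> extends continuously by 0 to the boundary of the ball.\<close>

lemma log_barrier_attains_max:
  fixes w :: "'a::euclidean_space \<Rightarrow> real"
  assumes w: "continuous_on UNIV w" and K: "K > 0" and y0: "\<rho> \<le> norm (y0 - x)" "norm (y0 - x) < r"
  obtains z where "\<rho> \<le> norm (z - x)" "norm (z - x) < r"
    "\<And>y. \<rho> \<le> norm (y - x) \<Longrightarrow> norm (y - x) < r \<Longrightarrow>
       w y + K * ln (r\<^sup>2 - (norm (y - x))\<^sup>2) \<le> w z + K * ln (r\<^sup>2 - (norm (z - x))\<^sup>2)"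
proof -
  \<comment> \<open>The exponential of the function to be maximised, divided by \<open>K\<close>.\<close>
  define g where "g y = (r\<^sup>2 - (norm (y - x))\<^sup>2) * exp (w y / K)" for y
  let ?S = "cball x r \<inter> {y. \<rho> \<le> norm (y - x)}"
  have "compact ?S" by (intro compact_Int_closed closed_Collect_le continuous_intros) auto
  moreover have "y0 \<in> ?S" using y0 by (simp add: dist_norm norm_minus_commute)
  moreover have "continuous_on ?S g"
    unfolding g_def using K by (intro continuous_intros continuous_on_subset[OF w]) auto
  ultimately obtain z where z: "z \<in> ?S" "\<And>y. y \<in> ?S \<Longrightarrow> g y \<le> g z"
    using continuous_attains_sup[of ?S g] by blast
  have r2: "r\<^sup>2 - (norm (y - x))\<^sup>2 > 0" if "norm (y - x) < r" for y
    using power_strict_mono[OF that norm_ge_zero, of 2] by simp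
  have "g z \<ge> g y0" using z(2) \<open>y0 \<in> ?S\<close> .
  moreover have "g y0 > 0" using r2[OF y0(2)] unfolding g_def by simp
  ultimately have "g z > 0" by simp
  then have "0 < r\<^sup>2 - (norm (z - x))\<^sup>2" unfolding g_def by (rule zero_less_mult_pos2) simp
  then have zr2: "(norm (z - x))\<^sup>2 < r\<^sup>2" by simp
  have "0 \<le> r" using norm_ge_zero y0(2) by (rule order_trans[OF _ less_imp_le])
  then have zr: "norm (z - x) < r" using power2_less_imp_less[OF zr2] by blast
  show ?thesis
  proof (rule that[OF _ zr])
    show "\<rho> \<le> norm (z - x)" using z(1) by simp
    fix y assume y: "\<rho> \<le> norm (y - x)" "norm (y - x) < r"
    then have "y \<in> ?S" by (simp add: dist_norm norm_minus_commute)
    then have "g y \<le> g z" by (rule z(2))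
    then have "ln (g y) \<le> ln (g z)" using r2[OF y(2)] by (intro ln_mono) (auto simp: g_def)
    then have "ln (r\<^sup>2 - (norm (y - x))\<^sup>2) + w y / K \<le> ln (r\<^sup>2 - (norm (z - x))\<^sup>2) + w z / K"
      unfolding g_def using r2[OF y(2)] r2[OF zr] by (simp add: ln_mult_pos)
    then have "K * (ln (r\<^sup>2 - (norm (y - x))\<^sup>2) + w y / K) \<le> K * (ln (r\<^sup>2 - (norm (z - x))\<^sup>2) + w z / K)"
      using K by (intro mult_left_mono) auto
    then show "w y + K * ln (r\<^sup>2 - (norm (y - x))\<^sup>2) \<le> w z + K * ln (r\<^sup>2 - (norm (z - x))\<^sup>2)"
      using K by (simp add: algebra_simps)
  qed
qed

text \<open>The comparison function is the cone \<open>c |y - x|\<close>, of slope \<open>c\<close> slightly above \<open>sqrt M\<close>, plus a logarithm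
  that blows up at radius \<open>r\<close>. The blow-up confines the comparison to the ball,
  and \<open>K\<close> is so small that the logarithm adds at most \<open>\<delta>\<close> to the slope at radii up to \<open>r / 2\<close>. The
  Laplacian of the cone is of order \<open>1 / \<rho>\<close> outside the ball of radius \<open>\<rho>\<close> but unbounded at its vertex,
  which is why growth is measured from the maximum \<open>S\<close> over a ball instead of a value at a point.\<close>

lemma visc_subsolution_ball_growth:
  fixes v :: "real ^ 'n \<Rightarrow> real"
  assumes sub: "visc_subsolution \<epsilon> V v" and vc: "continuous_on UNIV v" and v0: "\<And>z. 0 \<le> v z"
    and eps: "0 < \<epsilon>" "\<epsilon> \<le> 3 * \<delta> * r / 16" "\<epsilon> * real CARD('n) \<le> \<delta> * \<rho>"
    and M: "0 \<le> M" "\<And>z. norm (z - x) < r \<Longrightarrow> V z \<le> M"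
    and \<rho>: "0 < \<rho>" "\<rho> \<le> r / 2" and \<delta>: "0 < \<delta>"
    and S: "\<And>z. norm (z - x) \<le> \<rho> \<Longrightarrow> v z \<le> S"
    and y: "\<rho> \<le> norm (y - x)" "norm (y - x) \<le> r / 2"
  shows "v y \<le> S + (sqrt M + 2 * \<delta>) * (norm (y - x) - \<rho>)"
proof -
  define n where "n = real CARD('n)"
  have n: "n > 0" unfolding n_def by simp
  define K where "K = 3 * \<delta> * r / 4"
  define c where "c = sqrt M + \<delta>"
  have r: "r > 0" using \<rho> by simp
  have K: "K > 0" unfolding K_def using \<delta> r by simp
  have c: "c > 0" "c \<ge> \<delta>" unfolding c_def using M \<delta> by (auto simp: add_nonneg_pos)
  have cM: "\<delta> * c \<le> c\<^sup>2 - M"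
  proof -
    have "c\<^sup>2 - M = \<delta> * c + \<delta> * sqrt M" unfolding c_def using M by (simp add: power2_sum power2_eq_square algebra_simps)
    then show ?thesis using \<delta> M by simp
  qed
  have yr: "norm (y - x) < r" using y r by linarith
  have wc: "continuous_on UNIV (\<lambda>y. v y - c * norm (y - x))" by (intro continuous_intros vc)
  obtain z where z: "\<rho> \<le> norm (z - x)" "norm (z - x) < r"
    "\<And>y. \<rho> \<le> norm (y - x) \<Longrightarrow> norm (y - x) < r \<Longrightarrow>
       v y - c * norm (y - x) + K * ln (r\<^sup>2 - (norm (y - x))\<^sup>2) \<le> v z - c * norm (z - x) + K * ln (r\<^sup>2 - (norm (z - x))\<^sup>2)"
    by (rule log_barrier_attains_max[OF wc K y(1) yr]) (rule that; assumption)
  \<comment> \<open>An interior maximum would violate the equation.\<close>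
  have zS: "norm (z - x) = \<rho>"
  proof (rule ccontr)
    assume "norm (z - x) \<noteq> \<rho>"
    define t where "t = norm (z - x)"
    have t: "t > \<rho>" "t < r" "t > 0" using \<open>norm (z - x) \<noteq> \<rho>\<close> z \<rho> unfolding t_def by auto
    define X :: "real ^ 'n ^ 'n" where "X = mat (c / t)"
    have X: "transpose X = X" unfolding X_def by (simp add: transpose_mat)
    have Xh: "X *v h = (c / t) *\<^sub>R h" for h unfolding X_def by (rule mat_vector_mult)
    have tr: "trace X = n * (c / t)" unfolding X_def trace_def mat_def n_def by simp
    define b where "b = K / (r\<^sup>2 - t\<^sup>2)"
    have "t\<^sup>2 < r\<^sup>2" using t by (intro power_strict_mono) auto
    then have b: "b > 0" unfolding b_def using K by simp
    have "((\<lambda>y. norm (y - x)) \<longlongrightarrow> t) (nhds z)" unfolding t_def by (intro tendsto_intros filterlim_ident)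
    then have "\<forall>\<^sub>F y in nhds z. \<rho> < norm (y - x)" "\<forall>\<^sub>F y in nhds z. norm (y - x) < r"
      using t by (auto dest: order_tendstoD)
    then have ev: "\<forall>\<^sub>F y in nhds z. v y - ((1/2) * ((y - x) \<bullet> (X *v (y - x))) - K * ln (r\<^sup>2 - (norm (y - x))\<^sup>2))
        \<le> v z - ((1/2) * ((z - x) \<bullet> (X *v (z - x))) - K * ln (r\<^sup>2 - (norm (z - x))\<^sup>2))"
    proof eventually_elim
      case (elim y)
      \<comment> \<open>The cone lies below a paraboloid that touches it on the sphere of radius \<open>t\<close>.\<close>
      have "0 \<le> (norm (y - x) - t)\<^sup>2" by simp
      then have "2 * (t * norm (y - x)) \<le> (norm (y - x))\<^sup>2 + t\<^sup>2" by (simp add: power2_diff algebra_simps)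
      then have "c / (2 * t) * (2 * (t * norm (y - x))) \<le> c / (2 * t) * ((norm (y - x))\<^sup>2 + t\<^sup>2)"
        using c t by (intro mult_left_mono) auto
      then have "c * norm (y - x) \<le> c / (2 * t) * (norm (y - x))\<^sup>2 + c * t / 2"
        using t by (simp add: distrib_left power2_eq_square)
      moreover have "(1/2) * ((z - x) \<bullet> (X *v (z - x))) = c * t - c * t / 2"
        unfolding Xh using t by (simp add: dot_square_norm t_def[symmetric] power2_eq_square)
      moreover have "(1/2) * ((y - x) \<bullet> (X *v (y - x))) = c / (2 * t) * (norm (y - x))\<^sup>2"
        unfolding Xh by (simp add: dot_square_norm)
      ultimately show ?case using z(3)[of y] elim t unfolding t_def[symmetric] by linarith
    qed
    have main: "\<epsilon> * v z - \<epsilon> * (n * (c / t) + 2 * n * b + 16 * b\<^sup>2 * t\<^sup>2 / K) + (norm (X *v (z - x) + (2 * b) *\<^sub>R (z - x)))\<^sup>2 \<le> V z"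
      using visc_subsolution_log_barrier[OF sub X K z(2) ev]
      unfolding t_def[symmetric] b_def[symmetric] tr n_def[symmetric] by simp
    have "norm (X *v (z - x) + (2 * b) *\<^sub>R (z - x)) = c + 2 * b * t"
    proof -
      have "X *v (z - x) + (2 * b) *\<^sub>R (z - x) = (c / t + 2 * b) *\<^sub>R (z - x)" unfolding Xh by (simp add: scaleR_add_left)
      then have "norm (X *v (z - x) + (2 * b) *\<^sub>R (z - x)) = \<bar>c / t + 2 * b\<bar> * t" by (simp add: t_def)
      also have "\<dots> = (c / t + 2 * b) * t" using c t b by simp
      also have "\<dots> = c + 2 * b * t" using t by (simp add: distrib_right)
      finally show ?thesis .
    qed
    then have g: "(norm (X *v (z - x) + (2 * b) *\<^sub>R (z - x)))\<^sup>2 = c\<^sup>2 + 4 * (c * (b * t)) + 4 * (b\<^sup>2 * t\<^sup>2)"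
      by (simp add: power2_eq_square algebra_simps)
    have en: "\<epsilon> * n < \<delta> * t" using eps(3) \<delta> t(1) unfolding n_def by (smt (verit) mult_strict_left_mono)
    have p1: "\<epsilon> * (n * (c / t)) < c\<^sup>2 - M"
    proof -
      have "\<epsilon> * (n * (c / t)) = (\<epsilon> * n) * (c / t)" by simp
      also have "\<dots> < (\<delta> * t) * (c / t)" using en c t by (intro mult_strict_right_mono) auto
      also have "\<dots> = \<delta> * c" using t by simp
      finally show ?thesis using cM by simp
    qed
    have p2: "\<epsilon> * (2 * n * b) \<le> 4 * (c * (b * t))"
    proof -
      have "\<delta> * t \<le> c * t" using c t by simp
      then have "\<epsilon> * n \<le> c * t" using en by simp
      then have "(\<epsilon> * n) * (2 * b) \<le> (c * t) * (2 * b)" using b by (intro mult_right_mono) auto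
      moreover have "0 \<le> c * (b * t)" using c b t by simp
      ultimately show ?thesis by (simp add: algebra_simps)
    qed
    have p3: "\<epsilon> * (16 * b\<^sup>2 * t\<^sup>2 / K) \<le> 4 * (b\<^sup>2 * t\<^sup>2)"
    proof -
      have "4 * \<epsilon> / K \<le> 1" using eps(2) K unfolding K_def by (simp add: divide_le_eq)
      then have "(4 * \<epsilon> / K) * (4 * (b\<^sup>2 * t\<^sup>2)) \<le> 1 * (4 * (b\<^sup>2 * t\<^sup>2))" by (intro mult_right_mono) auto
      then show ?thesis by (simp add: algebra_simps)
    qed
    have "0 \<le> \<epsilon> * v z" using eps v0 by simp
    moreover have "V z \<le> M" using M(2) z(2) by blast
    ultimately show False using main[unfolded g distrib_left] p1 p2 p3 by linarith
  qed
  let ?t = "norm (y - x)"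
  have q: "?t\<^sup>2 \<le> r\<^sup>2 / 4" using power_mono[OF y(2) norm_ge_zero, of 2] by (simp add: power_divide)
  have D: "r\<^sup>2 - ?t\<^sup>2 \<ge> 3 * r\<^sup>2 / 4" using q by simp
  have D0: "r\<^sup>2 - ?t\<^sup>2 > 0" using D r by (smt (verit) divide_pos_pos zero_less_power)
  have \<rho>t: "\<rho>\<^sup>2 \<le> ?t\<^sup>2" using y \<rho> by (intro power_mono) auto
  have "ln (r\<^sup>2 - \<rho>\<^sup>2) - ln (r\<^sup>2 - ?t\<^sup>2) = ln ((r\<^sup>2 - \<rho>\<^sup>2) / (r\<^sup>2 - ?t\<^sup>2))"
    using D0 \<rho>t by (intro ln_divide_pos[symmetric]) auto
  also have "\<dots> \<le> (r\<^sup>2 - \<rho>\<^sup>2) / (r\<^sup>2 - ?t\<^sup>2) - 1" using D0 \<rho>t by (intro ln_le_minus_one divide_pos_pos) auto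
  also have "\<dots> = (?t\<^sup>2 - \<rho>\<^sup>2) / (r\<^sup>2 - ?t\<^sup>2)" using D0 by (simp add: field_simps)
  also have "\<dots> \<le> (r * (?t - \<rho>)) / (3 * r\<^sup>2 / 4)"
  proof (rule frac_le[OF _ _ _ D])
    have "(?t + \<rho>) * (?t - \<rho>) \<le> r * (?t - \<rho>)" using y \<rho> by (intro mult_right_mono) auto
    then show "?t\<^sup>2 - \<rho>\<^sup>2 \<le> r * (?t - \<rho>)" by (simp add: power2_eq_square algebra_simps)
  qed (use r y in auto)
  finally have "K * (ln (r\<^sup>2 - \<rho>\<^sup>2) - ln (r\<^sup>2 - ?t\<^sup>2)) \<le> K * ((r * (?t - \<rho>)) / (3 * r\<^sup>2 / 4))"
    using K by (intro mult_left_mono) auto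
  also have "\<dots> = \<delta> * (?t - \<rho>)" unfolding K_def using r by (simp add: field_simps power2_eq_square)
  finally have "K * (ln (r\<^sup>2 - \<rho>\<^sup>2) - ln (r\<^sup>2 - ?t\<^sup>2)) \<le> \<delta> * (?t - \<rho>)" .
  moreover have "v z \<le> S" using S zS by simp
  moreover have "v y - c * ?t + K * ln (r\<^sup>2 - ?t\<^sup>2) \<le> v z - c * \<rho> + K * ln (r\<^sup>2 - \<rho>\<^sup>2)"
    using z(3)[OF y(1) yr] unfolding zS .
  ultimately show ?thesis unfolding c_def by (simp add: algebra_simps)
qed

text \<open>The function \<open>(1 + \<delta>) tr A + \<delta> + (1 + \<delta>) h \<bullet> A h / 2\<close> is a strict supersolution. The logarithm makes the
  comparison local. Where \<open>|h|\<^sup>2 \<ge> r\<^sup>2 / 2\<close> the square of its gradient dominates its Laplacian; closer to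
  the centre its Laplacian is less than the margin \<open>\<delta>\<close> by the choice of \<open>K\<close>.\<close>

lemma visc_subsolution_near_zero:
  fixes v :: "real ^ 'n \<Rightarrow> real"
  assumes sub: "visc_subsolution \<epsilon> V v" and vc: "continuous_on UNIV v"
    and A: "positive_definite A" and \<delta>: "0 < \<delta>" and r: "0 < r"
    and V: "\<And>h. norm h < r \<Longrightarrow> V (x + h) \<le> (1 + \<delta>)\<^sup>2 * (norm (A *v h))\<^sup>2"
  defines "K \<equiv> \<delta> * r\<^sup>2 / (4 * real CARD('n))"
  assumes eps: "0 < \<epsilon>" "\<epsilon> \<le> K / 8" "\<epsilon> \<le> K / (2 * real CARD('n))" and h: "norm h < r"
  shows "v (x + h) \<le> (1 + \<delta>) * trace A + \<delta> + (1/2) * (1 + \<delta>) * (h \<bullet> (A *v h)) + K * (ln (r\<^sup>2) - ln (r\<^sup>2 - (norm h)\<^sup>2))"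
proof -
  define n where "n = real CARD('n)"
  have n: "n > 0" unfolding n_def by simp
  have K: "K > 0" unfolding K_def using \<delta> r by simp
  define C where "C = (1 + \<delta>) * trace A + \<delta>"
  define X where "X = (1 + \<delta>) *\<^sub>R A"
  have AT: "transpose A = A" and Apos: "0 \<le> w \<bullet> (A *v w)" for w
    using A unfolding positive_definite_def by (auto simp: less_imp_le) (cases "w = 0", auto simp: less_imp_le)
  have X: "transpose X = X" unfolding X_def using AT by (simp add: transpose_scalar)
  have Xh: "X *v h = (1 + \<delta>) *\<^sub>R (A *v h)" for h unfolding X_def by (simp add: scaleR_matrix_vector_assoc)
  have wc: "continuous_on UNIV (\<lambda>y. v y - (1/2) * ((y - x) \<bullet> (X *v (y - x))))"
    by (intro continuous_intros vc bounded_linear.continuous_on[OF matrix_vector_mul_bounded_linear])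
  have x0: "0 \<le> norm (x - x)" "norm (x - x) < r" using r by auto
  obtain z where z: "0 \<le> norm (z - x)" "norm (z - x) < r"
    "\<And>y. 0 \<le> norm (y - x) \<Longrightarrow> norm (y - x) < r \<Longrightarrow>
       v y - (1/2) * ((y - x) \<bullet> (X *v (y - x))) + K * ln (r\<^sup>2 - (norm (y - x))\<^sup>2) \<le> v z - (1/2) * ((z - x) \<bullet> (X *v (z - x))) + K * ln (r\<^sup>2 - (norm (z - x))\<^sup>2)"
    by (rule log_barrier_attains_max[OF wc K x0]) (rule that; assumption)
  have low: "v z - (1/2) * ((z - x) \<bullet> (X *v (z - x))) + K * ln (r\<^sup>2 - (norm (z - x))\<^sup>2) \<le> C + K * ln (r\<^sup>2)"
  proof (rule ccontr)
    assume neg: "\<not> ?thesis"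
    define t where "t = norm (z - x)"
    have t2: "t\<^sup>2 < r\<^sup>2" unfolding t_def using z(2) by (intro power_strict_mono) auto
    define b where "b = K / (r\<^sup>2 - t\<^sup>2)"
    have b: "b > 0" unfolding b_def using K t2 by simp
    have "ln (r\<^sup>2 - t\<^sup>2) \<le> ln (r\<^sup>2)" using t2 by (intro ln_mono) auto
    then have "K * ln (r\<^sup>2 - t\<^sup>2) \<le> K * ln (r\<^sup>2)" using K by simp
    moreover have "0 \<le> (1/2) * ((z - x) \<bullet> (X *v (z - x)))" unfolding Xh using \<delta> Apos by simp
    ultimately have vC: "v z > C" using neg unfolding t_def by linarith
    have "((\<lambda>y. norm (y - x)) \<longlongrightarrow> norm (z - x)) (nhds z)" by (intro tendsto_intros filterlim_ident)
    then have "\<forall>\<^sub>F y in nhds z. norm (y - x) < r" using z(2) by (auto dest: order_tendstoD)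
    then have ev: "\<forall>\<^sub>F y in nhds z. v y - ((1/2) * ((y - x) \<bullet> (X *v (y - x))) - K * ln (r\<^sup>2 - (norm (y - x))\<^sup>2))
        \<le> v z - ((1/2) * ((z - x) \<bullet> (X *v (z - x))) - K * ln (r\<^sup>2 - (norm (z - x))\<^sup>2))"
      by eventually_elim (use z(3) in force)
    have main: "\<epsilon> * v z - \<epsilon> * (trace X + 2 * n * b + 16 * b\<^sup>2 * t\<^sup>2 / K) + (norm (X *v (z - x) + (2 * b) *\<^sub>R (z - x)))\<^sup>2 \<le> V z"
      using visc_subsolution_log_barrier[OF sub X K z(2) ev]
      unfolding t_def[symmetric] b_def[symmetric] n_def[symmetric] by simp
    define w where "w = z - x"
    have "(norm (X *v w + (2 * b) *\<^sub>R w))\<^sup>2 = (1 + \<delta>)\<^sup>2 * (norm (A *v w))\<^sup>2 + 4 * b * (1 + \<delta>) * (w \<bullet> (A *v w)) + 4 * b\<^sup>2 * t\<^sup>2"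
      unfolding Xh t_def w_def[symmetric] power2_norm_eq_inner
      by (simp add: inner_add_left inner_add_right inner_commute power2_eq_square algebra_simps)
    moreover have "0 \<le> 4 * b * (1 + \<delta>) * (w \<bullet> (A *v w))" using b \<delta> Apos by simp
    moreover have "V z \<le> (1 + \<delta>)\<^sup>2 * (norm (A *v w))\<^sup>2" using V[of w] z(2) unfolding w_def by simp
    ultimately have "\<epsilon> * v z - \<epsilon> * (trace X + 2 * n * b + 16 * b\<^sup>2 * t\<^sup>2 / K) + 4 * b\<^sup>2 * t\<^sup>2 \<le> 0"
      using main unfolding w_def[symmetric] by linarith
    moreover have "\<epsilon> * v z > \<epsilon> * C" using vC eps by simp
    moreover have "\<epsilon> * C = \<epsilon> * trace X + \<epsilon> * \<delta>" unfolding C_def X_def by (simp add: trace_scaleR distrib_left)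
    ultimately have ineq: "\<epsilon> * \<delta> + 4 * b\<^sup>2 * t\<^sup>2 < \<epsilon> * (2 * n * b) + \<epsilon> * (16 * b\<^sup>2 * t\<^sup>2 / K)"
      by (simp add: distrib_left)
    have p3: "\<epsilon> * (16 * b\<^sup>2 * t\<^sup>2 / K) \<le> 2 * b\<^sup>2 * t\<^sup>2"
    proof -
      have "8 * \<epsilon> / K \<le> 1" using eps(2) K by (simp add: divide_le_eq)
      then have "(8 * \<epsilon> / K) * (2 * (b\<^sup>2 * t\<^sup>2)) \<le> 1 * (2 * (b\<^sup>2 * t\<^sup>2))" by (intro mult_right_mono) auto
      then show ?thesis by (simp add: algebra_simps)
    qed
    have ineq2: "\<epsilon> * \<delta> + 2 * b\<^sup>2 * t\<^sup>2 < \<epsilon> * (2 * n * b)" using ineq p3 by linarith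
    show False
    proof (cases "t\<^sup>2 \<ge> r\<^sup>2 / 2")
      case True
      have "K / 2 \<le> b * t\<^sup>2"
      proof -
        have "b \<ge> K / r\<^sup>2" unfolding b_def using K t2 by (intro frac_le) auto
        then have "(K / r\<^sup>2) * (r\<^sup>2 / 2) \<le> b * t\<^sup>2" using True b K by (intro mult_mono) auto
        then show ?thesis using r by simp
      qed
      then have "2 * b * (K / 2) \<le> 2 * b * (b * t\<^sup>2)" using b by (intro mult_left_mono) auto
      moreover have "\<epsilon> * (2 * n) \<le> K" using eps(3) n unfolding n_def by (simp add: le_divide_eq)
      then have "(\<epsilon> * (2 * n)) * b \<le> K * b" using b by (intro mult_right_mono) auto
      moreover have "0 \<le> \<epsilon> * \<delta>" using eps \<delta> by simp
      ultimately show False using ineq2 by (simp add: power2_eq_square algebra_simps)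
    next
      case False
      then have "r\<^sup>2 / 2 \<le> r\<^sup>2 - t\<^sup>2" by simp
      then have "b \<le> K / (r\<^sup>2 / 2)" unfolding b_def using K r by (intro frac_le) auto
      also have "\<dots> = \<delta> / (2 * n)" unfolding K_def n_def using r by (simp add: field_simps)
      finally have "2 * n * b \<le> \<delta>" using n by (simp add: field_simps)
      then have "\<epsilon> * (2 * n * b) \<le> \<epsilon> * \<delta>" using eps by (intro mult_left_mono) auto
      moreover have "0 \<le> 2 * b\<^sup>2 * t\<^sup>2" by simp
      ultimately show False using ineq2 by linarith
    qed
  qed
  have "v (x + h) - (1/2) * (h \<bullet> (X *v h)) + K * ln (r\<^sup>2 - (norm h)\<^sup>2) \<le> C + K * ln (r\<^sup>2)"
    using z(3)[of "x + h"] h low by simp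
  then show ?thesis unfolding C_def Xh by (simp add: algebra_simps add_divide_distrib)
qed

section \<open>The upper bound\<close>

lemma lattice_shift_unit_cube:
  fixes z :: "real ^ 'n"
  obtains k where "k \<in> int_lattice" "z + k \<in> cbox 0 1"
proof
  let ?k = "(\<chi> i. - of_int \<lfloor>z $ i\<rfloor>) :: real ^ 'n"
  show "?k \<in> int_lattice" unfolding int_lattice_def by simp
  show "z + ?k \<in> cbox 0 1"
    unfolding mem_box_cart
  proof (intro allI conjI)
    fix i
    show "0 $ i \<le> (z + ?k) $ i" by simp
    have "z $ i \<le> 1 + real_of_int \<lfloor>z $ i\<rfloor>" by linarith
    then show "(z + ?k) $ i \<le> 1 $ i" by simp
  qed
qed

lemma torus_fun_shift: "torus_fun f \<Longrightarrow> k \<in> int_lattice \<Longrightarrow> f (z + k) = f z"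
  unfolding torus_fun_def by blast

lemma torus_fun_attains_inf:
  fixes f :: "real ^ 'n \<Rightarrow> real"
  assumes "torus_fun f" "continuous_on UNIV f"
  obtains z where "\<And>y. f z \<le> f y"
proof -
  have "(0 :: real ^ 'n) \<in> cbox 0 1" by (simp add: mem_box_cart)
  then have "compact (cbox 0 1 :: (real ^ 'n) set)" "cbox 0 1 \<noteq> ({} :: (real ^ 'n) set)" by auto
  then obtain z where z: "z \<in> cbox 0 1" "\<And>y. y \<in> cbox 0 1 \<Longrightarrow> f z \<le> f y"
    using continuous_attains_inf[of "cbox 0 1" f] continuous_on_subset[OF assms(2)] by blast
  show ?thesis
  proof (rule that)
    fix y :: "real ^ 'n"
    obtain k where "k \<in> int_lattice" "y + k \<in> cbox 0 1" using lattice_shift_unit_cube by blast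
    then show "f z \<le> f y" using z(2) torus_fun_shift[OF assms(1)] by metis
  qed
qed

lemma torus_fun_bounded_above:
  fixes f :: "real ^ 'n \<Rightarrow> real"
  assumes "torus_fun f" "continuous_on UNIV f"
  obtains C where "C > 0" "\<And>y. f y \<le> C"
proof -
  have "torus_fun (\<lambda>y. - f y)" using assms(1) unfolding torus_fun_def by simp
  moreover have "continuous_on UNIV (\<lambda>y. - f y)" by (intro continuous_intros assms(2))
  ultimately obtain z where "\<And>y. - f z \<le> - f y" by (rule torus_fun_attains_inf) blast
  then have "f y \<le> \<bar>f z\<bar> + 1" for y by (smt (verit))
  then show ?thesis using that[of "\<bar>f z\<bar> + 1"] by simp
qed

lemma torus_fun_uniformly_continuous:
  fixes f :: "real ^ 'n \<Rightarrow> real"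
  assumes per: "torus_fun f" and f: "continuous_on UNIV f" and e: "e > 0"
  obtains r where "r > 0" "\<And>y z. dist y z < r \<Longrightarrow> \<bar>f y - f z\<bar> < e"
proof -
  define C where "C = {x + y |x y. x \<in> cbox 0 (1 :: real ^ 'n) \<and> y \<in> cball (0 :: real ^ 'n) 1}"
  have "compact C" unfolding C_def by (rule compact_sums) auto
  then have uc: "uniformly_continuous_on C f"
    by (rule compact_uniformly_continuous[OF continuous_on_subset[OF f subset_UNIV]])
  obtain r where r: "r > 0" "\<And>y z. y \<in> C \<Longrightarrow> z \<in> C \<Longrightarrow> dist z y < r \<Longrightarrow> dist (f z) (f y) < e"
    using uniformly_continuous_onE[OF uc e] by blast
  show ?thesis
  proof (rule that[of "min r 1"])
    fix y z :: "real ^ 'n" assume d: "dist y z < min r 1"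
    obtain k where k: "k \<in> int_lattice" "y + k \<in> cbox 0 1" using lattice_shift_unit_cube by blast
    have "y + k = (y + k) + 0" "z + k = (y + k) + (z - y)" by simp_all
    moreover have "z - y \<in> cball 0 1" using d by (simp add: dist_norm norm_minus_commute)
    moreover have "(0 :: real ^ 'n) \<in> cball 0 1" by simp
    ultimately have "y + k \<in> C" "z + k \<in> C" unfolding C_def using k(2) by blast+
    moreover have "dist (y + k) (z + k) < r" using d by (simp add: dist_norm)
    ultimately have "dist (f (y + k)) (f (z + k)) < e" using r(2) by blast
    then show "\<bar>f y - f z\<bar> < e" using torus_fun_shift[OF per k(1)] by (simp add: dist_real_def)
  qed (use r in auto)
qed

text \<open>Compactness of the unit cube makes a locally uniform property for small \<open>\<epsilon>\<close> uniform.\<close>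

lemma torus_eventually_uniform:
  fixes Q :: "real \<Rightarrow> real ^ 'n \<Rightarrow> bool"
  assumes per: "\<And>\<epsilon> y k. k \<in> int_lattice \<Longrightarrow> Q \<epsilon> (y + k) = Q \<epsilon> y"
    and loc: "\<And>x. \<exists>d>0. \<exists>\<epsilon>0>0. \<forall>\<epsilon>. 0 < \<epsilon> \<longrightarrow> \<epsilon> < \<epsilon>0 \<longrightarrow> (\<forall>y. dist x y < d \<longrightarrow> Q \<epsilon> y)"
  shows "\<exists>\<epsilon>0>0. \<forall>\<epsilon>. 0 < \<epsilon> \<longrightarrow> \<epsilon> < \<epsilon>0 \<longrightarrow> (\<forall>y. Q \<epsilon> y)"
proof -
  obtain d e where de: "\<And>x. d x > 0" "\<And>x. e x > 0"
    "\<And>x \<epsilon> y. 0 < \<epsilon> \<Longrightarrow> \<epsilon> < e x \<Longrightarrow> dist x y < d x \<Longrightarrow> Q \<epsilon> y"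
    using loc by metis
  have cp: "compact (cbox 0 1 :: (real ^ 'n) set)" by auto
  have cov: "cbox 0 1 \<subseteq> (\<Union>x\<in>cbox 0 1. ball x (d x))" using de(1) by (auto intro: centre_in_ball[THEN iffD2])
  obtain C where C: "C \<subseteq> cbox 0 1" "finite C" "cbox 0 1 \<subseteq> (\<Union>x\<in>C. ball x (d x))"
    by (rule compactE_image[OF cp _ cov], simp) (rule that; assumption)
  define m where "m = Min (insert 1 (e ` C))"
  have m: "m > 0" unfolding m_def using C(2) de(2) by (subst Min_gr_iff) auto
  have me: "m \<le> e x" if "x \<in> C" for x unfolding m_def using C(2) that by (intro Min_le) auto
  show ?thesis
  proof (intro exI[of _ m] conjI allI impI)
    fix \<epsilon> and y :: "real ^ 'n" assume \<epsilon>: "0 < \<epsilon>" "\<epsilon> < m"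
    obtain k where k: "k \<in> int_lattice" "y + k \<in> cbox 0 1" using lattice_shift_unit_cube by blast
    then obtain x where "x \<in> C" "dist x (y + k) < d x" using C(3) by auto
    then have "Q \<epsilon> (y + k)" using de(3) \<epsilon> me by (meson less_le_trans)
    then show "Q \<epsilon> y" using per k by blast
  qed (rule m)
qed

text \<open>At a minimum of \<open>v\<close> a constant is an admissible test function.\<close>

lemma visc_solution_nonneg:
  fixes v :: "real ^ 'n \<Rightarrow> real"
  assumes v: "visc_solution \<epsilon> V v" and eps: "0 < \<epsilon>" and V: "\<And>z. 0 \<le> V z"
  shows "0 \<le> v y"
proof -
  obtain z where z: "\<And>y. v z \<le> v y"
    using torus_fun_attains_inf v unfolding visc_solution_def by blast
  have "V z \<le> \<epsilon> * v z - \<epsilon> * trace (0 :: real ^ 'n ^ 'n) + (norm ((0 :: real ^ 'n ^ 'n) *v (z - 0)))\<^sup>2"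
    using v z unfolding visc_solution_def
    by (intro visc_supersolution_quadratic) (auto simp: transpose_def vec_eq_iff)
  then have "0 \<le> \<epsilon> * v z" using V[of z] by (simp add: trace_def)
  then have "0 \<le> v z" using eps by (simp add: zero_le_mult_iff)
  then show ?thesis using z[of y] by simp
qed

locale vanishing_viscosity = torus_potential V B for V :: "real ^ 'n \<Rightarrow> real" and B +
  fixes v :: "real \<Rightarrow> real ^ 'n \<Rightarrow> real"
  assumes C2V: "C2 V" and solution: "\<And>\<epsilon>. 0 < \<epsilon> \<Longrightarrow> visc_solution \<epsilon> V (v \<epsilon>)"
begin

lemma solution_props:
  assumes "0 < \<epsilon>"
  shows "torus_fun (v \<epsilon>)" "continuous_on UNIV (v \<epsilon>)" "visc_subsolution \<epsilon> V (v \<epsilon>)"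
    "visc_supersolution \<epsilon> V (v \<epsilon>)" "0 \<le> v \<epsilon> y"
  using solution[OF assms] visc_solution_nonneg[OF solution[OF assms] assms nonneg]
  unfolding visc_solution_def by auto

lemma sqrt_V_uniformly_continuous:
  assumes "e > 0"
  obtains r where "r > 0" "\<And>y z. dist y z < r \<Longrightarrow> \<bar>sqrt (V y) - sqrt (V z)\<bar> < e"
proof (rule torus_fun_uniformly_continuous[OF _ _ assms, of "\<lambda>y. sqrt (V y)"])
  show "torus_fun (\<lambda>y. sqrt (V y))" using periodic unfolding torus_fun_def by simp
  show "continuous_on UNIV (\<lambda>y. sqrt (V y))" by (intro continuous_intros cont)
qed (rule that; assumption)

text \<open>For small \<open>\<epsilon>\<close> this function satisfies the eikonal slope bound up to any prescribed error.\<close>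

definition ball_sup :: "real \<Rightarrow> real \<Rightarrow> real ^ 'n \<Rightarrow> real" where
  "ball_sup \<epsilon> \<rho> y = Sup (v \<epsilon> ` cball y \<rho>)"

lemma ball_sup_upper:
  assumes "0 < \<epsilon>" "norm (z - y) \<le> \<rho>"
  shows "v \<epsilon> z \<le> ball_sup \<epsilon> \<rho> y"
  unfolding ball_sup_def
proof (rule cSup_upper)
  show "v \<epsilon> z \<in> v \<epsilon> ` cball y \<rho>" using assms by (auto simp: dist_norm norm_minus_commute)
  have "compact (v \<epsilon> ` cball y \<rho>)"
    by (intro compact_continuous_image continuous_on_subset[OF solution_props(2)[OF assms(1)]]) auto
  then show "bdd_above (v \<epsilon> ` cball y \<rho>)" by (intro bounded_imp_bdd_above compact_imp_bounded)
qed

lemma ball_sup_least: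
  assumes "0 \<le> \<rho>" "\<And>z. norm (z - y) \<le> \<rho> \<Longrightarrow> v \<epsilon> z \<le> c"
  shows "ball_sup \<epsilon> \<rho> y \<le> c"
  unfolding ball_sup_def using assms by (intro cSup_least) (auto simp: dist_norm norm_minus_commute)

lemma ball_sup_periodic:
  assumes "0 < \<epsilon>"
  shows "torus_fun (ball_sup \<epsilon> \<rho>)"
  unfolding torus_fun_def
proof (intro allI ballI)
  fix z k :: "real ^ 'n" assume k: "k \<in> int_lattice"
  have "cball (z + k) \<rho> = (\<lambda>y. y + k) ` cball z \<rho>"
  proof (intro set_eqI iffI)
    fix y assume "y \<in> cball (z + k) \<rho>"
    then have "y - k \<in> cball z \<rho>" by (simp add: dist_norm algebra_simps)
    then show "y \<in> (\<lambda>y. y + k) ` cball z \<rho>" by (rule rev_image_eqI) simp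
  qed (auto simp: dist_norm)
  then have "v \<epsilon> ` cball (z + k) \<rho> = v \<epsilon> ` cball z \<rho>"
    using torus_fun_shift[OF solution_props(1)[OF assms] k] by (simp add: image_image)
  then show "ball_sup \<epsilon> \<rho> (z + k) = ball_sup \<epsilon> \<rho> z" unfolding ball_sup_def by simp
qed

text \<open>The preceding growth estimate on overlapping balls, with \<open>V\<close> nearly constant on each of them.\<close>

lemma ball_sup_slope:
  assumes \<delta>: "\<delta> > 0"
  obtains r where "r > 0" "\<And>\<rho>. 0 < \<rho> \<Longrightarrow> \<rho> \<le> r \<Longrightarrow> \<exists>\<epsilon>0>0. \<forall>\<epsilon>. 0 < \<epsilon> \<longrightarrow> \<epsilon> < \<epsilon>0 \<longrightarrow>
     (\<forall>y z. dist y z \<le> r \<longrightarrow> \<bar>ball_sup \<epsilon> \<rho> z - ball_sup \<epsilon> \<rho> y\<bar> \<le> (sqrt (V y) + 4 * \<delta>) * dist y z)"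
proof -
  obtain r where r: "r > 0" "\<And>y z. dist y z < r \<Longrightarrow> \<bar>sqrt (V y) - sqrt (V z)\<bar> < \<delta>"
    using sqrt_V_uniformly_continuous[OF \<delta>] by blast
  define n where "n = real CARD('n)"
  have n: "n > 0" unfolding n_def by simp
  show ?thesis
  proof (rule that[of "r / 4"])
    fix \<rho> assume \<rho>: "0 < \<rho>" "\<rho> \<le> r / 4"
    define \<epsilon>0 where "\<epsilon>0 = min (3 * \<delta> * r / 16) (\<delta> * \<rho> / n)"
    have "\<epsilon>0 > 0" unfolding \<epsilon>0_def using \<delta> r \<rho> n by simp
    moreover have "\<bar>ball_sup \<epsilon> \<rho> z - ball_sup \<epsilon> \<rho> y\<bar> \<le> (sqrt (V y) + 4 * \<delta>) * dist y z"
      if \<epsilon>: "0 < \<epsilon>" "\<epsilon> < \<epsilon>0" and yz: "dist y z \<le> r / 4" for \<epsilon> y z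
    proof -
      have e: "\<epsilon> \<le> 3 * \<delta> * r / 16" "\<epsilon> * n \<le> \<delta> * \<rho>"
        using \<epsilon>(2) n unfolding \<epsilon>0_def by (auto simp: less_divide_eq)
      have one: "ball_sup \<epsilon> \<rho> z \<le> ball_sup \<epsilon> \<rho> y + (sqrt (V y) + 3 * \<delta>) * dist y z"
        if yz: "dist y z \<le> r / 4" for y z
      proof (rule ball_sup_least)
        fix w assume w: "norm (w - z) \<le> \<rho>"
        have wy: "norm (w - y) \<le> \<rho> + dist y z"
          using norm_triangle_ineq[of "w - z" "z - y"] w by (simp add: dist_norm norm_minus_commute)
        have c0: "0 \<le> sqrt (V y) + 3 * \<delta>" using nonneg[of y] \<delta> by simp
        show "v \<epsilon> w \<le> ball_sup \<epsilon> \<rho> y + (sqrt (V y) + 3 * \<delta>) * dist y z"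
        proof (cases "norm (w - y) \<le> \<rho>")
          case True
          then have "v \<epsilon> w \<le> ball_sup \<epsilon> \<rho> y" by (rule ball_sup_upper[OF \<epsilon>(1)])
          moreover have "0 \<le> (sqrt (V y) + 3 * \<delta>) * dist y z" using c0 by simp
          ultimately show ?thesis by simp
        next
          case False
          let ?M = "(sqrt (V y) + \<delta>)\<^sup>2"
          have "v \<epsilon> w \<le> ball_sup \<epsilon> \<rho> y + (sqrt ?M + 2 * \<delta>) * (norm (w - y) - \<rho>)"
          proof (rule visc_subsolution_ball_growth[OF solution_props(3,2,5)[OF \<epsilon>(1)] \<epsilon>(1) e[unfolded n_def]])
            fix u assume "norm (u - y) < r"
            then have "sqrt (V u) \<le> sqrt (V y) + \<delta>" using r(2)[of u y] by (simp add: dist_norm)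
            then have "(sqrt (V u))\<^sup>2 \<le> ?M" using nonneg[of u] by (intro power_mono) auto
            then show "V u \<le> ?M" using nonneg[of u] by simp
          next
            fix u assume "norm (u - y) \<le> \<rho>"
            then show "v \<epsilon> u \<le> ball_sup \<epsilon> \<rho> y" by (rule ball_sup_upper[OF \<epsilon>(1)])
          qed (use \<rho> \<delta> r False wy yz in auto)
          also have "sqrt ?M = sqrt (V y) + \<delta>" using nonneg[of y] \<delta> by simp
          also have "(sqrt (V y) + \<delta> + 2 * \<delta>) * (norm (w - y) - \<rho>) \<le> (sqrt (V y) + \<delta> + 2 * \<delta>) * dist y z"
            using wy c0 by (intro mult_left_mono) auto
          finally show ?thesis by (simp add: algebra_simps)
        qed
      qed (use \<rho> in simp)
      have "dist z y < r" using yz r by (simp add: dist_commute)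
      then have "sqrt (V z) \<le> sqrt (V y) + \<delta>" using r(2)[of z y] by simp
      then have "(sqrt (V z) + 3 * \<delta>) * dist y z \<le> (sqrt (V y) + 4 * \<delta>) * dist y z" by (intro mult_right_mono) auto
      moreover have "(sqrt (V y) + 3 * \<delta>) * dist y z \<le> (sqrt (V y) + 4 * \<delta>) * dist y z" using \<delta> by (intro mult_right_mono) auto
      ultimately show ?thesis using one[OF yz] one[of z y] yz by (simp add: dist_commute abs_le_iff)
    qed
    ultimately show "\<exists>\<epsilon>0>0. \<forall>\<epsilon>. 0 < \<epsilon> \<longrightarrow> \<epsilon> < \<epsilon>0 \<longrightarrow>
      (\<forall>y z. dist y z \<le> r / 4 \<longrightarrow> \<bar>ball_sup \<epsilon> \<rho> z - ball_sup \<epsilon> \<rho> y\<bar> \<le> (sqrt (V y) + 4 * \<delta>) * dist y z)" by blast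
  qed (use r in simp)
qed

lemma upper_bound_near_zero:
  assumes p: "V p = 0" "positive_definite (hess V p)" and \<eta>: "\<eta> > 0"
  obtains \<rho> \<epsilon>0 where "\<rho> > 0" "\<epsilon>0 > 0"
    "\<And>\<epsilon> h. 0 < \<epsilon> \<Longrightarrow> \<epsilon> < \<epsilon>0 \<Longrightarrow> norm h \<le> \<rho> \<Longrightarrow> v \<epsilon> (p + h) \<le> kappa V p + \<eta>"
proof -
  define A where "A = pd_sqrt ((1/2) *\<^sub>R hess V p)"
  have A: "positive_definite A" unfolding A_def by (intro pd_sqrt_works positive_definite_half p)
  define k where "k = kappa V p"
  have k: "k = trace A" "k > 0" unfolding k_def kappa_def A_def[symmetric] using positive_definite_trace_pos[OF A] by auto
  define \<delta> where "\<delta> = (\<eta> / 2) / (k + 1)"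
  have "k + 1 \<noteq> 0" using k(2) by linarith
  then have "\<delta> * (k + 1) = \<eta> / 2" unfolding \<delta>_def by (rule nonzero_eq_divide_eq[THEN iffD1]) (rule refl)
  then have \<delta>: "\<delta> > 0" "\<delta> * k + \<delta> = \<eta> / 2" unfolding \<delta>_def using \<eta> k(2) by (simp_all add: distrib_left)
  have "2 * \<delta> > 0" using \<delta> by simp
  then obtain r where r: "r > 0" "\<And>h. norm h < r \<Longrightarrow> V (p + h) \<le> (1 + 2 * \<delta>) * (norm (A *v h))\<^sup>2"
    using potential_near_zero[OF C2V nonneg p, of "2 * \<delta>"] unfolding A_def by metis
  have Vle: "V (p + h) \<le> (1 + \<delta>)\<^sup>2 * (norm (A *v h))\<^sup>2" if "norm h < r" for h
  proof -
    have "(1 + 2 * \<delta>) * (norm (A *v h))\<^sup>2 \<le> (1 + \<delta>)\<^sup>2 * (norm (A *v h))\<^sup>2"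
      by (intro mult_right_mono) (auto simp: power2_sum)
    then show ?thesis using r(2)[OF that] by simp
  qed
  define K where "K = \<delta> * r\<^sup>2 / (4 * real CARD('n))"
  have K: "K > 0" unfolding K_def using \<delta> r by simp
  let ?g = "\<lambda>h. (1/2) * (1 + \<delta>) * (h \<bullet> (A *v h)) + K * (ln (r\<^sup>2) - ln (r\<^sup>2 - (norm h)\<^sup>2))"
  have "(?g \<longlongrightarrow> (1/2) * (1 + \<delta>) * (0 \<bullet> (A *v 0)) + K * (ln (r\<^sup>2) - ln (r\<^sup>2 - (norm (0 :: real ^ 'n))\<^sup>2))) (nhds 0)"
    using r by (intro tendsto_intros filterlim_ident bounded_linear.tendsto[OF matrix_vector_mul_bounded_linear]) auto
  then have "(?g \<longlongrightarrow> 0) (nhds 0)" by simp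
  then have "\<forall>\<^sub>F h in nhds 0. ?g h < \<eta> / 2" using \<eta> by (intro order_tendstoD) auto
  then obtain d where d: "d > 0" "\<And>h. dist h 0 < d \<Longrightarrow> ?g h < \<eta> / 2" unfolding eventually_nhds_metric by blast
  define \<epsilon>0 where "\<epsilon>0 = min (K / 8) (K / (2 * real CARD('n)))"
  show ?thesis
  proof (rule that[of "min (d / 2) (r / 2)" \<epsilon>0])
    fix \<epsilon> h assume \<epsilon>: "0 < \<epsilon>" "\<epsilon> < \<epsilon>0" and h: "norm (h :: real ^ 'n) \<le> min (d / 2) (r / 2)"
    have "v \<epsilon> (p + h) \<le> (1 + \<delta>) * trace A + \<delta> + (1/2) * (1 + \<delta>) * (h \<bullet> (A *v h)) + K * (ln (r\<^sup>2) - ln (r\<^sup>2 - (norm h)\<^sup>2))"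
      unfolding K_def
      by (rule visc_subsolution_near_zero[OF solution_props(3,2)[OF \<epsilon>(1)] A \<delta>(1) r(1) Vle \<epsilon>(1)])
        (use \<epsilon> h r in \<open>auto simp: \<epsilon>0_def K_def\<close>)
    moreover have "?g h < \<eta> / 2" using d h by (intro d(2)) auto
    moreover have "(1 + \<delta>) * trace A + \<delta> = k + \<eta> / 2" using \<delta>(2) k by (simp add: algebra_simps)
    ultimately show "v \<epsilon> (p + h) \<le> kappa V p + \<eta>" unfolding k_def by linarith
  qed (use d r K in \<open>auto simp: \<epsilon>0_def\<close>)
qed

text \<open>The suprema over balls grow along a nearly optimal curve from \<open>p\<close> to \<open>x\<close> by little more than
  \<open>mane V p x\<close>. Once the curve is fixed, its duration \<open>T\<close> determines how small \<open>\<delta>\<close>, then \<open>\<rho>\<close>, then \<open>\<epsilon>\<close> have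
  to be. The estimate extends to a neighbourhood of \<open>x\<close>, and compactness makes it uniform.\<close>

theorem upper_bound:
  assumes p: "V p = 0" "positive_definite (hess V p)" and \<eta>: "\<eta> > 0"
  shows "\<exists>\<epsilon>0>0. \<forall>\<epsilon>. 0 < \<epsilon> \<longrightarrow> \<epsilon> < \<epsilon>0 \<longrightarrow> (\<forall>y. v \<epsilon> y \<le> kappa V p + mane V p y + \<eta>)"
proof -
  define \<eta>' where "\<eta>' = \<eta> / 5"
  have \<eta>': "\<eta>' > 0" unfolding \<eta>'_def using \<eta> by simp
  obtain \<rho>1 \<epsilon>1 where 1: "\<rho>1 > 0" "\<epsilon>1 > 0"
    "\<And>\<epsilon> h. 0 < \<epsilon> \<Longrightarrow> \<epsilon> < \<epsilon>1 \<Longrightarrow> norm h \<le> \<rho>1 \<Longrightarrow> v \<epsilon> (p + h) \<le> kappa V p + \<eta>'"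
    using upper_bound_near_zero[OF p \<eta>'] by metis
  have "\<exists>\<epsilon>0>0. \<forall>\<epsilon>. 0 < \<epsilon> \<longrightarrow> \<epsilon> < \<epsilon>0 \<longrightarrow> (\<forall>y. 0 < \<epsilon> \<longrightarrow> v \<epsilon> y \<le> kappa V p + mane V p y + \<eta>)"
  proof (rule torus_eventually_uniform)
    fix \<epsilon> y and k :: "real ^ 'n" assume "k \<in> int_lattice"
    then show "(0 < \<epsilon> \<longrightarrow> v \<epsilon> (y + k) \<le> kappa V p + mane V p (y + k) + \<eta>) = (0 < \<epsilon> \<longrightarrow> v \<epsilon> y \<le> kappa V p + mane V p y + \<eta>)"
      using torus_fun_shift[OF solution_props(1)] torus_fun_shift[OF mane_periodic] by auto
  next
    fix x
    obtain T \<gamma> A where T: "0 < T" "\<gamma> \<in> torus_curves T p x" "0 \<le> A" "action V T \<gamma> = ennreal A" "A < mane V p x + \<eta>'"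
      using mane_approx[OF \<eta>'] by blast
    have ac: "abs_cont_on 0 T \<gamma>" using T(2) unfolding torus_curves_def abs_continuous_curve_iff by auto
    define Q where "Q = (8 * sqrt B + 16) * T"
    have Q: "Q > 0" unfolding Q_def using T B_nonneg by (simp add: add_nonneg_pos)
    define \<delta> where "\<delta> = min 1 (\<eta>' / Q)"
    have \<delta>: "\<delta> > 0" "\<delta> \<le> 1" "\<delta> * Q \<le> \<eta>'" unfolding \<delta>_def using \<eta>' Q by (auto simp: min_def field_simps)
    have cost: "(2 * (4 * \<delta>) * sqrt B + (4 * \<delta>)\<^sup>2) * T \<le> \<eta>'"
    proof -
      have "\<delta>\<^sup>2 \<le> \<delta>" using \<delta> by (simp add: power2_eq_square mult_left_le)
      then have "(2 * (4 * \<delta>) * sqrt B + (4 * \<delta>)\<^sup>2) * T \<le> (2 * (4 * \<delta>) * sqrt B + 16 * \<delta>) * T"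
        using T by (intro mult_right_mono) (auto simp: power_mult_distrib)
      also have "\<dots> = \<delta> * Q" unfolding Q_def by (simp add: algebra_simps)
      finally show ?thesis using \<delta> by simp
    qed
    obtain r where r: "r > 0" "\<And>\<rho>. 0 < \<rho> \<Longrightarrow> \<rho> \<le> r \<Longrightarrow> \<exists>\<epsilon>0>0. \<forall>\<epsilon>. 0 < \<epsilon> \<longrightarrow> \<epsilon> < \<epsilon>0 \<longrightarrow>
       (\<forall>y z. dist y z \<le> r \<longrightarrow> \<bar>ball_sup \<epsilon> \<rho> z - ball_sup \<epsilon> \<rho> y\<bar> \<le> (sqrt (V y) + 4 * \<delta>) * dist y z)"
      by (rule ball_sup_slope[OF \<delta>(1)]) (rule that; assumption)
    define \<rho> where "\<rho> = min \<rho>1 r"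
    have \<rho>: "0 < \<rho>" "\<rho> \<le> r" "\<rho> \<le> \<rho>1" unfolding \<rho>_def using 1 r by auto
    obtain \<epsilon>2 where 2: "\<epsilon>2 > 0" "\<And>\<epsilon> y z. 0 < \<epsilon> \<Longrightarrow> \<epsilon> < \<epsilon>2 \<Longrightarrow> dist y z \<le> r \<Longrightarrow>
       \<bar>ball_sup \<epsilon> \<rho> z - ball_sup \<epsilon> \<rho> y\<bar> \<le> (sqrt (V y) + 4 * \<delta>) * dist y z"
      using r(2)[OF \<rho>(1,2)] by blast
    define L where "L = sqrt B + 4"
    have L: "L > 0" unfolding L_def using B_nonneg by (simp add: add_nonneg_pos)
    define d where "d = min r (\<eta>' / L)"
    have d: "d > 0" "d \<le> r" "L * d \<le> \<eta>'" unfolding d_def using r \<eta>' L by (auto simp: min_def field_simps)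
    show "\<exists>d>0. \<exists>\<epsilon>0>0. \<forall>\<epsilon>. 0 < \<epsilon> \<longrightarrow> \<epsilon> < \<epsilon>0 \<longrightarrow> (\<forall>y. dist x y < d \<longrightarrow> 0 < \<epsilon> \<longrightarrow> v \<epsilon> y \<le> kappa V p + mane V p y + \<eta>)"
    proof (rule exI[of _ d], rule conjI[OF d(1)], rule exI[of _ "min \<epsilon>1 \<epsilon>2"], intro conjI allI impI)
      fix \<epsilon> y assume \<epsilon>: "0 < \<epsilon>" "\<epsilon> < min \<epsilon>1 \<epsilon>2" and xy: "dist x y < d"
      let ?S = "ball_sup \<epsilon> \<rho>"
      have "ennreal (?S (\<gamma> T) - ?S (\<gamma> 0)) \<le> action V T \<gamma> + ennreal ((2 * (4 * \<delta>) * sqrt B + (4 * \<delta>)\<^sup>2) * T)"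
        using \<delta> \<epsilon> by (intro curve_growth_le_action[OF ac T(1) cont nonneg bounded r(1)] 2(2)) auto
      also have "\<dots> \<le> ennreal A + ennreal \<eta>'" unfolding T(4) using cost by (intro add_left_mono ennreal_leI)
      also have "\<dots> = ennreal (A + \<eta>')" using T \<eta>' by (simp add: ennreal_plus)
      finally have "?S (\<gamma> T) - ?S (\<gamma> 0) \<le> A + \<eta>'" using T \<eta>' by (subst (asm) ennreal_le_iff) auto
      moreover have "?S (\<gamma> T) = ?S x" "?S (\<gamma> 0) = ?S p"
        using T(2) torus_funD[OF ball_sup_periodic[OF \<epsilon>(1)]] unfolding torus_curves_def by auto
      moreover have "?S p \<le> kappa V p + \<eta>'"
      proof (rule ball_sup_least)
        fix z assume "norm (z - p) \<le> \<rho>"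
        then show "v \<epsilon> z \<le> kappa V p + \<eta>'" using 1(3)[OF \<epsilon>(1), of "z - p"] \<epsilon>(2) \<rho> by simp
      qed (use \<rho> in simp)
      moreover have "?S y \<le> ?S x + \<eta>'"
      proof -
        have "\<bar>?S y - ?S x\<bar> \<le> (sqrt (V x) + 4 * \<delta>) * dist x y" using \<epsilon> xy d by (intro 2(2)) auto
        also have "\<dots> \<le> L * d"
          unfolding L_def using bounded[of x] \<delta> xy nonneg[of x] by (intro mult_mono) (auto intro!: add_mono)
        finally show ?thesis using d by simp
      qed
      moreover have "v \<epsilon> y \<le> ?S y" by (rule ball_sup_upper) (use \<epsilon> \<rho> in auto)
      moreover have "mane V p x \<le> mane V p y + \<eta>'"
      proof -
        have "mane V p x \<le> mane V p y + sqrt B * dist y x" by (rule mane_diff_le_segment) (rule bounded)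
        also have "sqrt B * dist y x \<le> L * d"
          unfolding L_def using B_nonneg xy by (intro mult_mono) (auto simp: dist_commute)
        finally show ?thesis using d by simp
      qed
      ultimately show "v \<epsilon> y \<le> kappa V p + mane V p y + \<eta>" using T(5) unfolding \<eta>'_def by simp
    qed (use d 1 2 in auto)
  qed
  then show ?thesis by blast
qed

end

section \<open>A lower bound for the critical potential near a well\<close>

context torus_potential
begin

text \<open>The infimum \<open>\<psi>\<close> over lattice translates of the truncated form \<open>min q0 (s h \<bullet> A h / 2)\<close> has slope at most
  \<open>s |A h| \<le> sqrt V\<close> near the translates of \<open>p\<close> and is constant elsewhere. So \<open>\<psi>\<close> bounds the cost of
  leaving \<open>p\<close> and \<open>- \<psi>\<close> the cost of arriving there.\<close>

lemma well_calibration: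
  assumes C2V: "C2 V" and p: "V p = 0" "positive_definite (hess V p)" and s: "0 < s" "s < 1"
  defines "A \<equiv> pd_sqrt ((1/2) *\<^sub>R hess V p)"
  obtains R q0 where "R > 0" "q0 > 0"
    "\<And>h. norm h \<le> R \<Longrightarrow> s\<^sup>2 * (norm (A *v h))\<^sup>2 \<le> V (p + h)"
    "\<And>h. norm h \<le> R \<Longrightarrow> min q0 ((1/2) * s * (h \<bullet> (A *v h))) \<le> mane V p (p + h)"
    "\<And>x. V x = 0 \<Longrightarrow> x - p \<notin> int_lattice \<Longrightarrow> q0 \<le> mane V x p"
proof -
  have A: "positive_definite A" unfolding A_def by (intro pd_sqrt_works positive_definite_half p)
  have symA: "(A *v x) \<bullet> y = x \<bullet> (A *v y)" for x y
    using A symmetric_matrix_dot unfolding positive_definite_def by metis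
  obtain l where l: "l > 0" "\<And>y. l * (norm y)\<^sup>2 \<le> y \<bullet> (A *v y)" "\<And>y. l * norm y \<le> norm (A *v y)"
    using positive_definite_coercive[OF A] by metis
  obtain C where C: "C > 0" "\<And>y. norm (A *v y) \<le> C * norm y"
    using linear_bounded_pos[OF matrix_vector_mul_linear[of A]] by blast
  have c: "1 - s\<^sup>2 > 0" using power_strict_mono[OF s(2), of 2] s(1) by simp
  obtain r where r': "r > 0" "\<And>h. norm h < r \<Longrightarrow> (1 - (1 - s\<^sup>2)) * (norm (A *v h))\<^sup>2 \<le> V (p + h) \<and> V (p + h) \<le> (1 + (1 - s\<^sup>2)) * (norm (A *v h))\<^sup>2"
    by (rule potential_near_zero[OF C2V nonneg p c, folded A_def]) (rule that; assumption)
  then have r: "r > 0" "\<And>h. norm h < r \<Longrightarrow> s\<^sup>2 * (norm (A *v h))\<^sup>2 \<le> V (p + h)" by simp_all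
  define q where "q h = (1/2) * s * (h \<bullet> (A *v h))" for h
  define q0 where "q0 = (1/2) * s * (l * (r / 2)\<^sup>2)"
  have q0: "q0 > 0" unfolding q0_def using s l r by simp
  have q_far: "q0 \<le> q h" if "r / 2 \<le> norm h" for h
  proof -
    have "l * (r / 2)\<^sup>2 \<le> l * (norm h)\<^sup>2" using that l r by (intro mult_left_mono power_mono) auto
    then have "l * (r / 2)\<^sup>2 \<le> h \<bullet> (A *v h)" using l(2)[of h] by simp
    then show ?thesis unfolding q_def q0_def using s by (intro mult_left_mono) auto
  qed
  have q_nn: "0 \<le> q h" for h
  proof -
    have "0 \<le> l * (norm h)\<^sup>2" using l by simp
    then have "0 \<le> h \<bullet> (A *v h)" using l(2)[of h] by linarith
    then show ?thesis unfolding q_def using s by simp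
  qed
  have zero_far: "r \<le> norm w" if "V (p + w) = 0" "w \<noteq> 0" for w
  proof (rule ccontr)
    assume "\<not> r \<le> norm w"
    then have "s\<^sup>2 * (norm (A *v w))\<^sup>2 \<le> 0" using r(2)[of w] that by simp
    then have "norm (A *v w) = 0" using s by (simp add: mult_le_0_iff)
    moreover have "l * norm w > 0" using l that by simp
    ultimately show False using l(3)[of w] by simp
  qed
  define g where "g h = min q0 (q h)" for h
  have g_slope: "\<exists>\<rho>>0. \<forall>h k. norm (k - h) \<le> \<rho> \<longrightarrow> g k - g h \<le> (sqrt (V (p + h)) + e) * norm (k - h) \<and>
      g h - g k \<le> (sqrt (V (p + h)) + e) * norm (k - h)" if e: "e > 0" for e
  proof (intro exI[of _ "min (r / 2) (2 * e / (s * C))"] conjI allI impI)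
    show "0 < min (r / 2) (2 * e / (s * C))" using r e s C by simp
    fix h k :: "real ^ 'n" assume hk: "norm (k - h) \<le> min (r / 2) (2 * e / (s * C))"
    let ?d = "k - h"
    have "\<bar>g k - g h\<bar> \<le> (sqrt (V (p + h)) + e) * norm ?d"
    proof (cases "r \<le> norm h")
      case True
      then have "r / 2 \<le> norm k" using hk norm_triangle_ineq2[of h k] by (simp add: norm_minus_commute)
      then have "g k = g h" unfolding g_def using q_far[of k] q_far[of h] True r by simp
      then show ?thesis using nonneg e by simp
    next
      case False
      have "q k - q h = s * ((A *v h) \<bullet> ?d) + (1/2) * s * (?d \<bullet> (A *v ?d))"
        unfolding q_def using symA[of h k] by (simp add: matrix_vector_mult_diff_distrib inner_diff_left inner_diff_right inner_commute algebra_simps)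
      then have "\<bar>q k - q h\<bar> \<le> s * \<bar>(A *v h) \<bullet> ?d\<bar> + (1/2) * s * \<bar>?d \<bullet> (A *v ?d)\<bar>"
        using s abs_triangle_ineq[of "s * ((A *v h) \<bullet> ?d)" "(1/2) * s * (?d \<bullet> (A *v ?d))"] by (simp add: abs_mult)
      also have "\<dots> \<le> s * (norm (A *v h) * norm ?d) + (1/2) * s * (norm ?d * (C * norm ?d))"
      proof (intro add_mono mult_left_mono)
        show "\<bar>(A *v h) \<bullet> ?d\<bar> \<le> norm (A *v h) * norm ?d" by (rule Cauchy_Schwarz_ineq2)
        have "\<bar>?d \<bullet> (A *v ?d)\<bar> \<le> norm ?d * norm (A *v ?d)" by (rule Cauchy_Schwarz_ineq2)
        also have "\<dots> \<le> norm ?d * (C * norm ?d)" using C by (intro mult_left_mono) auto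
        finally show "\<bar>?d \<bullet> (A *v ?d)\<bar> \<le> norm ?d * (C * norm ?d)" .
      qed (use s in auto)
      also have "\<dots> = (s * norm (A *v h) + (1/2) * s * C * norm ?d) * norm ?d" by (simp add: algebra_simps)
      also have "\<dots> \<le> (sqrt (V (p + h)) + e) * norm ?d"
      proof (intro mult_right_mono add_mono)
        have "(s * norm (A *v h))\<^sup>2 \<le> V (p + h)" using r(2)[of h] False by (simp add: power_mult_distrib)
        then show "s * norm (A *v h) \<le> sqrt (V (p + h))" by (rule real_le_rsqrt)
        have "(1/2) * s * C * norm ?d \<le> (1/2) * s * C * (2 * e / (s * C))" using hk s C by (intro mult_left_mono) auto
        then show "(1/2) * s * C * norm ?d \<le> e" using s C by simp
      qed simp
      finally have "\<bar>q k - q h\<bar> \<le> (sqrt (V (p + h)) + e) * norm ?d" .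
      moreover have "\<bar>g k - g h\<bar> \<le> \<bar>q k - q h\<bar>" unfolding g_def by (auto simp: min_def)
      ultimately show ?thesis by simp
    qed
    then show "g k - g h \<le> (sqrt (V (p + h)) + e) * norm (k - h)" "g h - g k \<le> (sqrt (V (p + h)) + e) * norm (k - h)"
      by (auto simp: abs_le_iff)
  qed
  have g_nn: "0 \<le> g h" for h unfolding g_def using q_nn q0 by (simp add: less_imp_le)
  define \<psi> where "\<psi> z = (INF k\<in>int_lattice. g (z - p - k))" for z
  have ne: "int_lattice \<noteq> ({} :: (real ^ 'n) set)" using int_lattice_0 by blast
  have bdd: "bdd_below ((\<lambda>k. g (z - p - k)) ` int_lattice)" for z using g_nn by (auto simp: bdd_below_def)
  have \<psi>_le: "\<psi> z \<le> g (z - p - k)" if "k \<in> int_lattice" for z k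
    unfolding \<psi>_def by (rule cINF_lower[OF bdd that])
  have \<psi>_ge: "c \<le> \<psi> z" if "\<And>k. k \<in> int_lattice \<Longrightarrow> c \<le> g (z - p - k)" for z c
    unfolding \<psi>_def by (rule cINF_greatest[OF ne that])
  have per: "torus_fun \<psi>"
    unfolding torus_fun_def
  proof (intro allI ballI antisym)
    fix z k :: "real ^ 'n" assume k: "k \<in> int_lattice"
    show "\<psi> (z + k) \<le> \<psi> z"
    proof (rule \<psi>_ge)
      fix j :: "real ^ 'n" assume "j \<in> int_lattice"
      then have "\<psi> (z + k) \<le> g (z + k - p - (j + k))" using k by (intro \<psi>_le int_lattice_add)
      then show "\<psi> (z + k) \<le> g (z - p - j)" by (simp add: algebra_simps)
    qed
    show "\<psi> z \<le> \<psi> (z + k)"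
    proof (rule \<psi>_ge)
      fix j :: "real ^ 'n" assume "j \<in> int_lattice"
      then have "\<psi> z \<le> g (z - p - (j - k))" using k by (intro \<psi>_le int_lattice_diff)
      then show "\<psi> z \<le> g (z + k - p - j)" by (simp add: algebra_simps)
    qed
  qed
  have slope: "\<exists>\<rho>>0. \<forall>y z. dist y z \<le> \<rho> \<longrightarrow> \<bar>\<psi> z - \<psi> y\<bar> \<le> (sqrt (V y) + e) * dist y z" if e: "e > 0" for e
  proof -
    obtain \<rho> where \<rho>: "\<rho> > 0" "\<And>h k. norm (k - h) \<le> \<rho> \<Longrightarrow> g k - g h \<le> (sqrt (V (p + h)) + e) * norm (k - h) \<and>
      g h - g k \<le> (sqrt (V (p + h)) + e) * norm (k - h)" using g_slope[OF e] by blast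
    show ?thesis
    proof (intro exI[of _ \<rho>] conjI allI impI)
      fix y z :: "real ^ 'n" assume yz: "dist y z \<le> \<rho>"
      let ?c = "(sqrt (V y) + e) * dist y z"
      have Vy: "V (p + (y - p - k)) = V y" if "k \<in> int_lattice" for k
        using torus_funD[OF periodic, of "y - k" y] int_lattice_minus[OF that] by (simp add: algebra_simps)
      have dk: "norm ((z - p - k) - (y - p - k)) = dist y z" for k by (simp add: dist_norm norm_minus_commute)
      have gk: "g (z - p - k) - g (y - p - k) \<le> ?c" "g (y - p - k) - g (z - p - k) \<le> ?c" if k: "k \<in> int_lattice" for k
        using \<rho>(2)[of "z - p - k" "y - p - k"] yz unfolding Vy[OF k] dk by auto
      have "\<psi> z - ?c \<le> \<psi> y"
      proof (rule \<psi>_ge)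
        fix k :: "real ^ 'n" assume "k \<in> int_lattice"
        then show "\<psi> z - ?c \<le> g (y - p - k)" using gk(1)[of k] \<psi>_le[of k z] by linarith
      qed
      moreover have "\<psi> y - ?c \<le> \<psi> z"
      proof (rule \<psi>_ge)
        fix k :: "real ^ 'n" assume "k \<in> int_lattice"
        then show "\<psi> y - ?c \<le> g (z - p - k)" using gk(2)[of k] \<psi>_le[of k y] by linarith
      qed
      ultimately show "\<bar>\<psi> z - \<psi> y\<bar> \<le> ?c" by (simp add: abs_le_iff)
    qed fact
  qed
  have \<psi>p: "\<psi> p = 0"
  proof (rule antisym)
    show "\<psi> p \<le> 0" using \<psi>_le[OF int_lattice_0, of p] q0 by (simp add: g_def q_def)
    show "0 \<le> \<psi> p" by (rule \<psi>_ge) (rule g_nn)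
  qed
  show ?thesis
  proof (rule that[of "r / 2" q0])
    fix h :: "real ^ 'n" assume h: "norm h \<le> r / 2"
    then have "norm h < r" using r by linarith
    then show "s\<^sup>2 * (norm (A *v h))\<^sup>2 \<le> V (p + h)" by (rule r(2))
    have "min q0 (q h) \<le> \<psi> (p + h)"
    proof (rule \<psi>_ge)
      fix k :: "real ^ 'n" assume k: "k \<in> int_lattice"
      show "min q0 (q h) \<le> g (p + h - p - k)"
      proof (cases "k = 0")
        case True then show ?thesis by (simp add: g_def)
      next
        case False
        have "V (p + k) = 0" using torus_fun_shift[OF periodic k] p by simp
        then have "r \<le> norm k" using False by (rule zero_far)
        then have "r / 2 \<le> norm (h - k)" using h norm_triangle_ineq2[of k h] by (simp add: norm_minus_commute)
        then show ?thesis using q_far[of "h - k"] by (simp add: g_def)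
      qed
    qed
    also have "\<psi> (p + h) \<le> mane V p (p + h)"
      using calibration_le_mane[OF per slope, of "p + h" p] \<psi>p by simp
    finally show "min q0 ((1/2) * s * (h \<bullet> (A *v h))) \<le> mane V p (p + h)" unfolding q_def .
  next
    fix x assume x: "V x = 0" "x - p \<notin> int_lattice"
    have "q0 \<le> \<psi> x"
    proof (rule \<psi>_ge)
      fix k :: "real ^ 'n" assume k: "k \<in> int_lattice"
      have "V (p + (x - p - k)) = 0"
        using torus_funD[OF periodic, of "x - k" x] int_lattice_minus[OF k] x by (simp add: algebra_simps)
      moreover have "x - p - k \<noteq> 0" using x k by auto
      ultimately have "r \<le> norm (x - p - k)" by (rule zero_far)
      then show "q0 \<le> g (x - p - k)" using q_far[of "x - p - k"] r by (simp add: g_def)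
    qed
    moreover have "(- \<psi> p) - (- \<psi> x) \<le> mane V x p"
    proof (rule calibration_le_mane)
      show "torus_fun (\<lambda>z. - \<psi> z)" using per unfolding torus_fun_def by simp
      show "\<exists>\<rho>>0. \<forall>y z. dist y z \<le> \<rho> \<longrightarrow> \<bar>- \<psi> z - - \<psi> y\<bar> \<le> (sqrt (V y) + e) * dist y z" if "e > 0" for e
        using slope[OF that] by (simp add: abs_minus_commute)
    qed
    ultimately show "q0 \<le> mane V x p" using \<psi>p by simp
  qed (use r q0 in auto)
qed

end

section \<open>The lower bound and convergence\<close>

locale potential_wells = vanishing_viscosity V B v
  for V :: "real ^ 'n \<Rightarrow> real" and B and v :: "real \<Rightarrow> real ^ 'n \<Rightarrow> real" +
  fixes P :: "(real ^ 'n) set"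
  assumes finP: "finite P" and neP: "P \<noteq> {}"
    and zeros: "\<And>z. V z = 0 \<longleftrightarrow> (\<exists>p\<in>P. z - p \<in> int_lattice)"
    and distinct: "\<And>p q. p \<in> P \<Longrightarrow> q \<in> P \<Longrightarrow> p \<noteq> q \<Longrightarrow> p - q \<notin> int_lattice"
    and hess_pd: "\<And>p. p \<in> P \<Longrightarrow> positive_definite (hess V p)"
begin

lemma V_well: "p \<in> P \<Longrightarrow> V p = 0"
  using zeros int_lattice_0 by fastforce

definition vstar :: "real ^ 'n \<Rightarrow> real" where
  "vstar z = Min ((\<lambda>p. kappa V p + mane V p z) ` P)"

lemma vstar_le: "p \<in> P \<Longrightarrow> vstar z \<le> kappa V p + mane V p z"
  unfolding vstar_def using finP by (intro Min_le) auto

lemma vstar_attained: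
  obtains p where "p \<in> P" "vstar z = kappa V p + mane V p z"
proof -
  have "vstar z \<in> (\<lambda>p. kappa V p + mane V p z) ` P"
    unfolding vstar_def using finP neP by (intro Min_in) auto
  then show ?thesis using that by blast
qed

text \<open>Thus \<open>vstar\<close> is itself calibrated, which makes it comparable at different wells.\<close>

lemma vstar_triangle: "vstar z \<le> vstar y + mane V y z"
proof -
  obtain p where p: "p \<in> P" "vstar y = kappa V p + mane V p y" by (rule vstar_attained)
  then show ?thesis using vstar_le[OF p(1), of z] mane_triangle[of p z y] by linarith
qed

lemma kappa_pos: "p \<in> P \<Longrightarrow> 0 < kappa V p"
  unfolding kappa_def by (intro positive_definite_trace_pos pd_sqrt_works positive_definite_half hess_pd)

lemma mane_self: "mane V p p \<le> 0"
  using mane_le_segment[of p p B] bounded by simp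

lemma vstar_well_le: "p \<in> P \<Longrightarrow> vstar p \<le> kappa V p"
  using vstar_le[of p p] mane_self[of p] by linarith

lemma mane_lipschitz: "\<bar>mane V p x - mane V p y\<bar> \<le> sqrt B * dist x y"
  using mane_diff_le_segment[of y x B p] mane_diff_le_segment[of x y B p] bounded
  by (simp add: dist_commute abs_le_iff)

end

locale lower_barrier = potential_wells V B v P
  for V :: "real ^ 'n \<Rightarrow> real" and B v P +
  fixes s :: real
  assumes s: "0 < s" "s < 1"
begin

text \<open>The reduction by \<open>s\<^sup>3\<close> makes \<open>level p\<close> strictly smaller than \<open>level q + mane V q p\<close> for every other well \<open>q\<close>.\<close>

definition level :: "real ^ 'n \<Rightarrow> real" where "level p = s^3 * vstar p"

text \<open>The factor \<open>s\<close> reduces the slope strictly below \<open>sqrt V\<close> away from the wells.\<close>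

definition u :: "real ^ 'n \<Rightarrow> real" where
  "u y = s * Min ((\<lambda>p. level p + mane V p y) ` P)"

lemma u_le: "p \<in> P \<Longrightarrow> u y \<le> s * (level p + mane V p y)"
  unfolding u_def using finP s by (intro mult_left_mono Min_le) auto

lemma u_ge:
  assumes "\<And>p. p \<in> P \<Longrightarrow> c \<le> level p + mane V p y"
  shows "s * c \<le> u y"
  unfolding u_def using finP neP s assms by (intro mult_left_mono) auto

lemma u_attained:
  obtains p where "p \<in> P" "u y = s * (level p + mane V p y)"
proof -
  have "Min ((\<lambda>p. level p + mane V p y) ` P) \<in> (\<lambda>p. level p + mane V p y) ` P"
    using finP neP by (intro Min_in) auto
  then show ?thesis using that unfolding u_def by auto
qed

text \<open>Lowering the levels by the factor \<open>s\<^sup>3\<close> costs no more than this factor overall, because \<open>vstar\<close>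
  satisfies the triangle inequality.\<close>

lemma u_ge_vstar: "s^4 * vstar y \<le> u y"
proof -
  have "s * (s^3 * vstar y) \<le> u y"
  proof (rule u_ge)
    fix p assume p: "p \<in> P"
    have "s^3 * vstar y \<le> s^3 * (vstar p + mane V p y)" using vstar_triangle s by (intro mult_left_mono) auto
    also have "\<dots> \<le> level p + 1 * mane V p y"
      unfolding level_def distrib_left using s mane_nonneg by (intro add_left_mono mult_right_mono power_le_one) auto
    finally show "s^3 * vstar y \<le> level p + mane V p y" by simp
  qed
  then show ?thesis by (simp add: power_Suc[symmetric] mult.assoc[symmetric] eval_nat_numeral)
qed

lemma u_periodic: "torus_fun u"
  using mane_periodic unfolding torus_fun_def u_def by simp

lemma u_diff_le_segment:
  assumes "\<And>z. z \<in> closed_segment y x \<Longrightarrow> V z \<le> M"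
  shows "u x \<le> u y + s * sqrt M * dist y x"
proof -
  obtain p where p: "p \<in> P" "u y = s * (level p + mane V p y)" by (rule u_attained)
  have "u x \<le> s * (level p + mane V p x)" by (rule u_le[OF p(1)])
  also have "\<dots> \<le> s * (level p + (mane V p y + sqrt M * dist y x))"
    using mane_diff_le_segment[OF assms] s by (intro mult_left_mono add_left_mono) auto
  finally show ?thesis using p(2) by (simp add: algebra_simps)
qed

lemma u_lipschitz: "\<bar>u x - u y\<bar> \<le> sqrt B * dist x y"
proof -
  have "s * sqrt B * dist x y \<le> 1 * sqrt B * dist x y"
    using s B_nonneg by (intro mult_right_mono) auto
  then show ?thesis
    using u_diff_le_segment[of y x B] u_diff_le_segment[of x y B] bounded
    by (simp add: dist_commute abs_le_iff)
qed

lemma u_continuous: "continuous_on UNIV u"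
  by (rule lipschitz_on_continuous_on[OF lipschitz_onI[of UNIV u "sqrt B"]])
    (use u_lipschitz B_nonneg in \<open>auto simp: dist_real_def\<close>)

lemma u_bounded: obtains C where "C > 0" "\<And>y. u y \<le> C"
proof (rule torus_fun_bounded_above[OF u_periodic u_continuous])
qed (rule that; assumption)

text \<open>The barrier is \<open>\<phi> = b + s\<^sup>3 h \<bullet> A h / 2\<close> with \<open>b\<close> slightly above \<open>s * level p \<ge> u p\<close>. It is a strict
  subsolution because \<open>b \<le> s\<^sup>3 \<kappa>\<close>. Every well other than \<open>p\<close> contributes more to \<open>u\<close> than \<open>p\<close> does near \<open>p\<close>,
  by a margin proportional to \<open>1 - s\<^sup>3\<close>; hence \<open>u\<close> grows like \<open>s\<^sup>2 h \<bullet> A h / 2\<close> there and overtakes \<open>\<phi>\<close> on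
  the sphere of radius \<open>R2\<close>. If \<open>v - \<phi>\<close> were less than \<open>m0\<close> somewhere in the ball, its minimum would lie
  in the interior, against the supersolution property.\<close>

lemma well_barrier:
  assumes p: "p \<in> P"
  obtains r0 \<epsilon>0 where "r0 > 0" "\<epsilon>0 > 0"
    "\<And>\<epsilon> m0 y z. 0 < \<epsilon> \<Longrightarrow> \<epsilon> < \<epsilon>0 \<Longrightarrow> m0 \<le> 0 \<Longrightarrow> (\<forall>z. m0 \<le> v \<epsilon> z - u z) \<Longrightarrow>
       norm (y - p) < r0 \<Longrightarrow> norm (z - p) < r0 \<Longrightarrow> u y + m0 < v \<epsilon> z"
proof -
  define A where "A = pd_sqrt ((1/2) *\<^sub>R hess V p)"
  define k where "k = kappa V p"
  have Vp: "V p = 0" by (rule V_well[OF p])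
  have A: "positive_definite A" unfolding A_def by (intro pd_sqrt_works positive_definite_half hess_pd p)
  have k: "k > 0" "trace A = k" using kappa_pos[OF p] unfolding k_def kappa_def A_def by auto
  obtain l where l: "l > 0" "\<And>y. l * (norm y)\<^sup>2 \<le> y \<bullet> (A *v y)" "\<And>y. l * norm y \<le> norm (A *v y)"
    using positive_definite_coercive[OF A] by metis
  obtain C where C: "C > 0" "\<And>y. norm (A *v y) \<le> C * norm y"
    using linear_bounded_pos[OF matrix_vector_mul_linear[of A]] by blast
  have qC: "h \<bullet> (A *v h) \<le> C * (norm h)\<^sup>2" for h
  proof -
    have "h \<bullet> (A *v h) \<le> norm h * norm (A *v h)" by (rule norm_cauchy_schwarz)
    also have "\<dots> \<le> norm h * (C * norm h)" using C by (intro mult_left_mono) auto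
    finally show ?thesis by (simp add: power2_eq_square algebra_simps)
  qed
  obtain R q0 where R: "R > 0" "q0 > 0"
    "\<And>h. norm h \<le> R \<Longrightarrow> s\<^sup>2 * (norm (A *v h))\<^sup>2 \<le> V (p + h)"
    "\<And>h. norm h \<le> R \<Longrightarrow> min q0 ((1/2) * s * (h \<bullet> (A *v h))) \<le> mane V p (p + h)"
    "\<And>x. V x = 0 \<Longrightarrow> x - p \<notin> int_lattice \<Longrightarrow> q0 \<le> mane V x p"
    by (rule well_calibration[OF C2V Vp hess_pd[OF p] s, folded A_def]) (rule that; assumption)
  have s3: "0 < s^3" "s^3 < 1" using s by (auto simp: power_less_one_iff)
  define g where "g = (1 - s^3) * q0 / 2"
  have "(1 - s^3) * q0 \<le> 1 * q0" using s3 R(2) by (intro mult_right_mono) auto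
  moreover have "(1 - s^3) * q0 > 0" using s3 R(2) by simp
  ultimately have g: "g > 0" "g \<le> q0" unfolding g_def using R(2) by linarith+
  define S where "S = sqrt B + 1"
  have S: "S > 0" "sqrt B < S" unfolding S_def using B_nonneg by (auto simp: add_nonneg_pos)
  \<comment> \<open>The bound by \<open>g / S\<close> controls the other wells, the bound by \<open>g / (s * C)\<close> undoes the truncation at \<open>q0\<close>.\<close>
  define R2 where "R2 = min (min R 1) (min (g / S) (g / (s * C)))"
  have R2: "R2 > 0" "R2 \<le> R" "R2 \<le> 1" "R2 \<le> g / S" "R2 \<le> g / (s * C)"
    unfolding R2_def using R g S s C by auto
  have w_low: "level p + (1/2) * s * (h \<bullet> (A *v h)) \<le> level q + mane V q (p + h)"
    if q: "q \<in> P" and h: "norm h \<le> R2" for q h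
  proof -
    have qg: "(1/2) * s * (h \<bullet> (A *v h)) \<le> g"
    proof -
      have "(norm h)\<^sup>2 \<le> R2" using h R2(1,3) power_mono[OF h norm_ge_zero, of 2]
        by (simp add: power2_eq_square) (meson mult_left_le order_trans less_imp_le)
      then have "C * (norm h)\<^sup>2 \<le> C * R2" using C by simp
      then have "h \<bullet> (A *v h) \<le> C * R2" using qC[of h] by simp
      then have "s * (h \<bullet> (A *v h)) \<le> s * (C * R2)" using s by simp
      also have "\<dots> \<le> s * (C * (g / (s * C)))" using R2(5) s C by (intro mult_left_mono) auto
      also have "\<dots> = g" using s C by simp
      finally have "s * (h \<bullet> (A *v h)) \<le> g" .
      moreover have "0 \<le> g" using g by simp
      ultimately show ?thesis by linarith
    qed
    show ?thesis
    proof (cases "q = p")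
      case True
      have "min q0 ((1/2) * s * (h \<bullet> (A *v h))) \<le> mane V p (p + h)" using R(4)[of h] h R2 by simp
      then show ?thesis using True qg g by (simp add: min_def split: if_splits)
    next
      case False
      have qp: "q0 \<le> mane V q p" using R(5)[OF V_well[OF q] distinct[OF q p False]] .
      have "level p \<le> s^3 * (vstar q + mane V q p)" unfolding level_def using vstar_triangle s by (intro mult_left_mono) auto
      then have "level p \<le> level q + mane V q p - (1 - s^3) * mane V q p" unfolding level_def by (simp add: algebra_simps)
      moreover have "(1 - s^3) * q0 \<le> (1 - s^3) * mane V q p" using qp s3 by (intro mult_left_mono) auto
      moreover have "mane V q p \<le> mane V q (p + h) + sqrt B * norm h"
        using mane_lipschitz[of q p "p + h"] by (simp add: dist_norm abs_le_iff)
      moreover have "sqrt B * norm h \<le> S * (g / S)"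
        using S h R2 B_nonneg by (intro mult_mono) auto
      ultimately show ?thesis using qg S unfolding g_def by simp
    qed
  qed
  \<comment> \<open>Small against the advantage of \<open>u\<close> over the barrier at radius \<open>R2\<close>, and such that \<open>b \<le> s^3 * k\<close>.\<close>
  define \<beta> where "\<beta> = min ((s^2 - s^3) * l * R2\<^sup>2 / 4) ((s^3 - s^4) * k)"
  have s23: "s^3 < s^2" "s^4 < s^3" "s^6 < s^2" using s by (auto intro!: power_strict_decreasing)
  have \<beta>: "\<beta> > 0" "\<beta> < (s^2 - s^3) * l * R2\<^sup>2 / 2" "\<beta> \<le> (s^3 - s^4) * k"
  proof -
    have "(s^2 - s^3) * l * R2\<^sup>2 > 0" using s23 l R2 by simp
    moreover have "(s^3 - s^4) * k > 0" using s23 k by simp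
    ultimately show "\<beta> > 0" "\<beta> < (s^2 - s^3) * l * R2\<^sup>2 / 2" "\<beta> \<le> (s^3 - s^4) * k" unfolding \<beta>_def by auto
  qed
  define b where "b = s * level p + \<beta>"
  have bk: "b \<le> s^3 * k"
  proof -
    have "s * level p = s^4 * vstar p" unfolding level_def by (simp add: eval_nat_numeral mult.assoc)
    also have "\<dots> \<le> s^4 * k" unfolding k_def using vstar_well_le[OF p] s by (intro mult_left_mono) auto
    finally show ?thesis unfolding b_def using \<beta>(3) by (simp add: algebra_simps)
  qed
  define r0 where "r0 = min R2 (\<beta> / S)"
  have r0: "r0 > 0" "r0 \<le> R2" "r0 \<le> \<beta> / S" unfolding r0_def using R2 \<beta> S by auto
  have u_near: "u y < b" if "norm (y - p) < r0" for y
  proof -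
    have "u p \<le> s * (level p + mane V p p)" by (rule u_le[OF p])
    also have "\<dots> \<le> s * level p" using mane_self[of p] s by (simp add: mult_le_cancel_left)
    finally have "u p \<le> s * level p" .
    moreover have "u y \<le> u p + sqrt B * norm (y - p)"
      using u_lipschitz[of y p] by (simp add: dist_norm abs_le_iff)
    moreover have "sqrt B * norm (y - p) < \<beta>"
    proof -
      have "sqrt B * norm (y - p) \<le> sqrt B * (\<beta> / S)" using that r0 B_nonneg by (intro mult_left_mono) auto
      also have "\<dots> < S * (\<beta> / S)" using S \<beta> by (intro mult_strict_right_mono) auto
      finally show ?thesis using S by simp
    qed
    ultimately show ?thesis unfolding b_def by linarith
  qed
  define \<phi> where "\<phi> y = b + (1/2) * ((y - p) \<bullet> ((s^3 *\<^sub>R A) *v (y - p)))" for y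
  have \<phi>h: "\<phi> (p + h) = b + (1/2) * s^3 * (h \<bullet> (A *v h))" for h
    unfolding \<phi>_def by (simp add: scaleR_matrix_vector_assoc[symmetric])
  have Aq: "0 \<le> h \<bullet> (A *v h)" for h
  proof -
    have "0 \<le> l * (norm h)\<^sup>2" using l by simp
    then show ?thesis using l(2)[of h] by linarith
  qed
  have \<phi>_edge: "\<phi> (p + h) < u (p + h)" if h: "norm h = R2" for h
  proof -
    have "s * (level p + (1/2) * s * (h \<bullet> (A *v h))) \<le> u (p + h)"
      using w_low h by (intro u_ge) auto
    moreover have "(s^2 - s^3) * (l * R2\<^sup>2) \<le> (s^2 - s^3) * (h \<bullet> (A *v h))"
      using l(2)[of h] h s23 by (intro mult_left_mono) auto
    then have "b + (1/2) * s^3 * (h \<bullet> (A *v h)) < s * (level p + (1/2) * s * (h \<bullet> (A *v h)))"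
      using \<beta>(2) unfolding b_def by (simp add: algebra_simps power2_eq_square)
    ultimately show ?thesis unfolding \<phi>h by linarith
  qed
  have AT: "transpose (s^3 *\<^sub>R A) = s^3 *\<^sub>R A" using A unfolding positive_definite_def by (simp add: transpose_scalar)
  define \<epsilon>0 where "\<epsilon>0 = (s^2 - s^6) * l"
  have \<epsilon>0: "\<epsilon>0 > 0" unfolding \<epsilon>0_def using s23 l by simp
  show ?thesis
  proof (rule that[OF r0(1) \<epsilon>0], rule ccontr)
    fix \<epsilon> m0 y z assume \<epsilon>: "0 < \<epsilon>" "\<epsilon> < \<epsilon>0" and m0: "m0 \<le> 0" and ge': "\<forall>z. m0 \<le> v \<epsilon> z - u z"
      and y: "norm (y - p) < r0" and z: "norm (z - p) < r0" and "\<not> u y + m0 < v \<epsilon> z"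
    then have vz: "v \<epsilon> z < b + m0" using u_near[OF y] by simp
    have ge: "m0 \<le> v \<epsilon> z - u z" for z using ge' by blast
    have "b \<le> \<phi> z" using \<phi>h[of "z - p"] Aq[of "z - p"] s by simp
    have cphi: "continuous_on (cball p R2) (\<lambda>y. v \<epsilon> y - \<phi> y)"
      unfolding \<phi>_def
      by (intro continuous_intros continuous_on_subset[OF solution_props(2)[OF \<epsilon>(1)]]
          bounded_linear.continuous_on[OF matrix_vector_mul_bounded_linear]) auto
    have "z \<in> cball p R2" using z r0 by (simp add: dist_norm norm_minus_commute)
    then obtain x where x: "x \<in> cball p R2" "\<And>y. y \<in> cball p R2 \<Longrightarrow> v \<epsilon> x - \<phi> x \<le> v \<epsilon> y - \<phi> y"
      using continuous_attains_inf[OF _ _ cphi] by (metis compact_cball empty_iff)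
    have xm: "v \<epsilon> x - \<phi> x < m0" using x(2)[OF \<open>z \<in> cball p R2\<close>] vz \<open>b \<le> \<phi> z\<close> by linarith
    define h where "h = x - p"
    have xh: "x = p + h" unfolding h_def by simp
    have "norm h \<le> R2" using x(1) unfolding h_def by (simp add: dist_norm norm_minus_commute)
    moreover have "norm h \<noteq> R2" using \<phi>_edge[of h] xm ge[of x] unfolding xh by force
    ultimately have h: "norm h < R2" by simp
    have "\<forall>\<^sub>F y in nhds x. y \<in> ball p R2"
      using h by (intro eventually_nhds_in_open) (auto simp: xh dist_norm)
    then have "\<forall>\<^sub>F y in nhds x. v \<epsilon> x - (1/2) * ((x - p) \<bullet> ((s^3 *\<^sub>R A) *v (x - p))) \<le> v \<epsilon> y - (1/2) * ((y - p) \<bullet> ((s^3 *\<^sub>R A) *v (y - p)))"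
    proof eventually_elim
      case (elim y)
      then have "y \<in> cball p R2" by auto
      then show ?case using x(2)[of y] unfolding \<phi>_def by simp
    qed
    then have "V x \<le> \<epsilon> * v \<epsilon> x - \<epsilon> * trace (s^3 *\<^sub>R A) + (norm ((s^3 *\<^sub>R A) *v (x - p)))\<^sup>2"
      by (rule visc_supersolution_quadratic[OF solution_props(4)[OF \<epsilon>(1)] AT])
    then have 1: "V (p + h) \<le> \<epsilon> * v \<epsilon> x - \<epsilon> * (s^3 * k) + s^6 * (norm (A *v h))\<^sup>2"
      unfolding xh by (simp add: trace_scaleR k scaleR_matrix_vector_assoc[symmetric] power_mult_distrib power_mult[symmetric])
    have "v \<epsilon> x < \<phi> x" using xm m0 by simp
    then have "\<epsilon> * v \<epsilon> x < \<epsilon> * \<phi> x" using \<epsilon> by simp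
    moreover have "\<epsilon> * \<phi> x \<le> \<epsilon> * (s^3 * k + (1/2) * s^3 * (h \<bullet> (A *v h)))"
      unfolding xh \<phi>h using bk \<epsilon> by (intro mult_left_mono) auto
    ultimately have "s\<^sup>2 * (norm (A *v h))\<^sup>2 < \<epsilon> * ((1/2) * s^3 * (h \<bullet> (A *v h))) + s^6 * (norm (A *v h))\<^sup>2"
      using 1 R(3)[of h] h R2(2) by (simp add: distrib_left)
    moreover have "\<epsilon> * ((1/2) * s^3 * (h \<bullet> (A *v h))) \<le> (s^2 - s^6) * (norm (A *v h))\<^sup>2"
    proof -
      have "(1/2) * s^3 * (h \<bullet> (A *v h)) \<le> 1 * (h \<bullet> (A *v h))" using Aq[of h] s3 by (intro mult_right_mono) auto
      then have "\<epsilon> * ((1/2) * s^3 * (h \<bullet> (A *v h))) \<le> ((s^2 - s^6) * l) * (h \<bullet> (A *v h))"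
        using \<epsilon> Aq[of h] s3 unfolding \<epsilon>0_def by (intro mult_mono) auto
      also have "\<dots> = (s^2 - s^6) * (l * (h \<bullet> (A *v h)))" by simp
      also have "\<dots> \<le> (s^2 - s^6) * (norm (A *v h))\<^sup>2"
      proof (rule mult_left_mono)
        have "l * (h \<bullet> (A *v h)) \<le> l * (norm h * norm (A *v h))" using l norm_cauchy_schwarz by (intro mult_left_mono) auto
        also have "\<dots> \<le> norm (A *v h) * norm (A *v h)"
          using l(3)[of h] mult_right_mono[OF l(3)[of h] norm_ge_zero[of "A *v h"]] by (simp add: mult.assoc)
        finally show "l * (h \<bullet> (A *v h)) \<le> (norm (A *v h))\<^sup>2" by (simp add: power2_eq_square)
      qed (use s23 in simp)
      finally show ?thesis .
    qed
    ultimately show False by (simp add: algebra_simps)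
  qed
qed

lemma V_away_from_wells:
  assumes r: "r > 0"
  obtains \<sigma> where "\<sigma> > 0" "\<And>y. (\<And>p k. p \<in> P \<Longrightarrow> k \<in> int_lattice \<Longrightarrow> r \<le> norm (y + k - p)) \<Longrightarrow> \<sigma> \<le> sqrt (V y)"
proof -
  define D where "D = {y. \<forall>p\<in>P. \<forall>k\<in>int_lattice. r \<le> norm (y + k - p)}"
  have "D = (\<Inter>p\<in>P. \<Inter>k\<in>int_lattice. {y. r \<le> norm (y + k - p)})" unfolding D_def by auto
  then have "closed D" by (auto intro!: closed_INT closed_Collect_le continuous_intros)
  then have comp: "compact (cbox 0 1 \<inter> D)" by (intro compact_Int_closed) auto
  have pos: "V y > 0" if "y \<in> D" for y
  proof (rule ccontr)
    assume "\<not> V y > 0"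
    then have "V y = 0" using nonneg[of y] by simp
    then obtain p where "p \<in> P" "y - p \<in> int_lattice" using zeros by blast
    then have "r \<le> norm (y + - (y - p) - p)" using that int_lattice_minus unfolding D_def by blast
    then show False using r by simp
  qed
  have ex: "\<exists>\<sigma>>0. \<forall>y\<in>cbox 0 1 \<inter> D. \<sigma> \<le> sqrt (V y)"
  proof (cases "cbox 0 1 \<inter> D = {}")
    case True then show ?thesis by (intro exI[of _ 1]) auto
  next
    case False
    have "continuous_on (cbox 0 1 \<inter> D) (\<lambda>y. sqrt (V y))" by (intro continuous_intros continuous_on_subset[OF cont]) auto
    then obtain y0 where "y0 \<in> cbox 0 1 \<inter> D" "\<And>y. y \<in> cbox 0 1 \<inter> D \<Longrightarrow> sqrt (V y0) \<le> sqrt (V y)"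
      using continuous_attains_inf[OF comp False] by blast
    then show ?thesis using pos[of y0] by (intro exI[of _ "sqrt (V y0)"]) auto
  qed
  then obtain \<sigma> where \<sigma>: "\<sigma> > 0" "\<And>y. y \<in> cbox 0 1 \<inter> D \<Longrightarrow> \<sigma> \<le> sqrt (V y)" by blast
  show ?thesis
  proof (rule that[OF \<sigma>(1)])
    fix y assume y: "\<And>p k. p \<in> P \<Longrightarrow> k \<in> int_lattice \<Longrightarrow> r \<le> norm (y + k - p)"
    obtain j where j: "j \<in> int_lattice" "y + j \<in> cbox 0 1" using lattice_shift_unit_cube by blast
    have "y + j \<in> D" unfolding D_def
    proof (intro CollectI ballI)
      fix p k :: "real ^ 'n" assume "p \<in> P" "k \<in> int_lattice"
      then show "r \<le> norm (y + j + k - p)" using y[of p "j + k"] int_lattice_add[OF j(1)] by (simp add: add.assoc)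
    qed
    then have "\<sigma> \<le> sqrt (V (y + j))" using \<sigma>(2) j by blast
    then show "\<sigma> \<le> sqrt (V y)" using torus_fun_shift[OF periodic j(1)] by simp
  qed
qed

text \<open>Let \<open>m0\<close> be the minimum of \<open>v \<epsilon> z - u y + |y - z|\<^sup>2 / (2 \<eta>)\<close>, written with \<open>h = y - z\<close>, and suppose that it
  is negative. Varying \<open>y\<close> along the segment from \<open>y\<close> towards \<open>z\<close> gives \<open>|h| / \<eta> \<le> s * sqrt (V y)\<close> up to a small error,
  and varying \<open>z\<close> shows that \<open>v \<epsilon>\<close> is touched from below by a paraboloid with this slope. Since \<open>y\<close> and \<open>z\<close>
  are close, the equation then gives \<open>V z \<le> s\<^sup>2 V y\<close> up to small errors, which is false away from the zeros of \<open>V\<close>.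
  If \<open>y\<close> is near a zero, the barrier at this well gives a contradiction.\<close>

theorem lower_bound: "\<exists>\<epsilon>0>0. \<forall>\<epsilon>. 0 < \<epsilon> \<longrightarrow> \<epsilon> < \<epsilon>0 \<longrightarrow> (\<forall>z. u z \<le> v \<epsilon> z)"
proof -
  define n where "n = real CARD('n)"
  have n: "n > 0" unfolding n_def by simp
  have "\<exists>r0 \<epsilon>0. r0 > 0 \<and> \<epsilon>0 > 0 \<and> (\<forall>\<epsilon> m0 y z. 0 < \<epsilon> \<longrightarrow> \<epsilon> < \<epsilon>0 \<longrightarrow> m0 \<le> 0 \<longrightarrow> (\<forall>z. m0 \<le> v \<epsilon> z - u z) \<longrightarrow>
       norm (y - p) < r0 \<longrightarrow> norm (z - p) < r0 \<longrightarrow> u y + m0 < v \<epsilon> z)" if "p \<in> P" for p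
    by (rule well_barrier[OF that]) blast
  then obtain r0 e0 where re: "\<And>p. p \<in> P \<Longrightarrow> r0 p > 0" "\<And>p. p \<in> P \<Longrightarrow> e0 p > 0"
    "\<And>p \<epsilon> m0 y z. p \<in> P \<Longrightarrow> 0 < \<epsilon> \<Longrightarrow> \<epsilon> < e0 p \<Longrightarrow> m0 \<le> 0 \<Longrightarrow> (\<forall>z. m0 \<le> v \<epsilon> z - u z) \<Longrightarrow>
       norm (y - p) < r0 p \<Longrightarrow> norm (z - p) < r0 p \<Longrightarrow> u y + m0 < v \<epsilon> z" by metis
  define r where "r = Min (r0 ` P)"
  define e1 where "e1 = Min (e0 ` P)"
  have r: "r > 0" "\<And>p. p \<in> P \<Longrightarrow> r \<le> r0 p" unfolding r_def using re finP neP by auto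
  have e1: "e1 > 0" "\<And>p. p \<in> P \<Longrightarrow> e1 \<le> e0 p" unfolding e1_def using re finP neP by auto
  have "r / 2 > 0" using r by simp
  then obtain \<sigma> where \<sigma>: "\<sigma> > 0"
    "\<And>y. (\<And>p k. p \<in> P \<Longrightarrow> k \<in> int_lattice \<Longrightarrow> r / 2 \<le> norm (y + k - p)) \<Longrightarrow> \<sigma> \<le> sqrt (V y)"
    using V_away_from_wells by blast
  \<comment> \<open>With this error, \<open>sqrt V - e\<close> still exceeds \<open>s * (sqrt V + e)\<close> wherever \<open>sqrt V \<ge> \<sigma>\<close>.\<close>
  define e where "e = \<sigma> * (1 - s) / 4"
  have e: "e > 0" unfolding e_def using \<sigma> s by simp
  obtain d where d: "d > 0" "\<And>y z. dist y z < d \<Longrightarrow> \<bar>sqrt (V y) - sqrt (V z)\<bar> < e"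
    using sqrt_V_uniformly_continuous[OF e] by blast
  obtain C where C: "C > 0" "\<And>y. u y \<le> C" by (rule u_bounded) (rule that; assumption)
  \<comment> \<open>An upper bound for the distance of the two doubled variables.\<close>
  define \<mu> where "\<mu> = min (min (r / 2) d) 1"
  have \<mu>: "\<mu> > 0" "\<mu> \<le> r / 2" "\<mu> \<le> d" "\<mu> \<le> 1" unfolding \<mu>_def using r d by auto
  define S where "S = sqrt B + 1"
  have S: "S > 0" unfolding S_def using B_nonneg by (simp add: add_nonneg_pos)
  define \<eta> where "\<eta> = \<mu> / (2 * S)"
  have \<eta>: "\<eta> > 0" "2 * \<eta> * S = \<mu>" unfolding \<eta>_def using \<mu> S by simp_all
  have \<eta>B: "2 * \<eta> * sqrt B < \<mu>" using \<eta> unfolding S_def by (simp add: distrib_left)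
  define e2 where "e2 = (1 - s) * \<sigma>\<^sup>2 / 4 / (C + n / \<eta>)"
  have Cn: "C + n / \<eta> > 0" using C n \<eta> by (simp add: add_pos_pos)
  have e2: "e2 > 0" unfolding e2_def using s \<sigma> Cn by simp
  show ?thesis
  proof (intro exI[of _ "min e1 e2"] conjI allI impI)
    show "0 < min e1 e2" using e1 e2 by simp
    fix \<epsilon> z0 assume "0 < \<epsilon>" "\<epsilon> < min e1 e2"
    then have \<epsilon>: "0 < \<epsilon>" "\<epsilon> < e1" "\<epsilon> < e2" by auto
    note v = solution_props[OF \<epsilon>(1)]
    define F where "F = (\<lambda>(z, h). v \<epsilon> z - u (z + h) + (norm h)\<^sup>2 / (2 * \<eta>))"
    let ?K = "cbox 0 (1 :: real ^ 'n) \<times> cball (0 :: real ^ 'n) 1"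
    have "compact ?K" by (intro compact_Times) auto
    moreover have "(0, 0) \<in> ?K" by (simp add: mem_box_cart)
    moreover have "continuous_on ?K F" unfolding F_def case_prod_unfold
      using \<eta> by (intro continuous_intros continuous_on_compose2[OF v(2)] continuous_on_compose2[OF u_continuous]) auto
    ultimately obtain zh where zh: "zh \<in> ?K" "\<And>w. w \<in> ?K \<Longrightarrow> F zh \<le> F w"
      using continuous_attains_inf[of ?K F] by blast
    obtain z h where zh_eq: "zh = (z, h)" by (cases zh)
    define m0 where "m0 = F (z, h)"
    have h1: "norm h \<le> 1" using zh(1) zh_eq by simp
    have minF: "m0 \<le> F (z', h')" if "norm h' \<le> 1" for z' h'
    proof -
      obtain k where k: "k \<in> int_lattice" "z' + k \<in> cbox 0 1" using lattice_shift_unit_cube by blast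
      have "u (z' + k + h') = u ((z' + h') + k)" by (simp add: ac_simps)
      then have "F (z' + k, h') = F (z', h')"
        unfolding F_def using torus_fun_shift[OF v(1) k(1)] torus_fun_shift[OF u_periodic k(1)] by simp
      moreover have "F zh \<le> F (z' + k, h')" using k that by (intro zh(2)) auto
      ultimately show ?thesis unfolding m0_def zh_eq by simp
    qed
    have ge: "m0 \<le> v \<epsilon> x - u x" for x using minF[of 0 x] unfolding F_def by simp
    have "0 \<le> m0"
    proof (rule ccontr)
      assume "\<not> 0 \<le> m0"
      then have neg: "m0 < 0" by simp
      define y where "y = z + h"
      have vz: "v \<epsilon> z = u y - (norm h)\<^sup>2 / (2 * \<eta>) + m0" unfolding m0_def F_def y_def by simp
      have h2: "norm h \<le> 2 * \<eta> * sqrt B"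
      proof (cases "h = 0")
        case False
        have "(norm h)\<^sup>2 / (2 * \<eta>) \<le> u y - u z" using ge[of z] vz by simp
        also have "\<dots> \<le> sqrt B * norm h" using u_lipschitz[of y z] by (simp add: y_def dist_norm abs_le_iff)
        finally have "norm h * norm h \<le> (2 * \<eta> * sqrt B) * norm h" using \<eta> by (simp add: divide_le_eq power2_eq_square algebra_simps)
        then show ?thesis using False by simp
      qed (use \<eta> B_nonneg in simp)
      then have h\<mu>: "norm h < \<mu>" using \<eta>B by simp
      have far: "r / 2 \<le> norm (y + k - p)" if pk: "p \<in> P" "k \<in> int_lattice" for p k
      proof (rule ccontr)
        assume near: "\<not> r / 2 \<le> norm (y + k - p)"
        have "norm (z + k - p) \<le> norm (y + k - p) + norm h"
          using norm_triangle_ineq4[of "y + k - p" h] by (simp add: y_def algebra_simps)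
        then have "norm (z + k - p) < r0 p" "norm (y + k - p) < r0 p"
          using near h\<mu> \<mu>(2) r(1) r(2)[OF pk(1)] by auto
        then have "u (y + k) + m0 < v \<epsilon> (z + k)"
          using re(3)[OF pk(1) \<epsilon>(1), of m0 "y + k" "z + k"] \<epsilon>(2) e1(2)[OF pk(1)] neg ge by auto
        then have "u y + m0 < v \<epsilon> z"
          using torus_fun_shift[OF v(1) pk(2)] torus_fun_shift[OF u_periodic pk(2)] by simp
        moreover have "0 \<le> (norm h)\<^sup>2 / (2 * \<eta>)" using \<eta> by simp
        ultimately show False using vz by simp
      qed
      have \<sigma>y: "\<sigma> \<le> sqrt (V y)" using \<sigma>(2) far by blast
      define M where "M = sqrt (V y) + e"
      have M0: "M > 0" unfolding M_def using \<sigma>y \<sigma> e by simp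
      \<comment> \<open>Variation of \<open>y\<close>: replace \<open>h\<close> by \<open>(1 - t) h\<close> and let \<open>t\<close> tend to 0.\<close>
      have slope: "norm h / \<eta> \<le> s * M"
      proof (cases "h = 0")
        case False
        have "norm h * (2 - t) / (2 * \<eta>) \<le> s * M" if t: "0 < t" "t < 1" for t
        proof -
          have "V x \<le> M\<^sup>2" if "x \<in> closed_segment (y - t *\<^sub>R h) y" for x
          proof -
            have "dist x y \<le> dist (y - t *\<^sub>R h) y" using segment_bound[OF that] by (simp add: dist_norm norm_minus_commute)
            also have "\<dots> = t * norm h" using t by (simp add: dist_norm)
            also have "\<dots> \<le> 1 * norm h" using t by (intro mult_right_mono) auto
            finally have "dist x y < d" using h\<mu> \<mu> by simp
            then have "sqrt (V x) \<le> M" using d(2)[of x y] unfolding M_def by simp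
            then have "(sqrt (V x))\<^sup>2 \<le> M\<^sup>2" using nonneg[of x] by (intro power_mono) auto
            then show ?thesis using nonneg[of x] by simp
          qed
          then have "u y \<le> u (y - t *\<^sub>R h) + s * sqrt (M\<^sup>2) * dist (y - t *\<^sub>R h) y" by (rule u_diff_le_segment)
          then have 1: "u y \<le> u (y - t *\<^sub>R h) + s * M * (t * norm h)" using M0 t by (simp add: dist_norm)
          have nh: "norm ((1 - t) *\<^sub>R h) = (1 - t) * norm h" using t by simp
          have "(1 - t) * norm h \<le> 1" using h1 t mult_le_one[of "1 - t" "norm h"] by simp
          then have "m0 \<le> F (z, (1 - t) *\<^sub>R h)" by (intro minF) (simp only: nh)
          also have "F (z, (1 - t) *\<^sub>R h) = v \<epsilon> z - u (y - t *\<^sub>R h) + ((1 - t) * norm h)\<^sup>2 / (2 * \<eta>)"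
            unfolding F_def prod.case nh by (simp add: y_def algebra_simps)
          finally have "(norm h)\<^sup>2 / (2 * \<eta>) - ((1 - t) * norm h)\<^sup>2 / (2 * \<eta>) \<le> s * M * (t * norm h)"
            using vz 1 by linarith
          moreover have "(norm h)\<^sup>2 / (2 * \<eta>) - ((1 - t) * norm h)\<^sup>2 / (2 * \<eta>) = (t * norm h) * (norm h * (2 - t) / (2 * \<eta>))"
            by (simp add: diff_divide_distrib[symmetric] power2_eq_square algebra_simps)
          ultimately have "(t * norm h) * (norm h * (2 - t) / (2 * \<eta>)) \<le> (t * norm h) * (s * M)" by (simp add: mult_ac)
          moreover have "t * norm h > 0" using t False by simp
          ultimately show ?thesis by (rule mult_left_le_imp_le)
        qed
        then have ev: "\<forall>\<^sub>F t in at_right 0. norm h * (2 - t) / (2 * \<eta>) \<le> s * M"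
          unfolding eventually_at_right_field by (intro exI[of _ 1]) auto
        have "((\<lambda>t. norm h * (2 - t) / (2 * \<eta>)) \<longlongrightarrow> norm h * (2 - 0) / (2 * \<eta>)) (at_right 0)"
          using \<eta> by (intro tendsto_intros) auto
        then have "norm h * (2 - 0) / (2 * \<eta>) \<le> s * M" using tendsto_upperbound[OF _ ev] by simp
        then show ?thesis by simp
      qed (use s M0 in simp)
      \<comment> \<open>Variation of \<open>z\<close> with \<open>y\<close> fixed.\<close>
      let ?X = "mat (- 1 / \<eta>) :: real ^ 'n ^ 'n"
      have Xq: "(1/2) * ((x - y) \<bullet> (?X *v (x - y))) = - ((norm (y - x))\<^sup>2 / (2 * \<eta>))" for x
        unfolding mat_vector_mult by (simp add: dot_square_norm norm_minus_commute)
      have "V z \<le> \<epsilon> * v \<epsilon> z - \<epsilon> * trace ?X + (norm (?X *v (z - y)))\<^sup>2"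
      proof (rule visc_supersolution_quadratic[OF v(4)])
        show "transpose ?X = ?X" by (simp add: transpose_mat)
        have "\<forall>\<^sub>F x in nhds z. x \<in> ball y 1"
          using h\<mu> \<mu> by (intro eventually_nhds_in_open) (auto simp: y_def dist_norm)
        then show "\<forall>\<^sub>F x in nhds z. v \<epsilon> z - (1/2) * ((z - y) \<bullet> (?X *v (z - y))) \<le> v \<epsilon> x - (1/2) * ((x - y) \<bullet> (?X *v (x - y)))"
        proof eventually_elim
          case (elim x)
          then have "m0 \<le> F (x, y - x)" by (intro minF) (simp add: dist_norm)
          then have "m0 \<le> v \<epsilon> x - u y + (norm (y - x))\<^sup>2 / (2 * \<eta>)" unfolding F_def by simp
          moreover have "norm (y - z) = norm h" unfolding y_def by simp
          ultimately show ?case unfolding Xq using vz by simp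
        qed
      qed
      moreover have "trace ?X = - (n / \<eta>)" unfolding trace_def mat_def n_def by simp
      moreover have "norm (?X *v (z - y)) = norm h / \<eta>" unfolding mat_vector_mult y_def using \<eta> by simp
      ultimately have 1: "V z \<le> \<epsilon> * v \<epsilon> z + \<epsilon> * (n / \<eta>) + (norm h / \<eta>)\<^sup>2" by simp
      have "v \<epsilon> z \<le> C"
      proof -
        have "0 \<le> (norm h)\<^sup>2 / (2 * \<eta>)" using \<eta> by simp
        then show ?thesis using vz neg C(2)[of y] by simp
      qed
      then have "\<epsilon> * v \<epsilon> z \<le> \<epsilon> * C" using \<epsilon> by simp
      moreover have "(norm h / \<eta>)\<^sup>2 \<le> (s * M)\<^sup>2" using slope \<eta> by (intro power_mono) auto
      moreover have "\<epsilon> * (C + n / \<eta>) < (1 - s) * \<sigma>\<^sup>2 / 4"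
        using \<epsilon>(3) unfolding e2_def pos_less_divide_eq[OF Cn] .
      ultimately have 2: "V z < (1 - s) * \<sigma>\<^sup>2 / 4 + (s * M)\<^sup>2" using 1 unfolding distrib_left by linarith
      define a where "a = sqrt (V y)"
      have a: "a \<ge> \<sigma>" unfolding a_def by (rule \<sigma>y)
      have e4: "e \<le> \<sigma> / 4" unfolding e_def using \<sigma> s by (simp add: mult_left_le)
      have "dist y z < d" using h\<mu> \<mu> by (simp add: y_def dist_norm)
      then have "a - e \<le> sqrt (V z)" using d(2)[of y z] unfolding a_def by simp
      moreover have "0 \<le> a - e" using a e4 \<sigma> by simp
      ultimately have "(a - e)\<^sup>2 \<le> (sqrt (V z))\<^sup>2" by (intro power_mono) auto
      then have 3: "(a - e)\<^sup>2 \<le> V z" using nonneg[of z] by simp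
      have "(a - e)\<^sup>2 - (s * M)\<^sup>2 = ((a - e) - s * (a + e)) * ((a - e) + s * (a + e))"
        unfolding M_def a_def[symmetric] by (simp add: power2_eq_square algebra_simps)
      also have "\<dots> \<ge> ((1 - s) * \<sigma> / 2) * (\<sigma> / 2)"
      proof (rule mult_mono)
        have "(1 - s) * \<sigma> \<le> (1 - s) * a" using a s by (intro mult_left_mono) auto
        moreover have "s * e \<le> e" using s e by simp
        moreover have "(1 - s) * \<sigma> = 4 * e" unfolding e_def by simp
        moreover have "(a - e) - s * (a + e) = (1 - s) * a - e - s * e" by (simp add: algebra_simps)
        ultimately show "(1 - s) * \<sigma> / 2 \<le> (a - e) - s * (a + e)" by linarith
        have "0 \<le> s * (a + e)" using s a \<sigma> e by simp
        then show "\<sigma> / 2 \<le> (a - e) + s * (a + e)" using a e4 \<sigma> by linarith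
        then show "0 \<le> (a - e) - s * (a + e)"
          using \<open>(1 - s) * \<sigma> / 2 \<le> (a - e) - s * (a + e)\<close> \<sigma> s by (smt (verit) divide_nonneg_pos mult_nonneg_nonneg)
      qed (use \<sigma> in simp)
      finally have "(1 - s) * \<sigma>\<^sup>2 / 4 \<le> (a - e)\<^sup>2 - (s * M)\<^sup>2" by (simp add: power2_eq_square)
      then show False using 2 3 by linarith
    qed
    then show "u z0 \<le> v \<epsilon> z0" using ge[of z0] by simp
  qed
qed

end

context potential_wells
begin

text \<open>The lower bound \<open>s\<^sup>4 vstar \<le> v \<epsilon>\<close> loses at most \<open>(1 - s\<^sup>4) max vstar\<close>, which vanishes as \<open>s\<close> tends to 1.\<close>

theorem uniform_convergence: "uniform_limit UNIV v vstar (at_right 0)"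
proof (rule uniform_limitI)
  fix \<eta> :: real assume \<eta>: "\<eta> > 0"
  have up: "\<exists>\<epsilon>0>0. \<forall>\<epsilon>. 0 < \<epsilon> \<longrightarrow> \<epsilon> < \<epsilon>0 \<longrightarrow> (\<forall>y. v \<epsilon> y \<le> kappa V p + mane V p y + \<eta> / 2)" if "p \<in> P" for p
    using upper_bound[OF V_well[OF that] hess_pd[OF that], of "\<eta> / 2"] \<eta> by simp
  have "\<forall>\<^sub>F \<epsilon> in at_right 0. \<forall>p\<in>P. \<forall>y. v \<epsilon> y \<le> kappa V p + mane V p y + \<eta> / 2"
    using up finP by (intro eventually_ball_finite) (auto simp: eventually_at_right_field)
  then have U: "\<forall>\<^sub>F \<epsilon> in at_right 0. \<forall>y. v \<epsilon> y \<le> vstar y + \<eta> / 2"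
  proof eventually_elim
    case (elim \<epsilon>)
    show ?case
    proof
      fix y
      obtain p where "p \<in> P" "vstar y = kappa V p + mane V p y" by (rule vstar_attained)
      then show "v \<epsilon> y \<le> vstar y + \<eta> / 2" using elim by simp
    qed
  qed
  obtain C where C: "C > 0" "\<And>y. vstar y \<le> C"
  proof -
    obtain p where p: "p \<in> P" using neP by blast
    have "continuous_on UNIV (mane V p)"
      by (rule lipschitz_on_continuous_on[OF lipschitz_onI[of UNIV "mane V p" "sqrt B"]])
        (use mane_lipschitz B_nonneg in \<open>auto simp: dist_real_def\<close>)
    then obtain D where D: "D > 0" "\<And>y. mane V p y \<le> D"
      by (rule torus_fun_bounded_above[OF mane_periodic]) (rule that; assumption)
    have "vstar y \<le> kappa V p + D" for y using vstar_le[OF p, of y] D(2)[of y] by simp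
    then show ?thesis using that[of "kappa V p + D"] kappa_pos[OF p] D(1) by simp
  qed
  have "((\<lambda>s. (1 - s^4) * C) \<longlongrightarrow> (1 - 1^4) * C) (at_left 1)" by (intro tendsto_intros)
  then have "\<forall>\<^sub>F s in at_left 1. (1 - s^4) * C < \<eta>" using \<eta> by (intro order_tendstoD) auto
  moreover have "\<forall>\<^sub>F s in at_left (1::real). s \<in> {0<..<1}" by (intro eventually_at_left_real) simp
  ultimately have "\<forall>\<^sub>F s in at_left 1. (1 - s^4) * C < \<eta> \<and> 0 < s \<and> s < 1" by eventually_elim auto
  then obtain s where s01: "(1 - s^4) * C < \<eta>" "0 < s" "s < 1"
    using eventually_happens'[OF trivial_limit_at_left_real] by blast
  interpret lower_barrier V B v P s by unfold_locales (use s01 in auto)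
  have "\<forall>\<^sub>F \<epsilon> in at_right 0. \<forall>z. u z \<le> v \<epsilon> z" using lower_bound by (auto simp: eventually_at_right_field)
  then have L: "\<forall>\<^sub>F \<epsilon> in at_right 0. \<forall>y. vstar y - \<eta> < v \<epsilon> y"
  proof eventually_elim
    case (elim \<epsilon>)
    show ?case
    proof
      fix y
      have "(1 - s^4) * vstar y \<le> (1 - s^4) * C" using C s01 by (intro mult_left_mono) (auto simp: power_le_one)
      then have "(1 - s^4) * vstar y < \<eta>" using s01(1) by linarith
      then have "vstar y - \<eta> < s^4 * vstar y" by (simp add: algebra_simps)
      also have "\<dots> \<le> u y" by (rule u_ge_vstar)
      finally show "vstar y - \<eta> < v \<epsilon> y" using elim by (meson order_less_le_trans)
    qed
  qed
  show "\<forall>\<^sub>F \<epsilon> in at_right 0. \<forall>y\<in>UNIV. dist (v \<epsilon> y) (vstar y) < \<eta>"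
    using U L
  proof eventually_elim
    case (elim \<epsilon>)
    show ?case
    proof
      fix y
      show "dist (v \<epsilon> y) (vstar y) < \<eta>" using elim(1)[rule_format, of y] elim(2)[rule_format, of y] \<eta>
        by (simp add: dist_real_def abs_less_iff)
    qed
  qed
qed

end

theorem theorem1p1:
  fixes V :: "real ^ 'n \<Rightarrow> real"
    and m :: nat
    and x :: "nat \<Rightarrow> real ^ 'n"
    and v :: "real \<Rightarrow> real ^ 'n \<Rightarrow> real"
  assumes "torus_fun V" and "C2 V" and "\<And>z. 0 \<le> V z"
    and "1 \<le> m"
    and "\<And>i j. i \<in> {1..m} \<Longrightarrow> j \<in> {1..m} \<Longrightarrow> i \<noteq> j \<Longrightarrow> x i - x j \<notin> int_lattice"
    and "{z. V z = 0} = {z. \<exists>i\<in>{1..m}. z - x i \<in> int_lattice}"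
    and "\<And>i. i \<in> {1..m} \<Longrightarrow> positive_definite (hess V (x i))"
    and "\<And>\<epsilon>. 0 < \<epsilon> \<Longrightarrow> visc_solution \<epsilon> V (v \<epsilon>)"
  shows "uniform_limit UNIV v (\<lambda>z. Min ((\<lambda>i. kappa V (x i) + mane V (x i) z) ` {1..m})) (at_right 0)"
proof -
  have cV: "continuous_on UNIV V" by (rule C2_continuous[OF assms(2)])
  obtain B where VB: "\<And>y. V y \<le> B"
    by (rule torus_fun_bounded_above[OF assms(1) cV]) (rule that; assumption)
  interpret potential_wells V B v "x ` {1..m}"
  proof unfold_locales
    show "V z = 0 \<longleftrightarrow> (\<exists>p\<in>x ` {1..m}. z - p \<in> int_lattice)" for z
      using assms(6) by (auto simp: set_eq_iff)
    show "p - q \<notin> int_lattice" if "p \<in> x ` {1..m}" "q \<in> x ` {1..m}" "p \<noteq> q" for p q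
      using that assms(5) by blast
    show "x ` {1..m} \<noteq> {}" using assms(4) by auto
  qed (use assms cV VB in auto)
  have "vstar = (\<lambda>z. Min ((\<lambda>i. kappa V (x i) + mane V (x i) z) ` {1..m}))"
    unfolding vstar_def by (simp add: image_image)
  then show ?thesis using uniform_convergence by simp
qed

end
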